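(* Let $k>0$, $\epsilon>0$ and $T>2\epsilon$. Let $F\in L^2(\mathbf{R}^3)$ with $\operatorname{supp}F\subset\overline{B_\epsilon}$, and let $w$ be the outgoing solution of $(\Delta+k^2)w+F=0$ in $\mathbf{R}^3$. Let $u$ be the solution of the Cauchy problem $$\begin{cases}(\partial_t^2-\Delta)u=0, & x\in\mathbf{R}^3,\ 0<t<T,\\ u(x,0)=0, & x\in\mathbf{R}^3,\\ \partial_tu(x,0)=F(x), & x\in\mathbf{R}^3,\end{cases}$$ and define $$G(x)=-e^{-ikT}\bigl(\partial_tu(x,T)+ik\,u(x,T)\bigr),\qquad x\in\mathbf{R}^3.$$ Let $\tilde w$ be the outgoing solution of $(\Delta+k^2)\tilde w+G=0$ in $\mathbf{R}^3$. Then $$w(x)+\tilde w(x)=0\qquad\text{for all }x\in\mathbf{R}^3\setminus\overline{B_{T+\epsilon}}.$$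
   Context: $B_r$ denotes the open ball in $\mathbf{R}^3$ of radius $r$ centered at the origin. Functions are complex valued. For compactly supported $H\in L^2(\mathbf{R}^3)$, the outgoing solution $v$ of $(\Delta+k^2)v+H=0$ in $\mathbf{R}^3$ is the solution satisfying the outgoing radiation condition $$\lim_{r\to\infty}r\left(\frac{\partial}{\partial r}-ik\right)v(r\omega)=0,\qquad r=|x|,\ \omega=\frac{x}{|x|},$$ with the limit uniform in $\omega\in S^2$; it is given by $$v(x)=\frac{1}{4\pi}\int_{\mathbf{R}^3}\frac{e^{ik|x-y|}}{|x-y|}\,H(y)\,dy .$$ The solution $u$ of the Cauchy problem for the wave equation is the usual (unique) finite-energy weak solution, $u\in C([0,T];H^1(\mathbf{R}^3))\cap C^1([0,T];L^2(\mathbf{R}^3))$. By finite propagation speed, $u(\cdot,T)$ and $\partial_tu(\cdot,T)$ are supported in $\overline{B_{T+\epsilon}}$, so $G$ is a compactly supported $L^2$ function. *)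

theory Defs
  imports "HOL-Analysis.Analysis"
begin

text \<open>Square-integrable functions are represented by functions defined everywhere;
  as usual, two of them that agree almost everywhere denote the same element of \<open>L\<^sup>2\<close>.\<close>

definition L2 :: "('a::euclidean_space \<Rightarrow> complex) set" where
  "L2 = {f \<in> borel_measurable lebesgue. integrable lebesgue (\<lambda>x. (cmod (f x))\<^sup>2)}"

definition L2_norm :: "('a::euclidean_space \<Rightarrow> complex) \<Rightarrow> real" where
  "L2_norm f = sqrt (integral\<^sup>L lebesgue (\<lambda>x. (cmod (f x))\<^sup>2))"

definition dir_deriv :: "'a::euclidean_space \<Rightarrow> ('a \<Rightarrow> complex) \<Rightarrow> 'a \<Rightarrow> complex" where
  "dir_deriv b f x = vector_derivative (\<lambda>s::real. f (x + s *\<^sub>R b)) (at 0)"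

primrec Ck :: "nat \<Rightarrow> ('a::euclidean_space \<Rightarrow> complex) \<Rightarrow> bool" where
  "Ck 0 f \<longleftrightarrow> continuous_on UNIV f"
| "Ck (Suc n) f \<longleftrightarrow> (\<forall>x. f differentiable (at x)) \<and> (\<forall>b\<in>Basis. Ck n (dir_deriv b f))"

definition test_function :: "'a::euclidean_space set \<Rightarrow> ('a \<Rightarrow> complex) \<Rightarrow> bool" where
  "test_function \<Omega> \<phi> \<longleftrightarrow>
     (\<forall>n. Ck n \<phi>) \<and> (\<exists>K. compact K \<and> K \<subseteq> \<Omega> \<and> (\<forall>x. x \<notin> K \<longrightarrow> \<phi> x = 0))"

definition laplacian :: "('a::euclidean_space \<Rightarrow> complex) \<Rightarrow> 'a \<Rightarrow> complex" where
  "laplacian f x = (\<Sum>b\<in>Basis. dir_deriv b (dir_deriv b f) x)"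

text \<open>The operator \<open>\<partial>\<^sub>t\<^sup>2 - \<Delta>\<close> on functions of the pair (time, space).\<close>

definition wave_op :: "(real \<times> 'a::euclidean_space \<Rightarrow> complex) \<Rightarrow> real \<Rightarrow> 'a \<Rightarrow> complex" where
  "wave_op \<psi> t x = dir_deriv (1, 0) (dir_deriv (1, 0) \<psi>) (t, x) - laplacian (\<lambda>y. \<psi> (t, y)) x"

definition weak_partial ::
    "'a::euclidean_space \<Rightarrow> ('a \<Rightarrow> complex) \<Rightarrow> ('a \<Rightarrow> complex) \<Rightarrow> bool" where
  "weak_partial b f g \<longleftrightarrow>
     (\<forall>\<phi>. test_function UNIV \<phi> \<longrightarrow>
        (LINT x|lebesgue. f x * dir_deriv b \<phi> x) = - (LINT x|lebesgue. g x * \<phi> x))"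

definition L2_continuous_on ::
    "real set \<Rightarrow> (real \<Rightarrow> 'a::euclidean_space \<Rightarrow> complex) \<Rightarrow> bool" where
  "L2_continuous_on S f \<longleftrightarrow>
     (\<forall>t\<in>S. f t \<in> L2) \<and>
     (\<forall>t\<in>S. ((\<lambda>s. L2_norm (\<lambda>x. f s x - f t x)) \<longlongrightarrow> 0) (at t within S))"

text \<open>Weak partial derivatives are unique up to null sets, so the existential quantifier
  below does not involve a choice: this is continuity for the norm
  \<open>(\<parallel>f\<parallel>\<^sup>2 + \<parallel>\<nabla>f\<parallel>\<^sup>2)\<^sup>1\<^sup>/\<^sup>2\<close> of \<open>H\<^sup>1\<close>.\<close>

definition H1_continuous_on ::
    "real set \<Rightarrow> (real \<Rightarrow> 'a::euclidean_space \<Rightarrow> complex) \<Rightarrow> bool" where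
  "H1_continuous_on S f \<longleftrightarrow>
     L2_continuous_on S f \<and>
     (\<forall>b\<in>Basis. \<exists>g. L2_continuous_on S g \<and> (\<forall>t\<in>S. weak_partial b (f t) (g t)))"

text \<open>Membership in \<open>C\<^sup>1(S; L\<^sup>2)\<close>, with \<open>f'\<close> the derivative; it is one-sided at the end points
  when \<open>S\<close> is a compact interval.\<close>

definition L2_C1_on ::
    "real set \<Rightarrow> (real \<Rightarrow> 'a::euclidean_space \<Rightarrow> complex) \<Rightarrow> (real \<Rightarrow> 'a \<Rightarrow> complex) \<Rightarrow> bool" where
  "L2_C1_on S f f' \<longleftrightarrow>
     L2_continuous_on S f \<and> L2_continuous_on S f' \<and>
     (\<forall>t\<in>S. ((\<lambda>s. L2_norm (\<lambda>x. (f s x - f t x) / complex_of_real (s - t) - f' t x)) \<longlongrightarrow> 0)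
              (at t within S))"

text \<open>Finite-energy weak solution \<open>u\<close> on \<open>[0, T]\<close>, with time derivative \<open>u'\<close>, of the Cauchy
  problem with data \<open>u = 0\<close>, \<open>u' = F\<close> at time \<open>0\<close>; the wave equation holds in the sense of
  distributions on \<open>(0, T) \<times> \<real>\<^sup>3\<close>. The integral is an iterated one because the representatives
  \<open>u t\<close>, chosen separately for each \<open>t\<close>, need not be jointly measurable in \<open>(t, x)\<close>.\<close>

definition wave_cauchy_solution ::
    "real \<Rightarrow> (real^3 \<Rightarrow> complex) \<Rightarrow> (real \<Rightarrow> real^3 \<Rightarrow> complex) \<Rightarrow> (real \<Rightarrow> real^3 \<Rightarrow> complex) \<Rightarrow> bool" where
  "wave_cauchy_solution T F u u' \<longleftrightarrow>
     H1_continuous_on {0..T} u \<and>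
     L2_C1_on {0..T} u u' \<and>
     (\<forall>\<psi>. test_function ({0<..<T} \<times> UNIV) \<psi> \<longrightarrow>
        (LINT t:{0..T}|lebesgue. (LINT x|lebesgue. u t x * wave_op \<psi> t x)) = 0) \<and>
     (AE x in lebesgue. u 0 x = 0) \<and>
     (AE x in lebesgue. u' 0 x = F x)"

definition outgoing_radiation :: "real \<Rightarrow> (real^3 \<Rightarrow> complex) \<Rightarrow> bool" where
  "outgoing_radiation k v \<longleftrightarrow>
     (\<forall>\<^sub>F r in at_top. \<forall>\<omega>\<in>sphere 0 1. (\<lambda>s::real. v (s *\<^sub>R \<omega>)) differentiable (at r)) \<and>
     uniform_limit (sphere 0 1)
       (\<lambda>r \<omega>. complex_of_real r *
          (vector_derivative (\<lambda>s. v (s *\<^sub>R \<omega>)) (at r) - \<i> * complex_of_real k * v (r *\<^sub>R \<omega>)))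
       (\<lambda>\<omega>. 0) at_top"

text \<open>Outgoing solution of \<open>(\<Delta> + k\<^sup>2) v + H = 0\<close>, the equation being understood in the sense of
  distributions. For \<open>H\<close> in \<open>L\<^sup>2\<close> solutions are in \<open>H\<^sup>2\<close> locally, hence, in dimension three, have
  a continuous representative; requiring \<open>v\<close> to be continuous selects it and gives a meaning to
  point values of \<open>v\<close>.\<close>

definition outgoing_solution ::
    "real \<Rightarrow> (real^3 \<Rightarrow> complex) \<Rightarrow> (real^3 \<Rightarrow> complex) \<Rightarrow> bool" where
  "outgoing_solution k H v \<longleftrightarrow>
     continuous_on UNIV v \<and>
     (\<forall>\<phi>. test_function UNIV \<phi> \<longrightarrow>
        (LINT x|lebesgue. v x * (laplacian \<phi> x + complex_of_real (k\<^sup>2) * \<phi> x)) +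
        (LINT x|lebesgue. H x * \<phi> x) = 0) \<and>
     outgoing_radiation k v"

end

theory Submission
  imports Defs
begin

text \<open>Fix \<open>x0\<close> outside the closed ball of radius \<open>T + \<epsilon>\<close> and put \<open>s = |x - x0|\<close>, \<open>W = w + w'\<close>.
  Let \<open>\<psi> = a(s) / s\<close> be a radial test function with \<open>a(s) = exp (i k s)\<close> for \<open>\<eta> \<le> s \<le> L\<close>. There
  \<open>\<psi>\<close> solves the Helmholtz equation, and by d'Alembert's formula the wave with final data
  \<open>(\<psi>, - i k \<psi>)\<close> at time \<open>T\<close> is \<open>exp (i k T) \<psi>\<close> at time \<open>0\<close> on the support of \<open>F\<close>. Pairing it with
  \<open>u\<close> gives \<open>\<integral> (F + G) \<psi> = 0\<close>, hence \<open>\<integral> W (\<Delta> + k\<^sup>2) \<psi> = 0\<close>. The function \<open>(\<Delta> + k\<^sup>2) \<psi>\<close> has one part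
  near \<open>x0\<close> and one part in the shell \<open>L \<le> s \<le> 2 L\<close>. On the shell \<open>W\<close> and \<open>\<psi>\<close> are both outgoing, so
  their product oscillates like \<open>exp (2 i k |x|)\<close>; two radial integrations by parts, which use nothing
  but the radiation condition, show that its contribution vanishes as \<open>L \<rightarrow> \<infinity>\<close>. The part near \<open>x0\<close> is an
  approximate multiple of the Dirac measure as \<open>\<eta> \<rightarrow> 0\<close>, so \<open>W x0 = 0\<close>.\<close>

section \<open>Smooth functions on the line\<close>

text \<open>No representation formula and no uniqueness theorem for the Helmholtz equation is
  invoked. The distributional equations only allow pairing with functions that are smooth
  everywhere, also at \<open>x0\<close>, where \<open>a(s) / s\<close> looks singular. Hence
  \<open>\<psi>\<close> is encoded as an average of a profile over an interval, which is smooth in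
  space without dividing by a norm. The profile comes from one function \<open>f\<close> on the line
  with \<open>a(s) = f(s) - f(-s)\<close>: on \<open>[\<eta>, L]\<close> it carries the exponential,
  on \<open>[-L, -\<eta>]\<close> it is constant, so that d'Alembert's formula at time
  \<open>0\<close> sees a single travelling exponential. The second obstacle is that the radiation
  condition speaks of a derivative only. It gives no decay of \<open>W\<close>, merely a logarithmic
  bound, and a shell of volume of order \<open>L^3\<close> against a weight of order
  \<open>L^-2\<close> would leave a divergent estimate; this is why the oscillation has to be
  exploited, and twice. The last ingredient is a sign: the second derivative of the step used near
  \<open>x0\<close> is negative on \<open>(0, 1)\<close>, so the limiting multiple of the Dirac
  measure is not zero.\<close>

coinductive smooth :: "(real \<Rightarrow> complex) \<Rightarrow> bool" where
  smoothI: "(\<And>x. (g has_vector_derivative g' x) (at x)) \<Longrightarrow> smooth g' \<Longrightarrow> smooth g"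

lemma smooth_deriv:
  assumes "smooth g"
  obtains g' where "\<And>x. (g has_vector_derivative g' x) (at x)" "smooth g'"
  using assms by (cases rule: smooth.cases) auto

text \<open>Coinduction in usable form: it is enough to exhibit a family that contains the function
  and is closed under differentiation. The closure properties below are choices of such a
  family.\<close>

lemma smooth_family:
  assumes "i \<in> I" "\<And>i. i \<in> I \<Longrightarrow> \<exists>j\<in>I. \<forall>x. (F i has_vector_derivative F j x) (at x)"
  shows "smooth (F i)"
  using assms(1)
proof (coinduction arbitrary: i)
  case smooth
  then obtain j where "j \<in> I" "\<forall>x. (F i has_vector_derivative F j x) (at x)"
    using assms(2) by blast
  then show ?case by (intro exI[of _ "F i"] exI[of _ "F j"]) auto
qed

lemma smooth_vector_derivative:
  assumes "smooth g" "\<And>x. (g has_vector_derivative g' x) (at x)"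
  shows "smooth g'"
proof -
  obtain h where h: "\<And>x. (g has_vector_derivative h x) (at x)" "smooth h"
    using smooth_deriv[OF assms(1)] by metis
  have "h = g'" using h(1) assms(2) vector_derivative_unique_at by blast
  then show ?thesis using h by simp
qed

lemma smooth_continuous: "smooth g \<Longrightarrow> continuous_on S g"
  by (rule continuous_at_imp_continuous_on)
    (erule smooth_deriv, auto intro!: has_vector_derivative_continuous)

text \<open>Products alone are not closed under differentiation, but finite sums of products are, by
  the Leibniz rule; lists of factor pairs index the family.\<close>

lemma smooth_sum_mult:
  assumes "\<forall>(f, g)\<in>set xs. smooth f \<and> smooth g"
  shows "smooth (\<lambda>x. \<Sum>(f, g)\<leftarrow>xs. f x * g x)"
proof (rule smooth_family[of xs "{xs. \<forall>(f, g)\<in>set xs. smooth f \<and> smooth g}"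
      "\<lambda>xs x. \<Sum>(f, g)\<leftarrow>xs. f x * g x"])
  fix xs :: "((real \<Rightarrow> complex) \<times> (real \<Rightarrow> complex)) list"
  assume "xs \<in> {xs. \<forall>(f, g)\<in>set xs. smooth f \<and> smooth g}"
  then show "\<exists>ys\<in>{xs. \<forall>(f, g)\<in>set xs. smooth f \<and> smooth g}.
      \<forall>x. ((\<lambda>x. \<Sum>(f, g)\<leftarrow>xs. f x * g x) has_vector_derivative (\<Sum>(f, g)\<leftarrow>ys. f x * g x)) (at x)"
  proof (induction xs)
    case Nil
    show ?case by (intro bexI[of _ "[]"]) auto
  next
    case (Cons p xs)
    obtain f g where p: "p = (f, g)" by (cases p)
    obtain ys where ys: "\<forall>(f, g)\<in>set ys. smooth f \<and> smooth g"
      "\<And>x. ((\<lambda>x. \<Sum>(f, g)\<leftarrow>xs. f x * g x) has_vector_derivative (\<Sum>(f, g)\<leftarrow>ys. f x * g x)) (at x)"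
      using Cons by auto
    obtain f' where f': "\<And>x. (f has_vector_derivative f' x) (at x)" "smooth f'"
      using Cons.prems smooth_deriv[of f] p by auto
    obtain g' where g': "\<And>x. (g has_vector_derivative g' x) (at x)" "smooth g'"
      using Cons.prems smooth_deriv[of g] p by auto
    let ?ys = "(f, g') # (f', g) # ys"
    have "((\<lambda>x. \<Sum>(f, g)\<leftarrow>p # xs. f x * g x) has_vector_derivative (\<Sum>(f, g)\<leftarrow>?ys. f x * g x)) (at x)" for x
      unfolding p
      by (auto intro!: has_vector_derivative_eq_rhs[OF has_vector_derivative_add[OF
            has_vector_derivative_mult[OF f'(1) g'(1)] ys(2)]])
    moreover have "?ys \<in> {xs. \<forall>(f, g)\<in>set xs. smooth f \<and> smooth g}"
      using Cons.prems p ys f' g' by auto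
    ultimately show ?case by (intro bexI[of _ ?ys] allI)
  qed
qed (use assms in auto)

lemma smooth_const: "smooth (\<lambda>x. c)"
proof (rule smooth_family[of c UNIV "\<lambda>c x. c"])
  show "\<exists>d\<in>UNIV. \<forall>x. ((\<lambda>x. c) has_vector_derivative d) (at x)" for c :: complex
    by (rule bexI[of _ 0]) auto
qed auto

lemma smooth_mult: "smooth f \<Longrightarrow> smooth g \<Longrightarrow> smooth (\<lambda>x. f x * g x)"
  using smooth_sum_mult[of "[(f, g)]"] by simp

lemma smooth_add: "smooth f \<Longrightarrow> smooth g \<Longrightarrow> smooth (\<lambda>x. f x + g x)"
  using smooth_sum_mult[of "[(f, \<lambda>x. 1), (g, \<lambda>x. 1)]"] smooth_const by simp

lemma smooth_diff: "smooth f \<Longrightarrow> smooth g \<Longrightarrow> smooth (\<lambda>x. f x - g x)"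
  using smooth_sum_mult[of "[(f, \<lambda>x. 1), (g, \<lambda>x. -1)]"] smooth_const by simp

text \<open>The chain rule produces powers of \<open>a\<close>, so the family is indexed by a scalar
  factor together with the function.\<close>

lemma smooth_affine:
  assumes "smooth f"
  shows "smooth (\<lambda>x. f (a * x + b))"
proof -
  have "smooth (\<lambda>x. snd p (a * x + b) * fst p)" if "smooth (snd p)"
    for p :: "complex \<times> (real \<Rightarrow> complex)"
  proof (rule smooth_family[of p "{p. smooth (snd p)}" "\<lambda>p x. snd p (a * x + b) * fst p"])
    fix p :: "complex \<times> (real \<Rightarrow> complex)"
    assume "p \<in> {p. smooth (snd p)}"
    then obtain c f where p: "p = (c, f)" and "smooth f" by (cases p) auto
    then obtain f' where f': "\<And>x. (f has_vector_derivative f' x) (at x)" "smooth f'"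
      using smooth_deriv by metis
    have "((\<lambda>x. f (a * x + b)) has_vector_derivative a *\<^sub>R f' (a * x + b)) (at x)" for x
    proof -
      have "((\<lambda>x. a * x + b) has_vector_derivative a) (at x)"
        unfolding has_real_derivative_iff_has_vector_derivative[symmetric]
        by (auto intro!: derivative_eq_intros)
      from vector_diff_chain_at[OF this f'(1)] show ?thesis by (simp add: o_def)
    qed
    from has_vector_derivative_mult_left[OF this, of c]
    show "\<exists>q\<in>{p. smooth (snd p)}. \<forall>x.
        ((\<lambda>x. snd p (a * x + b) * fst p) has_vector_derivative snd q (a * x + b) * fst q) (at x)"
      using f'(2) p by (intro bexI[of _ "(of_real a * c, f')"]) (auto simp: scaleR_conv_of_real mult_ac)
  qed (use that in auto)
  from this[of "(1, f)"] show ?thesis using assms by simp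
qed

lemma smooth_cos_sin:
  "smooth (\<lambda>x. complex_of_real (cos x))" "smooth (\<lambda>x. complex_of_real (sin x))"
proof -
  have "smooth (\<lambda>x. fst p * complex_of_real (cos x) + snd p * complex_of_real (sin x))" for p
  proof (rule smooth_family[of p UNIV "\<lambda>p x. fst p * complex_of_real (cos x) + snd p * complex_of_real (sin x)"])
    fix p :: "complex \<times> complex"
    have c: "((\<lambda>x. complex_of_real (cos x)) has_vector_derivative - complex_of_real (sin x)) (at x)" for x
      by (rule has_vector_derivative_eq_rhs[OF has_vector_derivative_of_real]) (auto intro!: DERIV_cos)
    have s: "((\<lambda>x. complex_of_real (sin x)) has_vector_derivative complex_of_real (cos x)) (at x)" for x
      by (rule has_vector_derivative_eq_rhs[OF has_vector_derivative_of_real]) (auto intro!: DERIV_sin)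
    have "((\<lambda>x. fst p * complex_of_real (cos x) + snd p * complex_of_real (sin x)) has_vector_derivative
       fst p * (- complex_of_real (sin x)) + snd p * complex_of_real (cos x)) (at x)" for x
      by (intro has_vector_derivative_add has_vector_derivative_mult_right c s)
    then show "\<exists>q\<in>UNIV. \<forall>x. ((\<lambda>x. fst p * complex_of_real (cos x) + snd p * complex_of_real (sin x))
        has_vector_derivative fst q * complex_of_real (cos x) + snd q * complex_of_real (sin x)) (at x)"
      by (intro bexI[of _ "(snd p, - fst p)"]) (auto simp: algebra_simps)
  qed auto
  from this[of "(1, 0)"] this[of "(0, 1)"]
  show "smooth (\<lambda>x. complex_of_real (cos x))" "smooth (\<lambda>x. complex_of_real (sin x))"
    by simp_all
qed

section \<open>A flat function, a bump and a smooth step\<close>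

lemma poly_exp_decay: "((\<lambda>y::real. poly p y * exp (- y)) \<longlongrightarrow> 0) at_top"
proof -
  have "((\<lambda>y::real. \<Sum>i\<le>degree p. coeff p i * (y ^ i / exp y)) \<longlongrightarrow> (\<Sum>i\<le>degree p. coeff p i * 0)) at_top"
    by (intro tendsto_sum tendsto_mult tendsto_const tendsto_power_div_exp_0)
  then show ?thesis
    by (simp add: poly_altdef sum_distrib_right exp_minus divide_inverse mult.assoc)
qed

text \<open>A polynomial in \<open>1 / t\<close> as parameter makes the class closed under
  differentiation: the derivative sends \<open>p\<close> to \<open>p - pderiv p\<close> times the
  square of the variable.\<close>

definition flat :: "real poly \<Rightarrow> real \<Rightarrow> real" where
  "flat p t = (if t > 0 then poly p (1 / t) * exp (- (1 / t)) else 0)"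

lemma flat_deriv: "(flat p has_real_derivative flat ([:0, 0, 1:] * (p - pderiv p)) t) (at t)"
proof -
  let ?q = "[:0, 0, 1:] * (p - pderiv p)"
  consider "t > 0" | "t < 0" | "t = 0" by linarith
  then show ?thesis
  proof cases
    case 1
    have "((\<lambda>t. poly p (1 / t) * exp (- (1 / t))) has_real_derivative flat ?q t) (at t)"
      using 1 unfolding flat_def
      by (auto intro!: derivative_eq_intros DERIV_chain2[OF poly_DERIV] simp: field_simps power2_eq_square)
    then show ?thesis
      by (rule has_field_derivative_transform_within_open[of _ _ _ "{0<..}"]) (use 1 in \<open>auto simp: flat_def\<close>)
  next
    case 2
    have "((\<lambda>t. 0) has_real_derivative flat ?q t) (at t)"
      using 2 unfolding flat_def by auto
    then show ?thesis
      by (rule has_field_derivative_transform_within_open[of _ _ _ "{..<0}"]) (use 2 in \<open>auto simp: flat_def\<close>)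
  next
    case 3
    \<comment> \<open>The difference quotient at \<open>0\<close> from the right is again of this
      form, with \<open>p\<close> multiplied by the variable, and tends to \<open>0\<close> by
      exponential decay.\<close>
    have "((\<lambda>h::real. poly (p * [:0, 1:]) (1 / h) * exp (- (1 / h))) \<longlongrightarrow> 0) (at_right 0)"
      by (rule filterlim_compose[OF poly_exp_decay[of "p * [:0,1:]"]]) (use filterlim_inverse_at_top_right in \<open>simp add: inverse_eq_divide\<close>)
    then have "((\<lambda>h. flat p h / h) \<longlongrightarrow> 0) (at_right 0)"
      by (rule Lim_transform_eventually)
        (auto intro!: eventually_at_rightI[of 0 1] simp: flat_def field_simps)
    moreover have "((\<lambda>h. flat p h / h) \<longlongrightarrow> 0) (at_left 0)"
      by (rule Lim_transform_eventually[OF tendsto_const])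
        (auto intro!: eventually_at_leftI[of "-1" 0] simp: flat_def)
    ultimately have "((\<lambda>h. flat p h / h) \<longlongrightarrow> 0) (at 0)"
      by (simp add: filterlim_split_at)
    then show ?thesis using 3 by (simp add: has_field_derivative_iff flat_def)
  qed
qed

lemma smooth_flat: "smooth (\<lambda>t. complex_of_real (flat p t))"
proof (rule smooth_family[of p UNIV "\<lambda>p t. complex_of_real (flat p t)"])
  show "\<exists>q\<in>UNIV. \<forall>t. ((\<lambda>t. complex_of_real (flat p t)) has_vector_derivative complex_of_real (flat q t)) (at t)" for p
    by (rule bexI[of _ "[:0, 0, 1:] * (p - pderiv p)"])
      (auto intro!: has_vector_derivative_of_real flat_deriv simp del: mult_pCons_left)
qed auto

definition bump :: "real \<Rightarrow> real" where "bump s = flat 1 (1 - s) * flat 1 (1 + s)"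

text \<open>\<open>[:0, 0, 1:]\<close> is what one differentiation makes of the constant polynomial
  \<open>1\<close>, so this is the derivative of \<open>bump\<close> by the product rule.\<close>

definition bump' :: "real \<Rightarrow> real" where
  "bump' s = flat 1 (1 - s) * flat [:0, 0, 1:] (1 + s) - flat [:0, 0, 1:] (1 - s) * flat 1 (1 + s)"

lemma flat_nonneg: "flat 1 t \<ge> 0" "flat [:0, 0, 1:] t \<ge> 0"
  by (auto simp: flat_def)

lemma flat_pos: "t > 0 \<Longrightarrow> flat 1 t > 0"
  by (auto simp: flat_def)

lemma bump_deriv: "(bump has_real_derivative bump' s) (at s)"
  unfolding bump_def[abs_def] bump'_def
  by (auto intro!: derivative_eq_intros DERIV_chain2[OF flat_deriv])

lemma bump_even: "bump (- s) = bump s"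
  by (simp add: bump_def mult.commute)

lemma bump_zero: "\<bar>s\<bar> \<ge> 1 \<Longrightarrow> bump s = 0" "\<bar>s\<bar> \<ge> 1 \<Longrightarrow> bump' s = 0"
  by (auto simp: bump_def bump'_def flat_def)

lemma bump_nonneg: "bump s \<ge> 0"
  by (simp add: bump_def flat_nonneg)

lemma bump_pos: "\<bar>s\<bar> < 1 \<Longrightarrow> bump s > 0"
  unfolding bump_def by (intro mult_pos_pos flat_pos) auto

text \<open>The logarithmic derivative of the bump is the difference of the squares of
  \<open>1 / (1 + s)\<close> and \<open>1 / (1 - s)\<close>. The sign is what later keeps the limit
  of the near part from vanishing.\<close>

lemma bump'_neg: 
  assumes "0 < s" "s < 1"
  shows "bump' s < 0"
proof -
  have "bump' s = exp (- 1 / (1 - s)) * exp (- 1 / (1 + s)) * ((1 / (1 + s))\<^sup>2 - (1 / (1 - s))\<^sup>2)"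
    using assms by (simp add: bump'_def flat_def power2_eq_square algebra_simps)
  moreover have "(1 / (1 + s))\<^sup>2 < (1 / (1 - s))\<^sup>2"
    using assms by (intro power_strict_mono divide_strict_left_mono) auto
  ultimately show ?thesis by (auto simp: mult_less_0_iff)
qed

lemma smooth_bump: "smooth (\<lambda>s. complex_of_real (bump s))"
  using smooth_mult[OF smooth_affine[OF smooth_flat, of 1 "-1" 1] smooth_affine[OF smooth_flat, of 1 1 1]]
  by (simp add: bump_def add.commute)

lemma antiderivative_real:
  fixes f :: "real \<Rightarrow> 'a::euclidean_space"
  assumes "continuous_on UNIV f"
  shows "\<exists>F. F 0 = 0 \<and> (\<forall>x. (F has_vector_derivative f x) (at x))"
proof -
  obtain F where F: "\<And>x. (F has_vector_derivative f x) (at x)"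
    using einterval_antiderivative[of "-\<infinity>" "\<infinity>" f] assms
    by (auto simp: continuous_on_eq_continuous_at)
  have "((\<lambda>x. F x - F 0) has_vector_derivative f x) (at x)" for x
    using has_vector_derivative_diff[OF F has_vector_derivative_const] by simp
  then show ?thesis by (intro exI[of _ "\<lambda>x. F x - F 0"]) auto
qed

text \<open>The step is the odd antiderivative of the bump, divided by its value at
  \<open>1\<close>. It has three uses: \<open>kap'\<close> is a nonnegative kernel of total mass
  \<open>2\<close> for mollifying, the plateaus of \<open>kap\<close> build cut-offs, and
  \<open>kap'' < 0\<close> on \<open>(0, 1)\<close> gives the concentration argument its
  sign.\<close>

lemma step_exists:
  "\<exists>(kap::real \<Rightarrow> real) kap' kap''. smooth (\<lambda>s. complex_of_real (kap s)) \<and>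
     (\<forall>s. (kap has_real_derivative kap' s) (at s)) \<and>
     (\<forall>s. (kap' has_real_derivative kap'' s) (at s)) \<and>
     (\<forall>s. kap (- s) = - kap s) \<and> (\<forall>s\<ge>1. kap s = 1) \<and> (\<forall>s. kap' s \<ge> 0) \<and>
     (\<forall>s. \<bar>s\<bar> \<ge> 1 \<longrightarrow> kap' s = 0 \<and> kap'' s = 0) \<and> (\<forall>s. 0 < s \<and> s < 1 \<longrightarrow> kap'' s < 0)"
proof -
  have cont: "continuous_on UNIV bump"
    using bump_deriv DERIV_isCont by (simp add: continuous_on_eq_continuous_at) blast
  obtain F where F0: "F 0 = 0" and F: "\<And>x. (F has_real_derivative bump x) (at x)"
    using antiderivative_real[OF cont] by (auto simp: has_real_derivative_iff_has_vector_derivative)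
  have F1: "F 1 > 0"
  proof -
    have "continuous_on {0..1} F" using F by (blast intro: DERIV_isCont continuous_at_imp_continuous_on)
    moreover have "\<exists>y. (F has_real_derivative y) (at x) \<and> 0 < y" if "0 < x" "x < 1" for x
      using F[of x] bump_pos[of x] that by auto
    ultimately show ?thesis using DERIV_pos_imp_increasing_open[of 0 1 F] F0 by fastforce
  qed
  have odd: "F (- s) = - F s" for s
  proof -
    have "((\<lambda>s. F s + F (- s)) has_real_derivative 0) (at s)" for s
      by (auto intro!: derivative_eq_intros F DERIV_chain2[OF F] simp: bump_even)
    then show ?thesis using DERIV_isconst_all[of "\<lambda>s. F s + F (- s)" s 0] F0 by simp
  qed
  have one: "F s = F 1" if "s \<ge> 1" for s
  proof (cases "s = 1")
    case False
    have "continuous_on {1..s} F" using F by (blast intro: DERIV_isCont continuous_at_imp_continuous_on)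
    moreover have "(F has_real_derivative 0) (at x)" if "1 < x" "x < s" for x
      using F[of x] bump_zero(1)[of x] that by simp
    ultimately show ?thesis using that False DERIV_isconst_end[of 1 s F] by fastforce
  qed simp
  define c where "c = F 1"
  have cF: "((\<lambda>s. F s / c) has_real_derivative bump s / c) (at s)" for s
    by (intro DERIV_cdivide F)
  have cb: "((\<lambda>s. bump s / c) has_real_derivative bump' s / c) (at s)" for s
    by (intro DERIV_cdivide bump_deriv)
  have "smooth (\<lambda>s. complex_of_real (F s / c))"
  proof (rule smoothI)
    have "complex_of_real (bump s) * complex_of_real (1 / c) = complex_of_real (bump s / c)" for s
      by simp
    then show "((\<lambda>s. complex_of_real (F s / c)) has_vector_derivative complex_of_real (bump s) * complex_of_real (1 / c)) (at s)" for s
      using has_vector_derivative_of_real[OF cF[of s]] by metis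
    show "smooth (\<lambda>s. complex_of_real (bump s) * complex_of_real (1 / c))"
      by (intro smooth_mult smooth_bump smooth_const)
  qed
  moreover have c0: "c > 0" using F1 c_def by simp
  moreover have "\<forall>s. F (- s) / c = - (F s / c)" "\<forall>s\<ge>1. F s / c = 1" "\<forall>s. bump s / c \<ge> 0"
     "\<forall>s. \<bar>s\<bar> \<ge> 1 \<longrightarrow> bump s / c = 0 \<and> bump' s / c = 0" "\<forall>s. 0 < s \<and> s < 1 \<longrightarrow> bump' s / c < 0"
  proof -
    show "\<forall>s. F (- s) / c = - (F s / c)" by (simp add: odd)
    show "\<forall>s\<ge>1. F s / c = 1" using one c0 unfolding c_def by (metis divide_self less_irrefl)
    show "\<forall>s. bump s / c \<ge> 0" using bump_nonneg c0 by (simp add: less_imp_le)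
    show "\<forall>s. \<bar>s\<bar> \<ge> 1 \<longrightarrow> bump s / c = 0 \<and> bump' s / c = 0" using bump_zero by simp
    show "\<forall>s. 0 < s \<and> s < 1 \<longrightarrow> bump' s / c < 0" using bump'_neg c0 divide_neg_pos by blast
  qed
  ultimately show ?thesis using cF cb
    by - (rule exI[of _ "\<lambda>s. F s / c"], rule exI[of _ "\<lambda>s. bump s / c"],
        rule exI[of _ "\<lambda>s. bump' s / c"], intro conjI; (assumption | intro allI)+)
qed

section \<open>Spherical waves\<close>

text \<open>In three dimensions the case \<open>n = 0\<close> is twice the average over unit vectors
  \<open>\<omega>\<close> of the plane waves \<open>g (\<tau> + y \<bullet> \<omega>)\<close>. It
  equals \<open>(f (\<tau> + s) - f (\<tau> - s)) / s\<close> with \<open>s = norm y\<close> and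
  \<open>f' = g\<close>, but as an integral it has no singularity at \<open>y = 0\<close>. The
  weights with \<open>n > 0\<close> appear when it is differentiated in \<open>y\<close>.\<close>

definition Theta :: "nat \<Rightarrow> (real \<Rightarrow> complex) \<Rightarrow> real \<Rightarrow> 'a::real_inner \<Rightarrow> complex" where
  "Theta n g \<tau> y = integral {-1..1} (\<lambda>\<xi>. (1 - \<xi>\<^sup>2) ^ n *\<^sub>R g (\<tau> + norm y * \<xi>))"

lemma Theta_integrable:
  assumes "smooth g" "continuous_on {a..b} w"
  shows "(\<lambda>\<xi>::real. w \<xi> *\<^sub>R g (\<tau> + s * \<xi>)) integrable_on {a..b}"
proof -
  have "continuous_on {a..b} (\<lambda>\<xi>. w \<xi> *\<^sub>R g (\<tau> + s * \<xi>))"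
    by (intro continuous_intros assms(2) continuous_on_compose2[OF smooth_continuous[OF assms(1), of UNIV]]) auto
  then show ?thesis by (rule integrable_continuous_real)
qed

lemma vector_derivative_affine:
  assumes "\<And>x. (g has_vector_derivative g' x) (at x)"
  shows "((\<lambda>\<xi>. g (\<tau> + s * \<xi>)) has_vector_derivative s *\<^sub>R g' (\<tau> + s * \<xi>)) (at \<xi> within A)"
proof -
  have "((\<lambda>\<xi>. \<tau> + s * \<xi>) has_vector_derivative s) (at \<xi>)"
    unfolding has_real_derivative_iff_has_vector_derivative[symmetric]
    by (auto intro!: derivative_eq_intros)
  from vector_diff_chain_at[OF this assms] show ?thesis
    by (auto simp: o_def intro: has_vector_derivative_at_within)
qed

text \<open>Up to a constant, \<open>(1 - \<xi>\<^sup>2) ^ n * \<xi>\<close> is the derivative of a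
  weight that vanishes at both end points. The factor \<open>norm y\<close> gained here turns a
  derivative along \<open>norm y\<close> into one with coefficient linear in
  \<open>y\<close>.\<close>

lemma Theta_ibp:
  fixes y :: "'a::real_inner"
  assumes g: "smooth g" "\<And>x. (g has_vector_derivative g' x) (at x)"
  shows "integral {-1..1} (\<lambda>\<xi>. ((1 - \<xi>\<^sup>2) ^ n * \<xi>) *\<^sub>R g (\<tau> + norm y * \<xi>))
     = (norm y / (2 * real (Suc n))) *\<^sub>R Theta (Suc n) g' \<tau> y"
proof -
  let ?c = "2 * real (Suc n)" and ?a = "\<lambda>\<xi>. \<tau> + norm y * \<xi>"
  have g': "smooth g'" using smooth_vector_derivative g by blast
  have d: "((\<lambda>\<xi>. (1 - \<xi>\<^sup>2) ^ Suc n *\<^sub>R g (?a \<xi>)) has_vector_derivative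
      norm y *\<^sub>R ((1 - \<xi>\<^sup>2) ^ Suc n *\<^sub>R g' (?a \<xi>)) - ?c *\<^sub>R (((1 - \<xi>\<^sup>2) ^ n * \<xi>) *\<^sub>R g (?a \<xi>)))
      (at \<xi> within {-1..1})" for \<xi>
  proof -
    have "((\<lambda>\<xi>. (1 - \<xi>\<^sup>2) ^ Suc n) has_real_derivative - ?c * ((1 - \<xi>\<^sup>2) ^ n * \<xi>)) (at \<xi> within {-1..1})"
      by (auto intro!: derivative_eq_intros simp del: power_Suc simp: algebra_simps)
    from has_vector_derivative_scaleR[OF this vector_derivative_affine[OF g(2), of \<tau> "norm y"]]
    show ?thesis by (rule has_vector_derivative_eq_rhs) (simp add: algebra_simps)
  qed
  have "((\<lambda>\<xi>. norm y *\<^sub>R ((1 - \<xi>\<^sup>2) ^ Suc n *\<^sub>R g' (?a \<xi>)) - ?c *\<^sub>R (((1 - \<xi>\<^sup>2) ^ n * \<xi>) *\<^sub>R g (?a \<xi>)))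
     has_integral 0) {-1..1}"
    using fundamental_theorem_of_calculus[OF _ d] by simp
  moreover have "((\<lambda>\<xi>. norm y *\<^sub>R ((1 - \<xi>\<^sup>2) ^ Suc n *\<^sub>R g' (?a \<xi>)) - ?c *\<^sub>R (((1 - \<xi>\<^sup>2) ^ n * \<xi>) *\<^sub>R g (?a \<xi>)))
     has_integral (norm y *\<^sub>R Theta (Suc n) g' \<tau> y
       - ?c *\<^sub>R integral {-1..1} (\<lambda>\<xi>. ((1 - \<xi>\<^sup>2) ^ n * \<xi>) *\<^sub>R g (?a \<xi>)))) {-1..1}"
    unfolding Theta_def
    by (intro has_integral_diff has_integral_cmul integrable_integral Theta_integrable g g' continuous_intros)
  ultimately have "?c *\<^sub>R integral {-1..1} (\<lambda>\<xi>. ((1 - \<xi>\<^sup>2) ^ n * \<xi>) *\<^sub>R g (?a \<xi>)) =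
      norm y *\<^sub>R Theta (Suc n) g' \<tau> y"
    by (metis (no_types, lifting) has_integral_unique right_minus_eq)
  then have "(1 / ?c) *\<^sub>R ?c *\<^sub>R integral {-1..1} (\<lambda>\<xi>. ((1 - \<xi>\<^sup>2) ^ n * \<xi>) *\<^sub>R g (?a \<xi>)) =
      (1 / ?c) *\<^sub>R norm y *\<^sub>R Theta (Suc n) g' \<tau> y" by (rule arg_cong)
  then show ?thesis by simp
qed

text \<open>The Euler-Poisson-Darboux relation behind the wave equation: \<open>3 / 2\<close> is
  half the dimension, and the right-hand side is the form in which the Laplacian arrives, there with
  a second derivative in place of \<open>g\<close>.\<close>

lemma Theta_recurrence:
  fixes y :: "'a::real_inner"
  assumes g: "smooth g" "\<And>x. (g has_vector_derivative g' x) (at x)"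
    "\<And>x. (g' has_vector_derivative g'' x) (at x)"
  shows "Theta 0 g \<tau> y = (3 / 2) *\<^sub>R Theta 1 g \<tau> y + ((norm y)\<^sup>2 / 8) *\<^sub>R Theta 2 g'' \<tau> y"
proof -
  let ?a = "\<lambda>\<xi>. \<tau> + norm y * \<xi>"
  have g': "smooth g'" using smooth_vector_derivative g by blast
  have d: "((\<lambda>\<xi>. ((1 - \<xi>\<^sup>2) * \<xi>) *\<^sub>R g (?a \<xi>)) has_vector_derivative
      norm y *\<^sub>R (((1 - \<xi>\<^sup>2) ^ 1 * \<xi>) *\<^sub>R g' (?a \<xi>)) + (1 - 3 * \<xi>\<^sup>2) *\<^sub>R g (?a \<xi>))
      (at \<xi> within {-1..1})" for \<xi>
  proof -
    have "((\<lambda>\<xi>. (1 - \<xi>\<^sup>2) * \<xi>) has_real_derivative (1 - 3 * \<xi>\<^sup>2)) (at \<xi> within {-1..1})"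
      by (auto intro!: derivative_eq_intros simp: algebra_simps power2_eq_square)
    from has_vector_derivative_scaleR[OF this vector_derivative_affine[OF g(2), of \<tau> "norm y"]]
    show ?thesis by (rule has_vector_derivative_eq_rhs) (simp add: algebra_simps)
  qed
  let ?I = "integral {-1..1} (\<lambda>\<xi>. ((1 - \<xi>\<^sup>2) ^ 1 * \<xi>) *\<^sub>R g' (?a \<xi>))"
  let ?J = "integral {-1..1} (\<lambda>\<xi>. (1 - 3 * \<xi>\<^sup>2) *\<^sub>R g (?a \<xi>))"
  have "((\<lambda>\<xi>. norm y *\<^sub>R (((1 - \<xi>\<^sup>2) ^ 1 * \<xi>) *\<^sub>R g' (?a \<xi>)) + (1 - 3 * \<xi>\<^sup>2) *\<^sub>R g (?a \<xi>))
     has_integral 0) {-1..1}"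
    using fundamental_theorem_of_calculus[OF _ d] by simp
  moreover have "((\<lambda>\<xi>. norm y *\<^sub>R (((1 - \<xi>\<^sup>2) ^ 1 * \<xi>) *\<^sub>R g' (?a \<xi>)) + (1 - 3 * \<xi>\<^sup>2) *\<^sub>R g (?a \<xi>))
     has_integral (norm y *\<^sub>R ?I + ?J)) {-1..1}"
    by (intro has_integral_add has_integral_cmul integrable_integral Theta_integrable g g' continuous_intros)
  ultimately have 1: "norm y *\<^sub>R ?I + ?J = 0"
    by (rule has_integral_unique[rotated])
  have 2: "?I = (norm y / 4) *\<^sub>R Theta 2 g'' \<tau> y"
    using Theta_ibp[OF g' g(3), of 1 \<tau> y] by (simp add: numeral_2_eq_2)
  \<comment> \<open>The weight \<open>1\<close> is \<open>3 / 2\<close> times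
    \<open>1 - \<xi>\<^sup>2\<close> minus \<open>1 / 2\<close> times
    \<open>1 - 3 * \<xi>\<^sup>2\<close>, and the latter is the derivative of
    \<open>(1 - \<xi>\<^sup>2) * \<xi>\<close>.\<close>
  have 3: "Theta 0 g \<tau> y = (3 / 2) *\<^sub>R Theta 1 g \<tau> y - (1 / 2) *\<^sub>R ?J"
  proof -
    have "((\<lambda>\<xi>. (3 / 2) *\<^sub>R ((1 - \<xi>\<^sup>2) ^ 1 *\<^sub>R g (?a \<xi>)) - (1 / 2) *\<^sub>R ((1 - 3 * \<xi>\<^sup>2) *\<^sub>R g (?a \<xi>)))
      has_integral ((3 / 2) *\<^sub>R Theta 1 g \<tau> y - (1 / 2) *\<^sub>R ?J)) {-1..1}"
      unfolding Theta_def
      by (intro has_integral_diff has_integral_cmul integrable_integral Theta_integrable g continuous_intros)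
    moreover have "(3 / 2) *\<^sub>R ((1 - \<xi>\<^sup>2) ^ 1 *\<^sub>R z) - (1 / 2) *\<^sub>R ((1 - 3 * \<xi>\<^sup>2) *\<^sub>R z) = (1 - \<xi>\<^sup>2) ^ 0 *\<^sub>R z"
      for \<xi> and z :: complex
      by (simp add: scaleR_diff_left[symmetric] field_simps)
    ultimately show ?thesis
      unfolding Theta_def[of 0] by (metis (no_types, lifting) integral_unique has_integral_cong)
  qed
  have "?J = - ((norm y)\<^sup>2 / 4) *\<^sub>R Theta 2 g'' \<tau> y"
    using 1 unfolding 2 by (simp add: add_eq_0_iff power2_eq_square)
  then show ?thesis unfolding 3 by simp
qed

lemma Theta_0_eq:
  assumes "\<And>x. (f has_vector_derivative g x) (at x)" "y \<noteq> 0"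
  shows "Theta 0 g \<tau> y = (f (\<tau> + norm y) - f (\<tau> - norm y)) / of_real (norm y)"
proof -
  have "((\<lambda>\<xi>. (1 / norm y) *\<^sub>R (norm y *\<^sub>R g (\<tau> + norm y * \<xi>))) has_integral
    (1 / norm y) *\<^sub>R (f (\<tau> + norm y * 1) - f (\<tau> + norm y * (-1)))) {-1..1}"
    by (intro has_integral_cmul fundamental_theorem_of_calculus vector_derivative_affine assms) simp
  then show ?thesis using assms(2) unfolding Theta_def
    by (auto dest!: integral_unique simp: scaleR_conv_of_real field_simps)
qed

lemma Theta_at_0: "Theta 0 g \<tau> 0 = 2 * g \<tau>"
  by (simp add: Theta_def scaleR_conv_of_real)

lemma taylor2:
  fixes g :: "real \<Rightarrow> complex"
  assumes "\<And>x. (g has_vector_derivative g' x) (at x)" "\<And>x. (g' has_vector_derivative g'' x) (at x)"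
    and M: "\<And>x. \<bar>x\<bar> \<le> K \<Longrightarrow> norm (g'' x) \<le> M" and "\<bar>a\<bar> \<le> K" "\<bar>b\<bar> \<le> K"
  shows "norm (g b - g a - (b - a) *\<^sub>R g' a) \<le> M * (b - a)\<^sup>2"
proof -
  have *: "\<bar>x\<bar> \<le> K" if "x \<in> closed_segment a b" for x
    using that assms(4,5) by (auto simp: closed_segment_eq_real_ivl split: if_splits)
  have 1: "norm (g' x - g' a) \<le> M * \<bar>b - a\<bar>" if x: "x \<in> closed_segment a b" for x
  proof -
    have "norm (g' x - g' a) \<le> M * norm (x - a)"
    proof (rule differentiable_bound[of "closed_segment a b" g' "\<lambda>x h. h *\<^sub>R g'' x"])
      fix z assume "z \<in> closed_segment a b"
      then have "norm (g'' z) \<le> M" using M * by blast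
      then show "onorm (\<lambda>h. h *\<^sub>R g'' z) \<le> M"
        using mult_left_mono[of "norm (g'' z)" M "\<bar>h\<bar>" for h] by (intro onorm_le) (simp add: mult.commute)
    qed (use x assms(2) in \<open>auto simp: has_vector_derivative_def intro: has_derivative_at_withinI\<close>)
    also have "\<dots> \<le> M * \<bar>b - a\<bar>"
      using M[OF assms(4)] x by (intro mult_left_mono)
        (auto simp: closed_segment_eq_real_ivl split: if_splits intro: order_trans[OF norm_ge_zero])
    finally show ?thesis .
  qed
  have "norm ((g b - b *\<^sub>R g' a) - (g a - a *\<^sub>R g' a)) \<le> (M * \<bar>b - a\<bar>) * norm (b - a)"
  proof (rule differentiable_bound[of "closed_segment a b" "\<lambda>x. g x - x *\<^sub>R g' a" "\<lambda>x h. h *\<^sub>R (g' x - g' a)"])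
    fix x assume x: "x \<in> closed_segment a b"
    show "((\<lambda>x. g x - x *\<^sub>R g' a) has_derivative (\<lambda>h. h *\<^sub>R (g' x - g' a))) (at x within closed_segment a b)"
      unfolding has_vector_derivative_def[symmetric]
      by (auto intro!: derivative_eq_intros has_vector_derivative_at_within[OF assms(1)])
    show "onorm (\<lambda>h. h *\<^sub>R (g' x - g' a)) \<le> M * \<bar>b - a\<bar>"
      using mult_left_mono[OF 1[OF x], of "\<bar>h\<bar>" for h] by (intro onorm_le) (simp add: mult_ac)
  qed auto
  then show ?thesis by (simp add: algebra_simps power2_eq_square abs_mult_self_eq mult.assoc flip: abs_mult)
qed

lemma smooth_bounded_on:
  assumes "smooth g"
  obtains M where "M \<ge> 0" "\<And>x. \<bar>x\<bar> \<le> K \<Longrightarrow> norm (g x) \<le> M"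
proof -
  have "bounded (g ` cball 0 K)"
    by (intro compact_imp_bounded compact_continuous_image smooth_continuous assms) auto
  then obtain M where "M > 0" "\<And>x. x \<in> cball 0 K \<Longrightarrow> norm (g x) \<le> M"
    unfolding bounded_pos by auto
  then show ?thesis by (intro that[of M]) auto
qed

text \<open>At \<open>y = 0\<close> the norm is not differentiable, but the derivative of \<open>Theta\<close> in the
  direction of \<open>norm y\<close> is a multiple of \<open>norm y\<close>, and
  \<open>norm y * (norm y' - norm y)\<close> differs from \<open>y \<bullet> (y' - y)\<close> by a quadratic term only.\<close>

lemma Theta_taylor:
  fixes y :: "'a::real_inner"
  assumes g: "smooth g" "\<And>x. (g has_vector_derivative g' x) (at x)"
    "\<And>x. (g' has_vector_derivative g'' x) (at x)"
  obtains C where "C \<ge> 0" "\<And>\<tau>' y'. \<bar>\<tau>' - \<tau>\<bar> + norm (y' - y) \<le> 1 \<Longrightarrow>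
    norm (Theta n g \<tau>' y' - Theta n g \<tau> y - ((\<tau>' - \<tau>) *\<^sub>R Theta n g' \<tau> y +
       ((y \<bullet> (y' - y)) / (2 * real (Suc n))) *\<^sub>R Theta (Suc n) g'' \<tau> y))
     \<le> C * (\<bar>\<tau>' - \<tau>\<bar> + norm (y' - y))\<^sup>2"
proof -
  have g': "smooth g'" "smooth g''" using smooth_vector_derivative g by blast+
  \<comment> \<open>The summand \<open>1\<close> leaves room for every perturbed argument
    \<open>\<tau>' + norm y' * \<xi>\<close> with total perturbation at most \<open>1\<close>, so
    one bound \<open>M\<close> serves them all.\<close>
  define K where "K = \<bar>\<tau>\<bar> + norm y + 1"
  obtain M where M: "M \<ge> 0" "\<And>x. \<bar>x\<bar> \<le> K \<Longrightarrow> norm (g'' x) \<le> M"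
    using smooth_bounded_on[OF g'(2)] by blast
  define Z where "Z = Theta (Suc n) g'' \<tau> y"
  have main: "norm (Theta n g \<tau>' y' - Theta n g \<tau> y - ((\<tau>' - \<tau>) *\<^sub>R Theta n g' \<tau> y +
       ((y \<bullet> (y' - y)) / (2 * real (Suc n))) *\<^sub>R Z))
     \<le> (2 * M + norm Z) * (\<bar>\<tau>' - \<tau>\<bar> + norm (y' - y))\<^sup>2"
    if le: "\<bar>\<tau>' - \<tau>\<bar> + norm (y' - y) \<le> 1" for \<tau>' y'
  proof -
    define \<delta> where "\<delta> = \<bar>\<tau>' - \<tau>\<bar> + norm (y' - y)"
    define ds where "ds = norm y' - norm y"
    have ds: "\<bar>ds\<bar> \<le> norm (y' - y)" unfolding ds_def by (rule norm_triangle_ineq3)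
    let ?a = "\<lambda>\<xi>. \<tau> + norm y * \<xi>" and ?b = "\<lambda>\<xi>. \<tau>' + norm y' * \<xi>"
    let ?I = "integral {-1..1} (\<lambda>\<xi>. ((1 - \<xi>\<^sup>2) ^ n * \<xi>) *\<^sub>R g' (?a \<xi>))"
    let ?r = "\<lambda>\<xi>. (1 - \<xi>\<^sup>2) ^ n *\<^sub>R (g (?b \<xi>) - g (?a \<xi>) - (?b \<xi> - ?a \<xi>) *\<^sub>R g' (?a \<xi>))"
    have "((\<lambda>\<xi>. (1 - \<xi>\<^sup>2) ^ n *\<^sub>R g (?b \<xi>) - (1 - \<xi>\<^sup>2) ^ n *\<^sub>R g (?a \<xi>) -
        ((\<tau>' - \<tau>) *\<^sub>R ((1 - \<xi>\<^sup>2) ^ n *\<^sub>R g' (?a \<xi>)) + ds *\<^sub>R (((1 - \<xi>\<^sup>2) ^ n * \<xi>) *\<^sub>R g' (?a \<xi>))))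
       has_integral (Theta n g \<tau>' y' - Theta n g \<tau> y - ((\<tau>' - \<tau>) *\<^sub>R Theta n g' \<tau> y + ds *\<^sub>R ?I))) {-1..1}"
      unfolding Theta_def
      by (intro has_integral_diff has_integral_add has_integral_cmul integrable_integral
          Theta_integrable g g' continuous_intros)
    moreover have "(\<lambda>\<xi>. (1 - \<xi>\<^sup>2) ^ n *\<^sub>R g (?b \<xi>) - (1 - \<xi>\<^sup>2) ^ n *\<^sub>R g (?a \<xi>) -
        ((\<tau>' - \<tau>) *\<^sub>R ((1 - \<xi>\<^sup>2) ^ n *\<^sub>R g' (?a \<xi>)) + ds *\<^sub>R (((1 - \<xi>\<^sup>2) ^ n * \<xi>) *\<^sub>R g' (?a \<xi>)))) = ?r"
      by (rule ext) (simp add: ds_def algebra_simps)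
    ultimately have I: "(?r has_integral (Theta n g \<tau>' y' - Theta n g \<tau> y -
         ((\<tau>' - \<tau>) *\<^sub>R Theta n g' \<tau> y + ds *\<^sub>R ?I))) {-1..1}" by simp
    have rb: "norm (?r \<xi>) \<le> M * \<delta>\<^sup>2" if \<xi>: "\<xi> \<in> {-1..1}" for \<xi>
    proof -
      have x1: "\<bar>norm y * \<xi>\<bar> \<le> norm y" "\<bar>norm y' * \<xi>\<bar> \<le> norm y'" "\<bar>ds * \<xi>\<bar> \<le> \<bar>ds\<bar>"
        using \<xi> by (auto simp: abs_mult intro!: mult_left_le)
      have a: "\<bar>?a \<xi>\<bar> \<le> K" unfolding K_def using x1 by linarith
      have b: "\<bar>?b \<xi>\<bar> \<le> K" unfolding K_def using x1 le ds unfolding ds_def by linarith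
      have "norm (g (?b \<xi>) - g (?a \<xi>) - (?b \<xi> - ?a \<xi>) *\<^sub>R g' (?a \<xi>)) \<le> M * (?b \<xi> - ?a \<xi>)\<^sup>2"
        by (rule taylor2[OF g(2,3) M(2) a b])
      also have "\<dots> \<le> M * \<delta>\<^sup>2"
      proof -
        have "?b \<xi> - ?a \<xi> = (\<tau>' - \<tau>) + ds * \<xi>" by (simp add: ds_def algebra_simps)
        then have "\<bar>?b \<xi> - ?a \<xi>\<bar> \<le> \<delta>" unfolding \<delta>_def using x1 ds by linarith
        then show ?thesis using M(1) by (intro mult_left_mono) (auto intro: power2_le_iff_abs_le[THEN iffD2] simp: \<delta>_def)
      qed
      finally have 1: "norm (g (?b \<xi>) - g (?a \<xi>) - (?b \<xi> - ?a \<xi>) *\<^sub>R g' (?a \<xi>)) \<le> M * \<delta>\<^sup>2" .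
      have "\<bar>(1 - \<xi>\<^sup>2) ^ n\<bar> \<le> 1"
        using \<xi> abs_square_le_1[of \<xi>] by (auto simp: power_abs intro!: power_le_one)
      then have "norm (?r \<xi>) \<le> 1 * (M * \<delta>\<^sup>2)"
        unfolding norm_scaleR by (intro mult_mono 1) auto
      then show ?thesis by simp
    qed
    have "norm (Theta n g \<tau>' y' - Theta n g \<tau> y - ((\<tau>' - \<tau>) *\<^sub>R Theta n g' \<tau> y + ds *\<^sub>R ?I))
        \<le> M * \<delta>\<^sup>2 * measure lborel {-1..1::real}"
      using has_integral_bound_real[OF _ finite.emptyI I, of "M * \<delta>\<^sup>2"] rb M(1) by simp
    then have 1: "norm (Theta n g \<tau>' y' - Theta n g \<tau> y - ((\<tau>' - \<tau>) *\<^sub>R Theta n g' \<tau> y + ds *\<^sub>R ?I)) \<le> 2 * M * \<delta>\<^sup>2"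
      by simp
    have Ieq: "?I = (norm y / (2 * real (Suc n))) *\<^sub>R Z"
      unfolding Z_def by (rule Theta_ibp[OF g'(1) g(3)])
    have cs: "ds * norm y - y \<bullet> (y' - y) = ((norm (y' - y))\<^sup>2 - ds\<^sup>2) / 2"
      unfolding ds_def by (simp add: power2_norm_eq_inner inner_diff inner_commute power2_diff algebra_simps)
        (simp add: power2_eq_square power2_norm_eq_inner[unfolded power2_eq_square])
    have "\<bar>ds * norm y - y \<bullet> (y' - y)\<bar> \<le> (norm (y' - y))\<^sup>2"
      unfolding cs using ds power2_le_iff_abs_le[of "norm (y' - y)" ds] zero_le_power2[of ds] by auto
    also have "\<dots> \<le> \<delta>\<^sup>2" unfolding \<delta>_def by (intro power_mono) auto
    finally have cs': "\<bar>ds * norm y - y \<bullet> (y' - y)\<bar> \<le> \<delta>\<^sup>2" .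
    have "norm (ds *\<^sub>R ?I - ((y \<bullet> (y' - y)) / (2 * real (Suc n))) *\<^sub>R Z) =
       (\<bar>ds * norm y - y \<bullet> (y' - y)\<bar> / (2 * real (Suc n))) * norm Z"
      unfolding Ieq scaleR_scaleR scaleR_diff_left[symmetric] norm_scaleR
      by (simp add: diff_divide_distrib[symmetric] del: of_nat_Suc)
    also have "\<dots> \<le> \<delta>\<^sup>2 * norm Z"
    proof (rule mult_right_mono)
      have "\<delta>\<^sup>2 * 1 \<le> \<delta>\<^sup>2 * (2 * real (Suc n))" by (intro mult_left_mono) auto
      with cs' show "\<bar>ds * norm y - y \<bullet> (y' - y)\<bar> / (2 * real (Suc n)) \<le> \<delta>\<^sup>2"
        by (subst pos_divide_le_eq) (auto simp del: of_nat_Suc)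
    qed auto
    finally have 2: "norm (ds *\<^sub>R ?I - ((y \<bullet> (y' - y)) / (2 * real (Suc n))) *\<^sub>R Z) \<le> norm Z * \<delta>\<^sup>2"
      by (simp add: mult.commute)
    show ?thesis
      using norm_triangle_mono[OF 1 2] unfolding \<delta>_def[symmetric] by (simp add: algebra_simps)
  qed
  show ?thesis by (rule that[OF _ main[unfolded Z_def]]) (use M in auto)
qed

section \<open>Differentiability of spherical waves and an algebra closed under it\<close>

lemma has_derivative_quadratic:
  fixes f :: "'a::real_normed_vector \<Rightarrow> 'b::real_normed_vector"
  assumes D: "bounded_linear D" and "C \<ge> 0" "d > 0"
    and *: "\<And>z. norm (z - x) \<le> d \<Longrightarrow> norm (f z - f x - D (z - x)) \<le> C * (norm (z - x))\<^sup>2"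
  shows "(f has_derivative D) (at x)"
  unfolding has_derivative_at_alt
proof (intro conjI D allI impI)
  fix e :: real assume "e > 0"
  define r where "r = min d (e / (C + 1))"
  have "norm (f z - f x - D (z - x)) \<le> e * norm (z - x)" if z: "norm (z - x) < r" for z
  proof -
    have "norm (f z - f x - D (z - x)) \<le> (C * norm (z - x)) * norm (z - x)"
      using *[of z] z by (simp add: r_def power2_eq_square mult.assoc)
    also have "C * norm (z - x) \<le> (C + 1) * (e / (C + 1))"
      using z assms by (intro mult_mono) (auto simp: r_def)
    also have "\<dots> = e" using assms by simp
    finally show ?thesis by (simp add: mult_right_mono)
  qed
  moreover have "r > 0" using assms \<open>e > 0\<close> by (simp add: r_def)
  ultimately show "\<exists>d>0. \<forall>y. norm (y - x) < d \<longrightarrow> norm (f y - f x - D (y - x)) \<le> e * norm (y - x)"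
    by blast
qed

lemma Theta_has_derivative:
  fixes y :: "'a::real_inner"
  assumes g: "smooth g" "\<And>x. (g has_vector_derivative g' x) (at x)"
    "\<And>x. (g' has_vector_derivative g'' x) (at x)"
  shows "((\<lambda>z. Theta n g (fst z) (snd z)) has_derivative
     (\<lambda>h. fst h *\<^sub>R Theta n g' \<tau> y + ((y \<bullet> snd h) / (2 * real (Suc n))) *\<^sub>R Theta (Suc n) g'' \<tau> y))
     (at (\<tau>, y))"
proof -
  obtain C where C: "C \<ge> 0" "\<And>\<tau>' y'. \<bar>\<tau>' - \<tau>\<bar> + norm (y' - y) \<le> 1 \<Longrightarrow>
    norm (Theta n g \<tau>' y' - Theta n g \<tau> y - ((\<tau>' - \<tau>) *\<^sub>R Theta n g' \<tau> y +
       ((y \<bullet> (y' - y)) / (2 * real (Suc n))) *\<^sub>R Theta (Suc n) g'' \<tau> y))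
     \<le> C * (\<bar>\<tau>' - \<tau>\<bar> + norm (y' - y))\<^sup>2"
    using Theta_taylor[OF g] by metis
  show ?thesis
  proof (rule has_derivative_quadratic[where C = "C * 4" and d = "1 / 2"])
    show "bounded_linear (\<lambda>h. fst h *\<^sub>R Theta n g' \<tau> y + ((y \<bullet> snd h) / (2 * real (Suc n))) *\<^sub>R Theta (Suc n) g'' \<tau> y)"
      unfolding divide_inverse
      by (intro bounded_linear_add bounded_linear_compose[OF bounded_linear_scaleR_left] bounded_linear_fst
        bounded_linear_mult_const bounded_linear_compose[OF bounded_linear_inner_right] bounded_linear_snd)
    fix z :: "real \<times> 'a" assume z: "norm (z - (\<tau>, y)) \<le> 1 / 2"
    obtain \<tau>' y' where [simp]: "z = (\<tau>', y')" by (cases z)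
    have le: "\<bar>\<tau>' - \<tau>\<bar> + norm (y' - y) \<le> 2 * norm (z - (\<tau>, y))"
      using norm_fst_le[of "\<tau>' - \<tau>" "y' - y"] norm_snd_le[of "y' - y" "\<tau>' - \<tau>"] by simp
    have "C * (\<bar>\<tau>' - \<tau>\<bar> + norm (y' - y))\<^sup>2 \<le> C * (2 * norm (z - (\<tau>, y)))\<^sup>2"
      using le C(1) by (intro mult_left_mono power_mono) auto
    then have "C * (\<bar>\<tau>' - \<tau>\<bar> + norm (y' - y))\<^sup>2 \<le> C * 4 * (norm (z - (\<tau>, y)))\<^sup>2"
      by (simp add: power_mult_distrib)
    with C(2)[of \<tau>' y'] le z
    show "norm (Theta n g (fst z) (snd z) - Theta n g (fst (\<tau>, y)) (snd (\<tau>, y)) -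
       (fst (z - (\<tau>, y)) *\<^sub>R Theta n g' \<tau> y + ((y \<bullet> snd (z - (\<tau>, y))) / (2 * real (Suc n))) *\<^sub>R Theta (Suc n) g'' \<tau> y))
      \<le> C * 4 * (norm (z - (\<tau>, y)))\<^sup>2"
      by simp
  qed (use C in auto)
qed

text \<open>Test functions need derivatives of every order, and a derivative of a
  \<open>Theta\<close> is a combination of \<open>Theta\<close> of the same and the next index with
  affine coefficients. The algebra generated by both kinds is therefore closed under
  differentiation. The general domain covers space as well as space-time.\<close>

inductive_set theta_alg :: "('a::euclidean_space \<Rightarrow> complex) set" where
  affine: "bounded_linear l \<Longrightarrow> (\<lambda>e. complex_of_real (c + l e)) \<in> theta_alg"
| Theta: "smooth g \<Longrightarrow> bounded_linear P \<Longrightarrow> bounded_linear Q \<Longrightarrow>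
    (\<lambda>e. Theta n g (\<tau> + P e) (y + Q e :: real^3)) \<in> theta_alg"
| add: "f \<in> theta_alg \<Longrightarrow> h \<in> theta_alg \<Longrightarrow> (\<lambda>e. f e + h e) \<in> theta_alg"
| mult: "f \<in> theta_alg \<Longrightarrow> h \<in> theta_alg \<Longrightarrow> (\<lambda>e. f e * h e) \<in> theta_alg"

lemma theta_alg_const: "(\<lambda>e. complex_of_real c) \<in> theta_alg"
  using theta_alg.affine[of "\<lambda>_. 0" c] by (simp add: bounded_linear_zero)

lemma Theta_affine_has_derivative:
  fixes P :: "'a::real_normed_vector \<Rightarrow> real" and Q :: "'a \<Rightarrow> 'b::real_inner"
  assumes g: "smooth g" "\<And>x. (g has_vector_derivative g' x) (at x)"
    "\<And>x. (g' has_vector_derivative g'' x) (at x)"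
    and "bounded_linear P" "bounded_linear Q"
  shows "((\<lambda>e. Theta n g (\<tau> + P e) (y + Q e)) has_derivative
     (\<lambda>b. P b *\<^sub>R Theta n g' (\<tau> + P x) (y + Q x) +
        (((y + Q x) \<bullet> Q b) / (2 * real (Suc n))) *\<^sub>R Theta (Suc n) g'' (\<tau> + P x) (y + Q x))) (at x)"
proof -
  have "((\<lambda>e. (\<tau> + P e, y + Q e)) has_derivative (\<lambda>b. (P b, Q b))) (at x)"
    by (auto intro!: derivative_eq_intros bounded_linear_imp_has_derivative assms(4,5))
  from has_derivative_compose[OF this Theta_has_derivative[OF g, of n "\<tau> + P x" "y + Q x"]]
  show ?thesis by simp
qed

lemma theta_alg_derivative:
  assumes "f \<in> theta_alg"
  shows "\<exists>D. (\<forall>x. (f has_derivative D x) (at x)) \<and> (\<forall>b. (\<lambda>x. D x b) \<in> theta_alg)"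
  using assms
proof induction
  case (affine l c)
  have "((\<lambda>e. complex_of_real (c + l e)) has_derivative (\<lambda>b. complex_of_real (l b))) (at x)" for x
    by (auto intro!: derivative_eq_intros bounded_linear_imp_has_derivative affine)
  then show ?case using theta_alg_const
    by (intro exI[of _ "\<lambda>x b. complex_of_real (l b)"]) blast
next
  case (Theta g P Q n \<tau> y)
  obtain g' where g': "\<And>x. (g has_vector_derivative g' x) (at x)" "smooth g'"
    using smooth_deriv[OF Theta(1)] by metis
  obtain g'' where g'': "\<And>x. (g' has_vector_derivative g'' x) (at x)" "smooth g''"
    using smooth_deriv[OF g'(2)] by metis
  let ?D = "\<lambda>x b. complex_of_real (P b) * Theta n g' (\<tau> + P x) (y + Q x) +
     complex_of_real (1 / (2 * real (Suc n))) * complex_of_real (y \<bullet> Q b + Q x \<bullet> Q b) *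
       Theta (Suc n) g'' (\<tau> + P x) (y + Q x)"
  have "((\<lambda>e. Theta n g (\<tau> + P e) (y + Q e)) has_derivative ?D x) (at x)" for x
    by (rule has_derivative_eq_rhs[OF Theta_affine_has_derivative[OF Theta(1) g'(1) g''(1) Theta(2,3)]])
      (simp add: scaleR_conv_of_real inner_add_left fun_eq_iff)
  moreover have "(\<lambda>x. ?D x b) \<in> theta_alg" for b
    by (intro theta_alg.add theta_alg.mult theta_alg_const theta_alg.affine theta_alg.Theta g' g'' Theta(2,3)
        bounded_linear_compose[OF bounded_linear_inner_left])
  ultimately show ?case by (intro exI[of _ ?D] conjI allI)
next
  case (add f h)
  then obtain D E where "\<forall>x. (f has_derivative D x) (at x)" "\<forall>b. (\<lambda>x. D x b) \<in> theta_alg"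
    "\<forall>x. (h has_derivative E x) (at x)" "\<forall>b. (\<lambda>x. E x b) \<in> theta_alg" by blast
  then show ?case
    by (intro exI[of _ "\<lambda>x b. D x b + E x b"]) (auto intro!: has_derivative_add theta_alg.add)
next
  case (mult f h)
  then obtain D E where "\<forall>x. (f has_derivative D x) (at x)" "\<forall>b. (\<lambda>x. D x b) \<in> theta_alg"
    "\<forall>x. (h has_derivative E x) (at x)" "\<forall>b. (\<lambda>x. E x b) \<in> theta_alg" by blast
  then show ?case using mult.hyps
    by (intro exI[of _ "\<lambda>x b. f x * E x b + D x b * h x"])
       (auto intro!: has_derivative_mult theta_alg.add theta_alg.mult)
qed

section \<open>Partial derivatives, the Laplacian and the wave operator\<close>

lemma dir_deriv_eq:
  assumes "(f has_derivative D) (at x)"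
  shows "dir_deriv b f x = D b"
proof -
  have "((\<lambda>s. x + s *\<^sub>R b) has_derivative (\<lambda>s. s *\<^sub>R b)) (at 0)"
    by (auto intro!: derivative_eq_intros)
  moreover have "(f has_derivative D) (at (x + 0 *\<^sub>R b))" using assms by simp
  ultimately have "((\<lambda>s. f (x + s *\<^sub>R b)) has_derivative (\<lambda>s. D (s *\<^sub>R b))) (at 0)"
    by (rule has_derivative_compose)
  then have "((\<lambda>s. f (x + s *\<^sub>R b)) has_vector_derivative D b) (at 0)"
    unfolding has_vector_derivative_def
    using linear_scale[OF bounded_linear.linear[OF has_derivative_bounded_linear[OF assms]]] by simp
  then show ?thesis unfolding dir_deriv_def by (rule vector_derivative_at)
qed

lemma theta_alg_Ck: "f \<in> theta_alg \<Longrightarrow> Ck n f"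
proof (induction n arbitrary: f)
  case 0
  then obtain D where "\<forall>x. (f has_derivative D x) (at x)" using theta_alg_derivative by blast
  then show ?case by (auto intro!: continuous_at_imp_continuous_on has_derivative_continuous)
next
  case (Suc n)
  then obtain D where D: "\<forall>x. (f has_derivative D x) (at x)" "\<forall>b. (\<lambda>x. D x b) \<in> theta_alg"
    using theta_alg_derivative by blast
  then have "dir_deriv b f = (\<lambda>x. D x b)" for b by (auto simp: dir_deriv_eq)
  then show ?case using D Suc.IH by (auto simp: differentiable_def)
qed

lemma theta_alg_test_function:
  assumes "f \<in> theta_alg" "compact K" "K \<subseteq> \<Omega>" "\<And>x. x \<notin> K \<Longrightarrow> f x = 0"
  shows "test_function \<Omega> f"
  unfolding test_function_def using assms theta_alg_Ck by blast

text \<open>Each derivative in a direction \<open>b\<close> pulls out a factor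
  \<open>(x - x0) \<bullet> b\<close> and raises the index by one. The second derivatives, summed
  over the basis, are the right-hand side of \<open>Theta_recurrence\<close> for
  \<open>g''\<close>.\<close>

lemma laplacian_Theta:
  fixes x0 :: "real^3"
  assumes g: "smooth g" "\<And>x. (g has_vector_derivative g' x) (at x)"
    "\<And>x. (g' has_vector_derivative g'' x) (at x)"
  shows "laplacian (\<lambda>x. c * Theta 0 g \<tau> (x - x0)) x = c * Theta 0 g'' \<tau> (x - x0)"
proof -
  have sm: "smooth g'" "smooth g''" using smooth_vector_derivative g by blast+
  obtain g3 where g3: "\<And>x. (g'' has_vector_derivative g3 x) (at x)" "smooth g3"
    using smooth_deriv[OF sm(2)] by metis
  obtain g4 where g4: "\<And>x. (g3 has_vector_derivative g4 x) (at x)" "smooth g4"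
    using smooth_deriv[OF g3(2)] by metis
  let ?y = "x - x0"
  have D: "((\<lambda>x. Theta n h \<tau> (x - x0)) has_derivative
      (\<lambda>b. (((z - x0) \<bullet> b) / (2 * real (Suc n))) *\<^sub>R Theta (Suc n) h2 \<tau> (z - x0))) (at z)"
    if "smooth h" "\<And>x. (h has_vector_derivative h1 x) (at x)" "\<And>x. (h1 has_vector_derivative h2 x) (at x)"
    for n h h1 h2 z
    using Theta_affine_has_derivative[OF that, of "\<lambda>_. 0" "\<lambda>x. x" n \<tau> "- x0" z]
    by (simp add: bounded_linear_zero bounded_linear_ident)
  have d1: "dir_deriv b (\<lambda>x. c * Theta 0 g \<tau> (x - x0)) = (\<lambda>z. c * ((((z - x0) \<bullet> b) / 2) *\<^sub>R Theta 1 g'' \<tau> (z - x0)))" for b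
    by (rule ext, rule dir_deriv_eq[THEN trans], rule has_derivative_mult_right, rule D[OF g]) simp
  have d2: "dir_deriv b (dir_deriv b (\<lambda>x. c * Theta 0 g \<tau> (x - x0))) x =
     c * (((b \<bullet> b) / 2) *\<^sub>R Theta 1 g'' \<tau> ?y + ((?y \<bullet> b)\<^sup>2 / 8) *\<^sub>R Theta 2 g4 \<tau> ?y)" for b
  proof -
    have i: "((\<lambda>z. ((z - x0) \<bullet> b) / 2) has_derivative (\<lambda>h. (h \<bullet> b) / 2)) (at x)"
      by (auto intro!: derivative_eq_intros)
    show ?thesis unfolding d1
      by (rule dir_deriv_eq[THEN trans], rule has_derivative_mult_right,
          rule has_derivative_scaleR[OF i D[OF sm(2) g3(1) g4(1)]])
        (simp add: numeral_2_eq_2 power2_eq_square algebra_simps)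
  qed
  have "laplacian (\<lambda>x. c * Theta 0 g \<tau> (x - x0)) x =
     c * (\<Sum>b\<in>Basis. ((b \<bullet> b) / 2) *\<^sub>R Theta 1 g'' \<tau> ?y + ((?y \<bullet> b)\<^sup>2 / 8) *\<^sub>R Theta 2 g4 \<tau> ?y)"
    unfolding laplacian_def d2 sum_distrib_left ..
  also have "(\<Sum>b\<in>Basis. ((b \<bullet> b) / 2) *\<^sub>R Theta 1 g'' \<tau> ?y + ((?y \<bullet> b)\<^sup>2 / 8) *\<^sub>R Theta 2 g4 \<tau> ?y) =
     (\<Sum>b\<in>(Basis::(real^3) set). (b \<bullet> b) / 2) *\<^sub>R Theta 1 g'' \<tau> ?y + (\<Sum>b\<in>Basis. (?y \<bullet> b)\<^sup>2 / 8) *\<^sub>R Theta 2 g4 \<tau> ?y"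
    unfolding sum.distrib scaleR_sum_left ..
  also have "(\<Sum>b\<in>(Basis::(real^3) set). (b \<bullet> b) / 2) = 3 / 2" by simp
  also have "(\<Sum>b\<in>Basis. (?y \<bullet> b)\<^sup>2 / 8) = (norm ?y)\<^sup>2 / 8"
    unfolding sum_divide_distrib[symmetric] power2_norm_eq_inner
    by (subst euclidean_inner[of ?y ?y]) (simp add: power2_eq_square)
  finally show ?thesis using Theta_recurrence[OF sm(2) g3(1) g4(1), of \<tau> ?y] by simp
qed

text \<open>The spherical wave itself is annihilated by the wave operator, so only terms in which
  the time cut-off \<open>\<theta>\<close> is differentiated survive; the minus sign comes from the
  reversed time \<open>T - t\<close>.\<close>

lemma wave_op_Theta:
  fixes x0 :: "real^3"
  assumes g: "smooth g" "\<And>x. (g has_vector_derivative g' x) (at x)"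
    "\<And>x. (g' has_vector_derivative g'' x) (at x)"
    and th: "\<And>x. (\<theta> has_vector_derivative \<theta>' x) (at x)" "\<And>x. (\<theta>' has_vector_derivative \<theta>'' x) (at x)"
  shows "wave_op (\<lambda>p. \<theta> (fst p) * Theta 0 g (T - fst p) (snd p - x0)) t x =
    \<theta>'' t * Theta 0 g (T - t) (x - x0) - 2 * \<theta>' t * Theta 0 g' (T - t) (x - x0)"
proof -
  have sm: "smooth g'" "smooth g''" using smooth_vector_derivative g by blast+
  obtain g3 where g3: "\<And>x. (g'' has_vector_derivative g3 x) (at x)" "smooth g3"
    using smooth_deriv[OF sm(2)] by metis
  have D: "((\<lambda>p. Theta n h (T - fst p) (snd p - x0)) has_derivative
      (\<lambda>b. - fst b *\<^sub>R Theta n h1 (T - fst p) (snd p - x0) +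
        (((snd p - x0) \<bullet> snd b) / (2 * real (Suc n))) *\<^sub>R Theta (Suc n) h2 (T - fst p) (snd p - x0))) (at p)"
    if "smooth h" "\<And>x. (h has_vector_derivative h1 x) (at x)" "\<And>x. (h1 has_vector_derivative h2 x) (at x)"
    for n h h1 h2 p
    using Theta_affine_has_derivative[OF that, of "\<lambda>p. - fst p" snd n T "- x0" p]
    by (simp add: bounded_linear_minus bounded_linear_fst bounded_linear_snd)
  have F: "((\<lambda>p::real \<times> (real^3). f (fst p)) has_derivative (\<lambda>b. fst b *\<^sub>R f' (fst p))) (at p)"
    if "\<And>x. (f has_vector_derivative f' x) (at x)" for f f' :: "real \<Rightarrow> complex" and p
  proof -
    have "((\<lambda>p::real \<times> (real^3). fst p) has_derivative (\<lambda>b. fst b)) (at p)"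
      by (auto intro!: derivative_eq_intros)
    from has_derivative_compose[OF this that[unfolded has_vector_derivative_def]] show ?thesis .
  qed
  have d: "dir_deriv (1, 0) (\<lambda>p. f (fst p) * Theta 0 h (T - fst p) (snd p - x0)) =
     (\<lambda>p. f' (fst p) * Theta 0 h (T - fst p) (snd p - x0) - f (fst p) * Theta 0 h1 (T - fst p) (snd p - x0))"
    if "\<And>x. (f has_vector_derivative f' x) (at x)" "smooth h" "\<And>x. (h has_vector_derivative h1 x) (at x)"
      "\<And>x. (h1 has_vector_derivative h2 x) (at x)" for f f' h h1 h2
    by (rule ext, rule dir_deriv_eq[THEN trans], rule has_derivative_mult[OF F[OF that(1)] D[OF that(2-4)]]) simp
  have "dir_deriv (1, 0) (\<lambda>p. \<theta>' (fst p) * Theta 0 g (T - fst p) (snd p - x0) - \<theta> (fst p) * Theta 0 g' (T - fst p) (snd p - x0)) (t, x)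
     = \<theta>'' t * Theta 0 g (T - t) (x - x0) - 2 * \<theta>' t * Theta 0 g' (T - t) (x - x0) + \<theta> t * Theta 0 g'' (T - t) (x - x0)"
    by (rule dir_deriv_eq[THEN trans], rule has_derivative_diff[OF
        has_derivative_mult[OF F[OF th(2)] D[OF g]] has_derivative_mult[OF F[OF th(1)] D[OF sm(1) g(3) g3(1)]]])
      (simp add: algebra_simps)
  then show ?thesis
    unfolding wave_op_def d[OF th(1) g] by (simp add: laplacian_Theta[OF g])
qed

lemma theta_alg_Theta0:
  fixes x0 :: "real^3"
  shows "smooth g \<Longrightarrow> (\<lambda>x. Theta 0 g \<tau> (x - x0)) \<in> theta_alg"
  using theta_alg.Theta[of g "\<lambda>_. 0" "\<lambda>x. x" 0 \<tau> "- x0"]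
  by (simp add: bounded_linear_zero bounded_linear_ident)

lemma theta_alg_wave:
  assumes "smooth g" "smooth \<theta>"
  shows "(\<lambda>p::real \<times> (real^3). \<theta> (fst p) * Theta 0 g (T - fst p) (snd p - x0)) \<in> theta_alg"
proof -
  \<comment> \<open>At \<open>y = 0\<close> the integral over the interval is
    \<open>2 * \<theta>\<close>, which places a function of time alone in the algebra.\<close>
  have "(\<lambda>p::real \<times> (real^3). Theta 0 \<theta> (0 + fst p) (0 + 0 :: real^3)) \<in> theta_alg"
    by (intro theta_alg.Theta assms bounded_linear_fst bounded_linear_zero)
  then have 1: "(\<lambda>p::real \<times> (real^3). complex_of_real (1 / 2) * Theta 0 \<theta> (0 + fst p) (0 + 0 :: real^3)) \<in> theta_alg"
    by (intro theta_alg.mult theta_alg_const)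
  have 2: "(\<lambda>p::real \<times> (real^3). Theta 0 g (T + - fst p) (- x0 + snd p)) \<in> theta_alg"
    by (intro theta_alg.Theta assms bounded_linear_minus bounded_linear_fst bounded_linear_snd)
  from theta_alg.mult[OF 1 2] show ?thesis by (simp add: Theta_at_0)
qed

section \<open>Pairings of square integrable functions\<close>

lemma L2_measurable: "f \<in> L2 \<Longrightarrow> f \<in> borel_measurable lebesgue"
  and L2_integrable: "f \<in> L2 \<Longrightarrow> integrable lebesgue (\<lambda>x. (cmod (f x))\<^sup>2)"
  unfolding L2_def by auto

lemma L2_norm_nonneg: "L2_norm f \<ge> 0"
  unfolding L2_norm_def by (auto intro: Bochner_Integration.integral_nonneg)

lemma L2_norm_power2: "(L2_norm f)\<^sup>2 = (LINT x|lebesgue. (cmod (f x))\<^sup>2)"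
  unfolding L2_norm_def by (simp add: Bochner_Integration.integral_nonneg)

lemma L2_mult_integrable:
  assumes "f \<in> L2" "g \<in> L2"
  shows "integrable lebesgue (\<lambda>x. f x * g x)"
proof (rule Bochner_Integration.integrable_bound)
  show "integrable lebesgue (\<lambda>x. (cmod (f x))\<^sup>2 + (cmod (g x))\<^sup>2)"
    using assms by (intro Bochner_Integration.integrable_add L2_integrable)
  show "(\<lambda>x. f x * g x) \<in> borel_measurable lebesgue"
    using assms by (intro borel_measurable_times L2_measurable)
  have "norm (f x * g x) \<le> norm ((cmod (f x))\<^sup>2 + (cmod (g x))\<^sup>2)" for x
  proof -
    have "0 \<le> (cmod (f x) - cmod (g x))\<^sup>2" by simp
    then have "2 * (cmod (f x) * cmod (g x)) \<le> (cmod (f x))\<^sup>2 + (cmod (g x))\<^sup>2"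
      by (simp add: power2_diff algebra_simps)
    moreover have "0 \<le> cmod (f x) * cmod (g x)" by simp
    ultimately show ?thesis unfolding norm_mult real_norm_def by linarith
  qed
  then show "AE x in lebesgue. norm (f x * g x) \<le> norm ((cmod (f x))\<^sup>2 + (cmod (g x))\<^sup>2)" by simp
qed

text \<open>The pointwise inequality between weighted squares and products, integrated, bounds the
  pairing for every weight \<open>c\<close>; the best weight would be \<open>b / a\<close>.\<close>

lemma L2_Cauchy_Schwarz:
  assumes "f \<in> L2" "g \<in> L2"
  shows "cmod (LINT x|lebesgue. f x * g x) \<le> L2_norm f * L2_norm g"
proof -
  define a b where "a = L2_norm f" and "b = L2_norm g"
  have ab: "a \<ge> 0" "b \<ge> 0" by (auto simp: a_def b_def L2_norm_nonneg)
  let ?X = "cmod (LINT x|lebesgue. f x * g x)"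
  have X: "?X \<le> (c * a\<^sup>2 + b\<^sup>2 / c) / 2" if "c > 0" for c
  proof -
    have "?X \<le> (LINT x|lebesgue. (c * (cmod (f x))\<^sup>2 + (cmod (g x))\<^sup>2 / c) / 2)"
    proof (rule Bochner_Integration.integral_norm_bound_integral)
      show "integrable lebesgue (\<lambda>x. (c * (cmod (f x))\<^sup>2 + (cmod (g x))\<^sup>2 / c) / 2)"
        using assms by (intro integrable_divide Bochner_Integration.integrable_add integrable_mult_right L2_integrable)
      fix x
      have "0 \<le> (c * cmod (f x) - cmod (g x))\<^sup>2 / c" using that by simp
      also have "\<dots> = c * (cmod (f x))\<^sup>2 + (cmod (g x))\<^sup>2 / c - 2 * (cmod (f x) * cmod (g x))"
        using that by (simp add: power2_diff field_simps power2_eq_square)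
      finally show "norm (f x * g x) \<le> (c * (cmod (f x))\<^sup>2 + (cmod (g x))\<^sup>2 / c) / 2"
        by (simp add: norm_mult)
    qed (use assms L2_mult_integrable in auto)
    also have "\<dots> = (c * a\<^sup>2 + b\<^sup>2 / c) / 2"
      using assms unfolding a_def b_def L2_norm_power2
      by (simp add: L2_integrable Bochner_Integration.integral_add integrable_mult_right integrable_divide)
    finally show ?thesis .
  qed
  show ?thesis unfolding a_def[symmetric] b_def[symmetric]
  proof (rule field_le_epsilon)
    fix e :: real assume "e > 0"
    \<comment> \<open>The shift by \<open>d\<close> keeps the nearly optimal weight
      \<open>(b + d) / (a + d)\<close> defined and positive when a norm vanishes; its size makes the
      loss at most \<open>e\<close>.\<close>
    define d where "d = e / (a + b + 1)"
    have d: "d > 0" using ab \<open>e > 0\<close> by (simp add: d_def)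
    have 1: "(b + d) / (a + d) * a\<^sup>2 \<le> (b + d) * a"
    proof -
      have "a / (a + d) \<le> 1" using ab d by simp
      then have "(b + d) * a * (a / (a + d)) \<le> (b + d) * a * 1" using ab d by (intro mult_left_mono) auto
      then show ?thesis by (simp add: power2_eq_square field_simps)
    qed
    have 2: "b\<^sup>2 / ((b + d) / (a + d)) \<le> b * (a + d)"
    proof -
      have "b / (b + d) \<le> 1" using ab d by simp
      then have "b * (a + d) * (b / (b + d)) \<le> b * (a + d) * 1" using ab d by (intro mult_left_mono) auto
      then show ?thesis by (simp add: power2_eq_square field_simps)
    qed
    have "?X \<le> ((b + d) / (a + d) * a\<^sup>2 + b\<^sup>2 / ((b + d) / (a + d))) / 2"
      using ab d by (intro X) (auto intro!: divide_pos_pos)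
    also have "\<dots> \<le> ((b + d) * a + b * (a + d)) / 2"
      by (intro divide_right_mono add_mono 1 2) simp
    also have "\<dots> = a * b + d * (a + b) / 2" by (simp add: field_simps)
    also have "\<dots> \<le> a * b + e"
    proof -
      have "d * (a + b) \<le> d * (a + b + 1)" using d by simp
      also have "\<dots> = e" using ab by (simp add: d_def)
      finally show ?thesis using \<open>e > 0\<close> by simp
    qed
    finally show "?X \<le> a * b + e" .
  qed
qed

lemma L2_scale:
  assumes "f \<in> L2"
  shows "(\<lambda>x. c * f x) \<in> L2"
  using assms unfolding L2_def by (auto simp: norm_mult power_mult_distrib)

lemma L2_add:
  assumes "f \<in> L2" "g \<in> L2"
  shows "(\<lambda>x. f x + g x) \<in> L2"
proof -
  have "integrable lebesgue (\<lambda>x. (cmod (f x + g x))\<^sup>2)"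
  proof (rule Bochner_Integration.integrable_bound)
    show "integrable lebesgue (\<lambda>x. 2 * (cmod (f x))\<^sup>2 + 2 * (cmod (g x))\<^sup>2)"
      using assms by (intro Bochner_Integration.integrable_add integrable_mult_right L2_integrable)
    show "(\<lambda>x. (cmod (f x + g x))\<^sup>2) \<in> borel_measurable lebesgue"
      using assms[THEN L2_measurable] by measurable
    have "(cmod (f x + g x))\<^sup>2 \<le> 2 * (cmod (f x))\<^sup>2 + 2 * (cmod (g x))\<^sup>2" for x
    proof -
      have "(cmod (f x + g x))\<^sup>2 \<le> (cmod (f x) + cmod (g x))\<^sup>2"
        by (intro power_mono norm_triangle_ineq) auto
      moreover have "0 \<le> (cmod (f x) - cmod (g x))\<^sup>2" by simp
      ultimately show ?thesis unfolding power2_sum power2_diff by linarith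
    qed
    then show "AE x in lebesgue. norm ((cmod (f x + g x))\<^sup>2) \<le> norm (2 * (cmod (f x))\<^sup>2 + 2 * (cmod (g x))\<^sup>2)"
      by simp
  qed
  then show ?thesis using assms[THEN L2_measurable] unfolding L2_def by auto
qed

lemma L2_diff:
  assumes "f \<in> L2" "g \<in> L2"
  shows "(\<lambda>x. f x - g x) \<in> L2"
  using L2_add[OF assms(1) L2_scale[OF assms(2), of "-1"]] by simp

lemma L2_bounded_support:
  fixes \<phi> :: "'a::euclidean_space \<Rightarrow> complex"
  assumes m: "\<phi> \<in> borel_measurable lebesgue" and b: "\<And>x. norm (\<phi> x) \<le> M"
    and s: "\<And>x. x \<notin> cball x0 \<rho> \<Longrightarrow> \<phi> x = 0"
  shows "\<phi> \<in> L2" "L2_norm \<phi> \<le> M * sqrt (measure lebesgue (cball x0 \<rho>))"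
proof -
  have M: "M \<ge> 0" using b[of x0] norm_ge_zero order_trans by blast
  have i: "integrable lebesgue (\<lambda>x. M\<^sup>2 * indicator (cball x0 \<rho>) x :: real)"
    using lmeasurable_cball[of x0 \<rho>] by (intro integrable_mult_right) (auto simp: fmeasurable_def)
  have le: "(cmod (\<phi> x))\<^sup>2 \<le> M\<^sup>2 * indicator (cball x0 \<rho>) x" for x
    using b[of x] s[of x] by (auto simp: indicator_def intro!: power_mono)
  have i2: "integrable lebesgue (\<lambda>x. (cmod (\<phi> x))\<^sup>2)"
    by (rule Bochner_Integration.integrable_bound[OF i]) (use m le in auto)
  then show "\<phi> \<in> L2" using m unfolding L2_def by auto
  have "(LINT x|lebesgue. (cmod (\<phi> x))\<^sup>2) \<le> (LINT x|lebesgue. M\<^sup>2 * indicator (cball x0 \<rho>) x)"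
    by (rule integral_mono[OF i2 i le])
  also have "\<dots> = M\<^sup>2 * measure lebesgue (cball x0 \<rho>)" by simp
  finally show "L2_norm \<phi> \<le> M * sqrt (measure lebesgue (cball x0 \<rho>))"
    unfolding L2_norm_def using M by (metis real_sqrt_le_iff real_sqrt_mult real_sqrt_abs abs_of_nonneg)
qed

lemma L2_pairing_continuous:
  assumes "L2_continuous_on S u" "L2_continuous_on S v"
  shows "continuous_on S (\<lambda>t. LINT x|lebesgue. u t x * v t x)"
  unfolding continuous_on_def
proof
  fix t assume t: "t \<in> S"
  let ?A = "\<lambda>s x. u s x - u t x" and ?B = "\<lambda>s x. v s x - v t x"
  have L: "u s \<in> L2" "v s \<in> L2" if "s \<in> S" for s
    using assms that unfolding L2_continuous_on_def by auto
  have lim: "((\<lambda>s. L2_norm (?A s)) \<longlongrightarrow> 0) (at t within S)" "((\<lambda>s. L2_norm (?B s)) \<longlongrightarrow> 0) (at t within S)"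
    using assms t unfolding L2_continuous_on_def by auto
  let ?m = "\<lambda>t. LINT x|lebesgue. u t x * v t x"
  have "((\<lambda>s. ?m s - ?m t) \<longlongrightarrow> 0) (at t within S)"
  proof (rule Lim_null_comparison)
    show "((\<lambda>s. L2_norm (?A s) * L2_norm (v t) + L2_norm (u t) * L2_norm (?B s) + L2_norm (?A s) * L2_norm (?B s)) \<longlongrightarrow> 0) (at t within S)"
      by (rule tendsto_eq_intros lim refl | simp)+
    show "\<forall>\<^sub>F s in at t within S. norm (?m s - ?m t) \<le>
        L2_norm (?A s) * L2_norm (v t) + L2_norm (u t) * L2_norm (?B s) + L2_norm (?A s) * L2_norm (?B s)"
      unfolding eventually_at_filter
    proof (intro always_eventually allI impI)
      fix s assume s: "s \<in> S"
      note D = L2_diff[OF L(1)[OF s] L(1)[OF t]] L2_diff[OF L(2)[OF s] L(2)[OF t]]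
      note I = has_bochner_integral_add has_bochner_integral_diff has_bochner_integral_integrable
        L2_mult_integrable L D s t
      have "has_bochner_integral lebesgue (\<lambda>x. u s x * v s x - u t x * v t x) (?m s - ?m t)"
        by (intro I)
      moreover have "has_bochner_integral lebesgue (\<lambda>x. ?A s x * v t x + u t x * ?B s x + ?A s x * ?B s x)
        ((LINT x|lebesgue. ?A s x * v t x) + (LINT x|lebesgue. u t x * ?B s x) + (LINT x|lebesgue. ?A s x * ?B s x))"
        by (intro I)
      moreover have "(\<lambda>x. u s x * v s x - u t x * v t x) = (\<lambda>x. ?A s x * v t x + u t x * ?B s x + ?A s x * ?B s x)"
      proof -
        have gen: "a * b - c * d = (a - c) * d + c * (b - d) + (a - c) * (b - d)" for a b c d :: complex
          by (simp add: algebra_simps)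
        show ?thesis by (rule ext) (rule gen)
      qed
      ultimately have "?m s - ?m t = (LINT x|lebesgue. ?A s x * v t x) + (LINT x|lebesgue. u t x * ?B s x) + (LINT x|lebesgue. ?A s x * ?B s x)"
        by (simp only:) (rule has_bochner_integral_eq)
      then show "norm (?m s - ?m t) \<le>
        L2_norm (?A s) * L2_norm (v t) + L2_norm (u t) * L2_norm (?B s) + L2_norm (?A s) * L2_norm (?B s)"
        by (simp only:) (intro norm_triangle_mono L2_Cauchy_Schwarz L D s t)
    qed
  qed
  then show "(?m \<longlongrightarrow> ?m t) (at t within S)" by (rule LIM_zero_cancel)
qed

text \<open>The increment of each factor is \<open>s - t\<close> times the sum of its derivative and
  a remainder small in \<open>L2\<close>; after expanding, Cauchy-Schwarz handles every product.
  Only norms at fixed times enter, so the representatives may be chosen separately for each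
  time.\<close>

lemma L2_pairing_has_vector_derivative:
  assumes "L2_C1_on S u u'" "L2_C1_on S v v'" and t: "t \<in> S"
  shows "((\<lambda>t. LINT x|lebesgue. u t x * v t x) has_vector_derivative
    ((LINT x|lebesgue. u' t x * v t x) + (LINT x|lebesgue. u t x * v' t x))) (at t within S)"
proof -
  let ?A = "\<lambda>s x. (u s x - u t x) / complex_of_real (s - t) - u' t x"
  let ?B = "\<lambda>s x. (v s x - v t x) / complex_of_real (s - t) - v' t x"
  let ?P = "\<lambda>f g. LINT x|lebesgue. f x * g x :: complex"
  have L: "u s \<in> L2" "v s \<in> L2" "u' s \<in> L2" "v' s \<in> L2" if "s \<in> S" for s
    using assms that unfolding L2_C1_on_def L2_continuous_on_def by auto
  have lim: "((\<lambda>s. L2_norm (?A s)) \<longlongrightarrow> 0) (at t within S)" "((\<lambda>s. L2_norm (?B s)) \<longlongrightarrow> 0) (at t within S)"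
    using assms t unfolding L2_C1_on_def by auto
  let ?m = "\<lambda>t. LINT x|lebesgue. u t x * v t x"
  let ?D = "?P (u' t) (v t) + ?P (u t) (v' t)"
  let ?bd = "\<lambda>s. L2_norm (?A s) * L2_norm (v t) + L2_norm (u t) * L2_norm (?B s) +
     \<bar>s - t\<bar> * (L2_norm (u' t) * L2_norm (v' t) + L2_norm (?A s) * L2_norm (v' t) +
       L2_norm (u' t) * L2_norm (?B s) + L2_norm (?A s) * L2_norm (?B s))"
  have st: "((\<lambda>s. \<bar>s - t\<bar>) \<longlongrightarrow> 0) (at t within S)"
    by (auto intro!: tendsto_eq_intros)
  show ?thesis
    unfolding has_vector_derivative_def has_derivative_within
  proof (rule conjI[OF bounded_linear_scaleR_left], rule Lim_null_comparison)
    have "(?bd \<longlongrightarrow> 0 * L2_norm (v t) + L2_norm (u t) * 0 + 0 * (L2_norm (u' t) * L2_norm (v' t) + 0 * L2_norm (v' t) +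
        L2_norm (u' t) * 0 + 0 * 0)) (at t within S)"
      by (intro tendsto_add tendsto_mult tendsto_const lim st)
    then show "(?bd \<longlongrightarrow> 0) (at t within S)" by simp
    show "\<forall>\<^sub>F s in at t within S. norm ((1 / norm (s - t)) *\<^sub>R (?m s - (?m t + (s - t) *\<^sub>R ?D))) \<le> ?bd s"
      unfolding eventually_at_filter
    proof (intro always_eventually allI impI)
      fix s assume st: "s \<noteq> t" and s: "s \<in> S"
      have A: "?A s \<in> L2" "?B s \<in> L2"
        using L2_diff[OF L2_scale[OF L2_diff[OF L(1)[OF s] L(1)[OF t]], of "1 / complex_of_real (s - t)"] L(3)[OF t]]
          L2_diff[OF L2_scale[OF L2_diff[OF L(2)[OF s] L(2)[OF t]], of "1 / complex_of_real (s - t)"] L(4)[OF t]]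
        by simp_all
      let ?d = "complex_of_real (s - t)"
      have d0: "?d \<noteq> 0" using st by simp
      have us: "u s x = u t x + ?d * (u' t x + ?A s x)" "v s x = v t x + ?d * (v' t x + ?B s x)" for x
        using d0 by (simp_all add: field_simps)
      have pt: "u s x * v s x - u t x * v t x - ?d * (u' t x * v t x + u t x * v' t x) =
         ?d * (?A s x * v t x + u t x * ?B s x + ?d * (u' t x * v' t x + ?A s x * v' t x + u' t x * ?B s x + ?A s x * ?B s x))" for x
      proof -
        have gen: "(a + d * (a' + A)) * (b + d * (b' + B)) - a * b - d * (a' * b + a * b') =
          d * (A * b + a * B + d * (a' * b' + A * b' + a' * B + A * B))" for a a' A b b' B d :: complex
          by (simp add: algebra_simps)
        show ?thesis by (subst us(1), subst us(2), rule gen)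
      qed
      note I = has_bochner_integral_add has_bochner_integral_diff has_bochner_integral_mult_right
        has_bochner_integral_integrable L2_mult_integrable L A s t
      have "has_bochner_integral lebesgue
          (\<lambda>x. u s x * v s x - u t x * v t x - ?d * (u' t x * v t x + u t x * v' t x))
          (?P (u s) (v s) - ?P (u t) (v t) - ?d * (?P (u' t) (v t) + ?P (u t) (v' t)))"
        by (intro I)
      moreover have "has_bochner_integral lebesgue
         (\<lambda>x. ?d * (?A s x * v t x + u t x * ?B s x + ?d * (u' t x * v' t x + ?A s x * v' t x + u' t x * ?B s x + ?A s x * ?B s x)))
         (?d * (?P (?A s) (v t) + ?P (u t) (?B s) + ?d * (?P (u' t) (v' t) + ?P (?A s) (v' t) + ?P (u' t) (?B s) + ?P (?A s) (?B s))))"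
        by (intro I)
      ultimately have "?P (u s) (v s) - ?P (u t) (v t) - ?d * (?P (u' t) (v t) + ?P (u t) (v' t)) =
         ?d * (?P (?A s) (v t) + ?P (u t) (?B s) + ?d * (?P (u' t) (v' t) + ?P (?A s) (v' t) + ?P (u' t) (?B s) + ?P (?A s) (?B s)))"
        unfolding pt by (rule has_bochner_integral_eq)
      then have "?m s - (?m t + (s - t) *\<^sub>R ?D) =
         ?d * (?P (?A s) (v t) + ?P (u t) (?B s) + ?d * (?P (u' t) (v' t) + ?P (?A s) (v' t) + ?P (u' t) (?B s) + ?P (?A s) (?B s)))"
        unfolding scaleR_conv_of_real by (simp only: diff_diff_eq)
      then have "norm ((1 / norm (s - t)) *\<^sub>R (?m s - (?m t + (s - t) *\<^sub>R ?D))) =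
        norm (?P (?A s) (v t) + ?P (u t) (?B s) + ?d * (?P (u' t) (v' t) + ?P (?A s) (v' t) + ?P (u' t) (?B s) + ?P (?A s) (?B s)))"
        using st by (simp only: norm_scaleR norm_mult) (simp del: of_real_diff)
      also have "\<dots> \<le> ?bd s"
      proof -
        have "norm (?P (u' t) (v' t) + ?P (?A s) (v' t) + ?P (u' t) (?B s) + ?P (?A s) (?B s)) \<le>
          L2_norm (u' t) * L2_norm (v' t) + L2_norm (?A s) * L2_norm (v' t) +
            L2_norm (u' t) * L2_norm (?B s) + L2_norm (?A s) * L2_norm (?B s)" (is "norm ?Z \<le> ?R")
          by (intro norm_triangle_mono L2_Cauchy_Schwarz L A s t)
        then have "norm (?d * ?Z) \<le> \<bar>s - t\<bar> * ?R"
          unfolding norm_mult norm_of_real by (intro mult_left_mono) auto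
        then show ?thesis by (intro norm_triangle_mono L2_Cauchy_Schwarz L A s t)
      qed
      finally show "norm ((1 / norm (s - t)) *\<^sub>R (?m s - (?m t + (s - t) *\<^sub>R ?D))) \<le> ?bd s" .
    qed
  qed
qed

text \<open>On a common ball the uniform norm controls the \<open>L2\<close> norm, so explicit test
  waves need only pointwise first and second order estimates in time.\<close>

lemma L2_C1_on_uniform:
  fixes \<Psi> \<Psi>' :: "real \<Rightarrow> 'a::euclidean_space \<Rightarrow> complex"
  assumes m: "\<And>t. t \<in> S \<Longrightarrow> \<Psi> t \<in> borel_measurable lebesgue" "\<And>t. t \<in> S \<Longrightarrow> \<Psi>' t \<in> borel_measurable lebesgue"
    and s: "\<And>t x. t \<in> S \<Longrightarrow> x \<notin> cball x0 \<rho> \<Longrightarrow> \<Psi> t x = 0 \<and> \<Psi>' t x = 0"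
    and b: "\<And>t x. t \<in> S \<Longrightarrow> norm (\<Psi> t x) \<le> M" "\<And>t x. t \<in> S \<Longrightarrow> norm (\<Psi>' t x) \<le> M"
    and l: "\<And>t s x. t \<in> S \<Longrightarrow> s \<in> S \<Longrightarrow> norm (\<Psi> s x - \<Psi> t x) \<le> M * \<bar>s - t\<bar>"
      "\<And>t s x. t \<in> S \<Longrightarrow> s \<in> S \<Longrightarrow> norm (\<Psi>' s x - \<Psi>' t x) \<le> M * \<bar>s - t\<bar>"
      "\<And>t s x. t \<in> S \<Longrightarrow> s \<in> S \<Longrightarrow> norm (\<Psi> s x - \<Psi> t x - (s - t) *\<^sub>R \<Psi>' t x) \<le> M * (s - t)\<^sup>2"
  shows "L2_C1_on S \<Psi> \<Psi>'"
proof -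
  let ?c = "sqrt (measure lebesgue (cball x0 \<rho>))"
  have st: "((\<lambda>s. M * \<bar>s - t\<bar> * ?c) \<longlongrightarrow> 0) (at t within S)" for t
    by (auto intro!: tendsto_eq_intros)
  have *: "((\<lambda>s. L2_norm (\<lambda>x. h s x)) \<longlongrightarrow> 0) (at t within S)"
    if "\<And>s. s \<in> S \<Longrightarrow> s \<noteq> t \<Longrightarrow> h s \<in> borel_measurable lebesgue"
      "\<And>s x. s \<in> S \<Longrightarrow> s \<noteq> t \<Longrightarrow> norm (h s x) \<le> M * \<bar>s - t\<bar>"
      "\<And>s x. s \<in> S \<Longrightarrow> s \<noteq> t \<Longrightarrow> x \<notin> cball x0 \<rho> \<Longrightarrow> h s x = 0" for h :: "real \<Rightarrow> 'a \<Rightarrow> complex" and t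
  proof (rule Lim_null_comparison[OF _ st])
    show "\<forall>\<^sub>F s in at t within S. norm (L2_norm (\<lambda>x. h s x)) \<le> M * \<bar>s - t\<bar> * ?c"
      unfolding eventually_at_filter
    proof (intro always_eventually allI impI)
      fix s assume "s \<noteq> t" "s \<in> S"
      then have "L2_norm (h s) \<le> M * \<bar>s - t\<bar> * ?c"
        by (intro L2_bounded_support(2) that)
      then show "norm (L2_norm (\<lambda>x. h s x)) \<le> M * \<bar>s - t\<bar> * ?c"
        using L2_norm_nonneg[of "h s"] by simp
    qed
  qed
  have c: "L2_continuous_on S \<Psi>" "L2_continuous_on S \<Psi>'"
    unfolding L2_continuous_on_def
    by (intro conjI ballI L2_bounded_support(1)[of _ M x0 \<rho>] * m b l borel_measurable_diff; simp add: s)+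
  have "((\<lambda>s. L2_norm (\<lambda>x. (\<Psi> s x - \<Psi> t x) / complex_of_real (s - t) - \<Psi>' t x)) \<longlongrightarrow> 0) (at t within S)"
    if t: "t \<in> S" for t
  proof (rule *)
    fix s x assume s: "s \<in> S" "s \<noteq> t"
    have "(\<Psi> s x - \<Psi> t x) / complex_of_real (s - t) - \<Psi>' t x = (\<Psi> s x - \<Psi> t x - (s - t) *\<^sub>R \<Psi>' t x) / complex_of_real (s - t)"
      using s by (simp add: field_simps scaleR_conv_of_real)
    then have "norm ((\<Psi> s x - \<Psi> t x) / complex_of_real (s - t) - \<Psi>' t x) =
       norm (\<Psi> s x - \<Psi> t x - (s - t) *\<^sub>R \<Psi>' t x) / \<bar>s - t\<bar>"
      by (simp only: norm_divide norm_of_real)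
    also have "\<dots> \<le> M * (s - t)\<^sup>2 / \<bar>s - t\<bar>"
      by (intro divide_right_mono l t s) auto
    also have "\<dots> = M * \<bar>s - t\<bar>"
      using s by (simp add: field_simps power2_eq_square flip: abs_mult)
    finally show "norm ((\<Psi> s x - \<Psi> t x) / complex_of_real (s - t) - \<Psi>' t x) \<le> M * \<bar>s - t\<bar>" .
  qed (use t m s in \<open>auto intro!: borel_measurable_diff borel_measurable_divide\<close>)
  then show ?thesis using c unfolding L2_C1_on_def by blast
qed

section \<open>Duality for the wave equation\<close>

lemma support_derivative:
  assumes "\<And>x. (f has_vector_derivative g x) (at x)" "\<And>s::real. \<bar>s\<bar> > K \<Longrightarrow> f s = 0" "\<bar>s\<bar> > K"
  shows "g s = 0"
proof -
  have "((\<lambda>_. 0) has_vector_derivative g s) (at s)"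
  proof (rule has_vector_derivative_transform_within_open[OF assms(1)])
    show "open {s. K < \<bar>s\<bar>}" by (intro open_Collect_less continuous_intros)
  qed (use assms in auto)
  then show ?thesis by (rule vector_derivative_unique_at[OF _ has_vector_derivative_const])
qed

lemma compact_support_bounded:
  assumes "smooth g" "\<And>s::real. \<bar>s\<bar> > K \<Longrightarrow> g s = 0"
  obtains M where "M \<ge> 0" "\<And>s. norm (g s) \<le> M"
proof -
  obtain M where M: "M \<ge> 0" "\<And>x. \<bar>x\<bar> \<le> K \<Longrightarrow> norm (g x) \<le> M"
    using smooth_bounded_on[OF assms(1)] by blast
  have "norm (g s) \<le> M" for s
    using M assms(2)[of s] by (cases "\<bar>s\<bar> \<le> K") auto
  then show ?thesis using that M(1) by blast
qed

text \<open>Finite speed of propagation. The support condition is put on the primitive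
  \<open>f\<close> rather than on \<open>g\<close>: a nonzero total integral of \<open>g\<close>
  would leave a tail of order \<open>1 / norm y\<close>.\<close>

lemma Theta_0_support:
  assumes "\<And>x. (f has_vector_derivative g x) (at x)" "\<And>s::real. \<bar>s\<bar> > K \<Longrightarrow> f s = 0" "K \<ge> 0"
    and "norm y > K + \<bar>\<tau>\<bar>"
  shows "Theta 0 g \<tau> y = 0"
proof -
  have "y \<noteq> 0" using assms by auto
  moreover have "f (\<tau> + norm y) = 0" "f (\<tau> - norm y) = 0"
    using assms by (auto intro!: assms(2))
  ultimately show ?thesis using Theta_0_eq[OF assms(1), of y \<tau>] by simp
qed

lemma Theta_0_bounds:
  assumes g: "smooth g" "\<And>x. (g has_vector_derivative g' x) (at x)" "\<And>x. (g' has_vector_derivative g'' x) (at x)"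
    and M: "\<And>s. norm (g s) \<le> M" "\<And>s. norm (g' s) \<le> M" "\<And>s. norm (g'' s) \<le> M"
  shows "norm (Theta 0 g \<tau> y) \<le> 2 * M"
    and "norm (Theta 0 g \<tau>' y - Theta 0 g \<tau> y) \<le> 2 * M * \<bar>\<tau>' - \<tau>\<bar>"
    and "norm (Theta 0 g \<tau>' y - Theta 0 g \<tau> y - (\<tau>' - \<tau>) *\<^sub>R Theta 0 g' \<tau> y) \<le> 2 * M * (\<tau>' - \<tau>)\<^sup>2"
proof -
  have M0: "M \<ge> 0" using M(1) norm_ge_zero order_trans by blast
  have sm: "smooth g'" using smooth_vector_derivative g by blast
  have I: "((\<lambda>\<xi>. h (\<tau> + norm y * \<xi>)) has_integral Theta 0 h \<tau> y) {-1..1}" if "smooth h" for h \<tau>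
    using integrable_integral[OF Theta_integrable[OF that, of "-1" 1 "\<lambda>_. 1" \<tau> "norm y"]]
    by (simp add: Theta_def)
  have b: "norm i \<le> 2 * B" if "(r has_integral i) {-1..1::real}" "\<And>\<xi>. norm (r \<xi>) \<le> B" for r :: "real \<Rightarrow> complex" and i B
  proof -
    have "B \<ge> 0" using that(2) norm_ge_zero order_trans by blast
    then show ?thesis using has_integral_bound_real[OF _ finite.emptyI that(1), of B] that(2) by simp
  qed
  show "norm (Theta 0 g \<tau> y) \<le> 2 * M"
    by (rule b[OF I[OF g(1)] M(1)])
  have "norm (g b - g a) \<le> M * \<bar>b - a\<bar>" for a b
  proof -
    have "norm (g b - g a) \<le> M * norm (b - a)"
    proof (rule differentiable_bound[of UNIV g "\<lambda>x h. h *\<^sub>R g' x"])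
      show "onorm (\<lambda>h. h *\<^sub>R g' x) \<le> M" for x
        using mult_left_mono[OF M(2)[of x], of "\<bar>h\<bar>" for h] by (intro onorm_le) (simp add: mult_ac)
    qed (use g(2) in \<open>auto simp: has_vector_derivative_def\<close>)
    then show ?thesis by simp
  qed
  then have "norm (g (\<tau>' + norm y * \<xi>) - g (\<tau> + norm y * \<xi>)) \<le> M * \<bar>\<tau>' - \<tau>\<bar>" for \<xi>
    by (metis add_diff_cancel_right)
  from b[OF has_integral_diff[OF I[OF g(1)] I[OF g(1)]] this]
  show "norm (Theta 0 g \<tau>' y - Theta 0 g \<tau> y) \<le> 2 * M * \<bar>\<tau>' - \<tau>\<bar>" by simp
  have "norm (g b - g a - (b - a) *\<^sub>R g' a) \<le> M * (b - a)\<^sup>2" for a b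
    by (rule taylor2[OF g(2,3), where K = "max \<bar>a\<bar> \<bar>b\<bar>"]) (auto intro: M(3))
  then have "norm (g (\<tau>' + norm y * \<xi>) - g (\<tau> + norm y * \<xi>) - (\<tau>' - \<tau>) *\<^sub>R g' (\<tau> + norm y * \<xi>)) \<le> M * (\<tau>' - \<tau>)\<^sup>2" for \<xi>
    by (metis add_diff_cancel_right)
  from b[OF has_integral_diff[OF has_integral_diff[OF I[OF g(1)] I[OF g(1)]] has_integral_cmul[OF I[OF sm]]] this]
  show "norm (Theta 0 g \<tau>' y - Theta 0 g \<tau> y - (\<tau>' - \<tau>) *\<^sub>R Theta 0 g' \<tau> y) \<le> 2 * M * (\<tau>' - \<tau>)\<^sup>2" by simp
qed

lemma theta_alg_continuous: "f \<in> theta_alg \<Longrightarrow> continuous_on UNIV f"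
  using theta_alg_Ck[of f 0] by simp

lemma continuous_lebesgue_measurable:
  fixes f :: "'a::euclidean_space \<Rightarrow> 'b::topological_space"
  shows "continuous_on UNIV f \<Longrightarrow> f \<in> borel_measurable lebesgue"
  by (intro measurable_completion) (simp add: borel_measurable_continuous_onI)

lemma Theta_0_measurable:
  fixes x0 :: "real^3"
  shows "smooth g \<Longrightarrow> (\<lambda>x. Theta 0 g \<tau> (x - x0)) \<in> borel_measurable lebesgue"
  by (intro continuous_lebesgue_measurable theta_alg_continuous theta_alg_Theta0)

lemma Theta_L2_C1:
  fixes x0 :: "real^3"
  assumes f: "smooth f" "\<And>x. (f has_vector_derivative g x) (at x)" "\<And>x. (g has_vector_derivative g' x) (at x)"
    and K: "\<And>s. \<bar>s\<bar> > K \<Longrightarrow> f s = 0" "K \<ge> 0"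
  shows "L2_C1_on {0..T} (\<lambda>t x. Theta 0 g (T - t) (x - x0)) (\<lambda>t x. - Theta 0 g' (T - t) (x - x0))"
proof -
  have sm: "smooth g" "smooth g'" using smooth_vector_derivative f by blast+
  obtain g2 where g2: "\<And>x. (g' has_vector_derivative g2 x) (at x)" "smooth g2"
    using smooth_deriv[OF sm(2)] by metis
  obtain g3 where g3: "\<And>x. (g2 has_vector_derivative g3 x) (at x)" "smooth g3"
    using smooth_deriv[OF g2(2)] by metis
  have s: "\<And>s. \<bar>s\<bar> > K \<Longrightarrow> g s = 0" "\<And>s. \<bar>s\<bar> > K \<Longrightarrow> g' s = 0" "\<And>s. \<bar>s\<bar> > K \<Longrightarrow> g2 s = 0" "\<And>s. \<bar>s\<bar> > K \<Longrightarrow> g3 s = 0"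
    using support_derivative[OF f(2) K(1)] support_derivative[OF f(3)] support_derivative[OF g2(1)]
      support_derivative[OF g3(1)] by metis+
  obtain M0 M1 M2 M3 where M: "\<And>s. norm (g s) \<le> M0" "\<And>s. norm (g' s) \<le> M1" "\<And>s. norm (g2 s) \<le> M2" "\<And>s. norm (g3 s) \<le> M3"
    "M0 \<ge> 0" "M1 \<ge> 0" "M2 \<ge> 0" "M3 \<ge> 0"
    using compact_support_bounded[OF sm(1) s(1)] compact_support_bounded[OF sm(2) s(2)]
      compact_support_bounded[OF g2(2) s(3)] compact_support_bounded[OF g3(2) s(4)] by metis
  define M where "M = M0 + M1 + M2 + M3"
  have B: "norm (g s) \<le> M" "norm (g' s) \<le> M" "norm (g2 s) \<le> M" "norm (g3 s) \<le> M" for s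
    using M(1-4)[of s] M(5-8) unfolding M_def by linarith+
  show ?thesis
  proof (rule L2_C1_on_uniform[where \<rho> = "K + T" and M = "2 * M"])
    fix t x assume t: "t \<in> {0..T}" and x: "x \<notin> cball x0 (K + T)"
    have "norm (x - x0) > K + \<bar>T - t\<bar>" using t x by (auto simp: dist_norm norm_minus_commute)
    then show "Theta 0 g (T - t) (x - x0) = 0 \<and> - Theta 0 g' (T - t) (x - x0) = 0"
      by (simp add: Theta_0_support[OF f(2) K] Theta_0_support[OF f(3) s(1) K(2)])
  next
    fix t s x
    show "norm (Theta 0 g (T - s) (x - x0) - Theta 0 g (T - t) (x - x0)) \<le> 2 * M * \<bar>s - t\<bar>"
      using Theta_0_bounds(2)[OF sm(1) f(3) g2(1) B(1-3), of "T - s" "x - x0" "T - t"] by (simp add: abs_minus_commute)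
    show "norm (- Theta 0 g' (T - s) (x - x0) - - Theta 0 g' (T - t) (x - x0)) \<le> 2 * M * \<bar>s - t\<bar>"
      using Theta_0_bounds(2)[OF sm(2) g2(1) g3(1) B(2-4), of "T - s" "x - x0" "T - t"]
      by (simp add: abs_minus_commute norm_minus_commute)
    show "norm (Theta 0 g (T - s) (x - x0) - Theta 0 g (T - t) (x - x0) - (s - t) *\<^sub>R (- Theta 0 g' (T - t) (x - x0))) \<le> 2 * M * (s - t)\<^sup>2"
      using Theta_0_bounds(3)[OF sm(1) f(3) g2(1) B(1-3), of "T - s" "x - x0" "T - t"]
      by (simp add: power2_commute algebra_simps)
    show "norm (Theta 0 g (T - t) (x - x0)) \<le> 2 * M"
      by (rule Theta_0_bounds(1)[OF sm(1) f(3) g2(1) B(1-3)])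
    show "norm (- Theta 0 g' (T - t) (x - x0)) \<le> 2 * M"
      unfolding norm_minus_cancel by (rule Theta_0_bounds(1)[OF sm(2) g2(1) g3(1) B(2-4)])
    show "(\<lambda>x. Theta 0 g (T - t) (x - x0)) \<in> borel_measurable lebesgue"
      by (rule Theta_0_measurable[OF sm(1)])
    show "(\<lambda>x. - Theta 0 g' (T - t) (x - x0)) \<in> borel_measurable lebesgue"
      by (rule borel_measurable_uminus[OF Theta_0_measurable[OF sm(2)]])
  qed
qed

section \<open>From a weak identity in time to a conserved quantity\<close>

lemma mollify:
  fixes r :: "real \<Rightarrow> complex"
  assumes w: "(w has_integral 1) {a..b}" "continuous_on {a..b} w" "\<And>t. w t \<ge> 0" "\<And>t. \<bar>t - c\<bar> > \<delta> \<Longrightarrow> w t = 0"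
    and r: "continuous_on {a..b} r" "\<And>t. t \<in> {a..b} \<Longrightarrow> \<bar>t - c\<bar> \<le> \<delta> \<Longrightarrow> norm (r t - r c) \<le> e"
  shows "norm (integral {a..b} (\<lambda>t. of_real (w t) * r t) - r c) \<le> e"
proof -
  have i: "(\<lambda>t. of_real (w t) * r t) integrable_on {a..b}"
    by (intro integrable_continuous_real continuous_intros w r)
  have A: "((\<lambda>t. of_real (w t) * r t - of_real (w t) * r c) has_integral
      (integral {a..b} (\<lambda>t. of_real (w t) * r t) - of_real 1 * r c)) {a..b}"
    by (intro has_integral_diff integrable_integral i has_integral_mult_left has_integral_of_real w)
  have B: "((\<lambda>t. w t * e) has_integral (1 * e)) {a..b}"
    by (intro has_integral_mult_left w)
  have "norm (of_real (w t) * r t - of_real (w t) * r c) \<le> w t * e" if "t \<in> {a..b}" for t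
  proof (cases "\<bar>t - c\<bar> \<le> \<delta>")
    case True
    then show ?thesis using r(2)[OF that] w(3)[of t]
      by (simp add: right_diff_distrib[symmetric] norm_mult mult_left_mono)
  next
    case False
    then show ?thesis using w(4)[of t] by simp
  qed
  from Henstock_Kurzweil_Integration.integral_norm_bound_integral[OF has_integral_integrable[OF A]
      has_integral_integrable[OF B] this]
  have "norm (integral {a..b} (\<lambda>t. of_real (w t) * r t) - of_real 1 * r c) \<le> 1 * e"
    unfolding integral_unique[OF A] integral_unique[OF B] by simp
  then show ?thesis by simp
qed

text \<open>A test function that steps up near \<open>t1\<close> and down near \<open>t2\<close> has
  as derivative the difference of two unit masses, so the hypothesis compares the values of
  \<open>r\<close> at the two times. Continuity carries constancy from the open interval to its end
  points.\<close>

lemma du_bois_reymond: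
  fixes r :: "real \<Rightarrow> complex"
  assumes T: "0 < T" and r: "continuous_on {0..T} r"
    and H: "\<And>\<theta> \<theta>' \<theta>'' a b. smooth \<theta> \<Longrightarrow> (\<And>t. (\<theta> has_vector_derivative \<theta>' t) (at t)) \<Longrightarrow>
      (\<And>t. (\<theta>' has_vector_derivative \<theta>'' t) (at t)) \<Longrightarrow> 0 < a \<Longrightarrow> b < T \<Longrightarrow>
      (\<And>t. t \<notin> {a..b} \<Longrightarrow> \<theta> t = 0) \<Longrightarrow> integral {0..T} (\<lambda>t. \<theta>' t * r t) = 0"
  shows "r 0 = r T"
proof -
  obtain kap kap' kap'' where k: "smooth (\<lambda>s. complex_of_real (kap s))"
     "\<And>s. (kap has_real_derivative kap' s) (at s)"
     "\<And>s. (kap' has_real_derivative kap'' s) (at s)"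
     "\<And>s. kap (- s) = - kap s" "\<And>s. s \<ge> 1 \<Longrightarrow> kap s = 1" "\<And>s. kap' s \<ge> 0"
     "\<And>s. \<bar>s\<bar> \<ge> 1 \<Longrightarrow> kap' s = 0"
    using step_exists by metis
  have km: "kap s = -1" if "s \<le> -1" for s using k(4)[of "-s"] k(5)[of "-s"] that by simp
  have const: "r t1 = r t2" if t: "0 < t1" "t1 < t2" "t2 < T" for t1 t2
  proof -
    have "norm (r t1 - r t2) \<le> 0 + e" if e: "e > 0" for e
    proof -
      have ex: "\<exists>d>0. \<forall>t\<in>{0..T}. \<bar>t - c\<bar> < d \<longrightarrow> norm (r t - r c) \<le> e / 2" if "c \<in> {0..T}" for c
        using r that half_gt_zero[OF e] unfolding continuous_on_iff dist_norm real_norm_def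
        by (meson less_imp_le)
      obtain d1 where d1: "d1 > 0" "\<And>t. t \<in> {0..T} \<Longrightarrow> \<bar>t - t1\<bar> < d1 \<Longrightarrow> norm (r t - r t1) \<le> e / 2"
        using ex[of t1] t by auto
      obtain d2 where d2: "d2 > 0" "\<And>t. t \<in> {0..T} \<Longrightarrow> \<bar>t - t2\<bar> < d2 \<Longrightarrow> norm (r t - r t2) \<le> e / 2"
        using ex[of t2] t by auto
      note d = d1 d2
      \<comment> \<open>The halves leave room: both masses stay inside \<open>(0, T)\<close> and
        inside the windows in which \<open>r\<close> varies by at most \<open>e / 2\<close>.\<close>
      define \<delta> where "\<delta> = Min {d1 / 2, d2 / 2, t1 / 2, (T - t2) / 2}"
      have \<delta>: "\<delta> > 0" "\<delta> < d1" "\<delta> < d2" "\<delta> < t1" "\<delta> < T - t2" using d t by (auto simp: \<delta>_def min_def)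
      define w where "w c t = kap' ((t - c) / \<delta>) / (2 * \<delta>)" for c t
      have aff: "((\<lambda>t. (t - c) / \<delta>) has_real_derivative 1 / \<delta>) (at t within A)" for c t A
        using \<delta> by (auto intro!: derivative_eq_intros)
      have wd: "((\<lambda>t. kap ((t - c) / \<delta>) / 2) has_real_derivative w c t) (at t within A)" for c t A
        using DERIV_cdivide[OF DERIV_chain2[OF k(2) aff[of c t A]], of 2] \<delta> by (simp add: w_def mult.commute)
      have wd2: "((\<lambda>t. w c t) has_real_derivative kap'' ((t - c) / \<delta>) * (1 / \<delta>) / (2 * \<delta>)) (at t within A)" for c t A
        unfolding w_def by (intro DERIV_cdivide DERIV_chain2[OF k(3) aff])
      have wi: "(w c has_integral 1) {0..T}" if "\<delta> < c" "c + \<delta> < T" for c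
      proof -
        have "(w c has_integral (kap ((T - c) / \<delta>) / 2 - kap ((0 - c) / \<delta>) / 2)) {0..T}"
          using T wd by (intro fundamental_theorem_of_calculus)
            (auto simp: has_real_derivative_iff_has_vector_derivative[symmetric])
        moreover have "kap ((T - c) / \<delta>) = 1" "kap ((0 - c) / \<delta>) = -1"
          using that \<delta> by (auto intro!: k(5) km simp: field_simps)
        ultimately show ?thesis by simp
      qed
      have wc: "continuous_on A (w c)" for A c
        using wd2 by (meson DERIV_continuous continuous_on_eq_continuous_within)
      have mol: "norm (integral {0..T} (\<lambda>t. of_real (w c t) * r t) - r c) \<le> e / 2"
        if "\<delta> < c" "c + \<delta> < T" "\<And>t. t \<in> {0..T} \<Longrightarrow> \<bar>t - c\<bar> \<le> \<delta> \<Longrightarrow> norm (r t - r c) \<le> e / 2" for c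
      proof (rule mollify[OF wi[OF that(1,2)] wc _ _ r that(3)])
        show "w c t \<ge> 0" for t using k(6) \<delta> by (simp add: w_def)
        show "w c t = 0" if "\<bar>t - c\<bar> > \<delta>" for t
          using k(7)[of "(t - c) / \<delta>"] that \<delta> by (simp add: w_def)
      qed auto
      let ?th = "\<lambda>t. complex_of_real (kap ((t - t1) / \<delta>) / 2 - kap ((t - t2) / \<delta>) / 2)"
      have "integral {0..T} (\<lambda>t. complex_of_real (w t1 t - w t2 t) * r t) = 0"
      proof (rule H[of ?th _ _ "t1 - \<delta>" "t2 + \<delta>"])
        show "(?th has_vector_derivative complex_of_real (w t1 t - w t2 t)) (at t)" for t
          by (intro has_vector_derivative_of_real DERIV_diff wd)
        show "((\<lambda>t. complex_of_real (w t1 t - w t2 t)) has_vector_derivative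
          complex_of_real (kap'' ((t - t1) / \<delta>) * (1 / \<delta>) / (2 * \<delta>) - kap'' ((t - t2) / \<delta>) * (1 / \<delta>) / (2 * \<delta>))) (at t)" for t
          by (intro has_vector_derivative_of_real DERIV_diff wd2)
        have "smooth (\<lambda>t. complex_of_real (1 / 2) * complex_of_real (kap (1 / \<delta> * t + - (t1 / \<delta>))) -
            complex_of_real (1 / 2) * complex_of_real (kap (1 / \<delta> * t + - (t2 / \<delta>))))"
          by (intro smooth_diff smooth_mult smooth_const smooth_affine[OF k(1)])
        then show "smooth ?th" by (simp add: diff_divide_distrib)
        show "?th t = 0" if t': "t \<notin> {t1 - \<delta>..t2 + \<delta>}" for t
        proof -
          have "t \<le> t1 - \<delta> \<or> t \<ge> t2 + \<delta>" using t' by auto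
          then have "kap ((t - t1) / \<delta>) = kap ((t - t2) / \<delta>)"
          proof
            assume "t \<le> t1 - \<delta>"
            then have "(t - t1) / \<delta> \<le> -1" "(t - t2) / \<delta> \<le> -1" using \<delta> t by (auto simp: field_simps)
            then show ?thesis using km by simp
          next
            assume "t \<ge> t2 + \<delta>"
            then have "(t - t1) / \<delta> \<ge> 1" "(t - t2) / \<delta> \<ge> 1" using \<delta> t by (auto simp: field_simps)
            then show ?thesis using k(5) by simp
          qed
          then show ?thesis by simp
        qed
      qed (use \<delta> in auto)
      moreover have "(\<lambda>t. complex_of_real (w c t) * r t) integrable_on {0..T}" for c
        by (intro integrable_continuous_real continuous_intros wc r)
      ultimately have "integral {0..T} (\<lambda>t. complex_of_real (w t1 t) * r t) = integral {0..T} (\<lambda>t. complex_of_real (w t2 t) * r t)"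
        by (simp add: left_diff_distrib integral_diff)
      moreover have "norm (integral {0..T} (\<lambda>t. of_real (w t1 t) * r t) - r t1) \<le> e / 2"
        using \<delta> t d by (intro mol) auto
      moreover have "norm (integral {0..T} (\<lambda>t. of_real (w t2 t) * r t) - r t2) \<le> e / 2"
        using \<delta> t d by (intro mol) auto
      ultimately show ?thesis
        using norm_triangle_le_diff[of "integral {0..T} (\<lambda>t. of_real (w t2 t) * r t) - r t2"
            "integral {0..T} (\<lambda>t. of_real (w t2 t) * r t) - r t1" e] by (simp add: norm_minus_commute)
    qed
    then have "norm (r t1 - r t2) \<le> 0" by (rule field_le_epsilon)
    then show ?thesis by simp
  qed
  have c: "continuous_on (closure {0<..<T}) r" using r T by simp
  have mid: "r t = r (T / 2)" if "t \<in> {0<..<T}" for t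
  proof -
    consider "t < T / 2" | "t = T / 2" | "T / 2 < t" by linarith
    then show ?thesis
    proof cases
      case 1 then show ?thesis using that T by (intro const) auto
    next
      case 2 then show ?thesis by (rule arg_cong)
    next
      case 3 then show ?thesis using that T by (intro const[symmetric]) auto
    qed
  qed
  have "r t = r (T / 2)" if "t \<in> {0..T}" for t
    by (rule continuous_constant_on_closure[OF c mid]) (use that T in auto)
  from this[of 0] this[of T] show ?thesis using T by simp
qed

text \<open>Green's identity in time: the pairing of \<open>u'\<close> with the test wave minus the
  pairing of \<open>u\<close> with the time derivative of the test wave is conserved. At time
  \<open>T\<close> it is the left-hand side; at time \<open>0\<close> the initial data leave only
  the pairing with \<open>F\<close>.\<close>

lemma wave_duality:
  fixes x0 :: "real^3"
  assumes T: "T > 0" and F: "F \<in> L2" and u: "wave_cauchy_solution T F u u'"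
    and f: "smooth f" "\<And>x. (f has_vector_derivative g x) (at x)" "\<And>x. (g has_vector_derivative g' x) (at x)"
    and K: "\<And>s. \<bar>s\<bar> > K \<Longrightarrow> f s = 0" "K \<ge> 0"
  shows "(LINT x|lebesgue. u' T x * Theta 0 g 0 (x - x0)) + (LINT x|lebesgue. u T x * Theta 0 g' 0 (x - x0))
     = (LINT x|lebesgue. F x * Theta 0 g T (x - x0))"
proof -
  have sm: "smooth g" "smooth g'" using smooth_vector_derivative f by blast+
  obtain g2 where g2: "\<And>x. (g' has_vector_derivative g2 x) (at x)"
    using smooth_deriv[OF sm(2)] by metis
  have gs: "\<And>s. \<bar>s\<bar> > K \<Longrightarrow> g s = 0" using support_derivative[OF f(2) K(1)] .
  define \<Psi> where "\<Psi> = (\<lambda>t x. Theta 0 g (T - t) (x - x0))"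
  define \<Psi>' where "\<Psi>' = (\<lambda>t x. - Theta 0 g' (T - t) (x - x0))"
  have C1: "L2_C1_on {0..T} \<Psi> \<Psi>'" unfolding \<Psi>_def \<Psi>'_def by (rule Theta_L2_C1[OF f K])
  have uC1: "L2_C1_on {0..T} u u'" using u unfolding wave_cauchy_solution_def by blast
  define m where "m = (\<lambda>t. LINT x|lebesgue. u t x * \<Psi> t x)"
  define p where "p = (\<lambda>t. LINT x|lebesgue. u t x * \<Psi>' t x)"
  define q where "q = (\<lambda>t. LINT x|lebesgue. u' t x * \<Psi> t x)"
  have m': "(m has_vector_derivative (q t + p t)) (at t within {0..T})" if "t \<in> {0..T}" for t
    using L2_pairing_has_vector_derivative[OF uC1 C1 that] unfolding m_def q_def p_def .
  have cont: "continuous_on {0..T} p" "continuous_on {0..T} q" "continuous_on {0..T} m"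
    using C1 uC1 unfolding p_def q_def m_def L2_C1_on_def by (auto intro: L2_pairing_continuous)
  have L: "u t \<in> L2" "\<Psi> t \<in> L2" "\<Psi>' t \<in> L2" if "t \<in> {0..T}" for t
    using C1 uC1 that unfolding L2_C1_on_def L2_continuous_on_def by auto
  have "q 0 - p 0 = q T - p T"
  proof (rule du_bois_reymond[OF T, of "\<lambda>t. q t - p t"])
    show "continuous_on {0..T} (\<lambda>t. q t - p t)" by (intro continuous_intros cont)
  next
    fix \<theta> \<theta>' \<theta>'' :: "real \<Rightarrow> complex" and a b
    assume th: "smooth \<theta>" "\<And>t. (\<theta> has_vector_derivative \<theta>' t) (at t)" "\<And>t. (\<theta>' has_vector_derivative \<theta>'' t) (at t)"
      and ab: "0 < a" "b < T" "\<And>t. t \<notin> {a..b} \<Longrightarrow> \<theta> t = 0"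
    have th': "smooth \<theta>'" "smooth \<theta>''" using smooth_vector_derivative th by blast+
    let ?\<psi> = "\<lambda>p::real \<times> (real^3). \<theta> (fst p) * Theta 0 g (T - fst p) (snd p - x0)"
    have test: "test_function ({0<..<T} \<times> UNIV) ?\<psi>"
    proof (rule theta_alg_test_function[OF theta_alg_wave[OF sm(1) th(1)]])
      show "compact ({a..b} \<times> cball x0 (K + T))" by (intro compact_Times) auto
      show "{a..b} \<times> cball x0 (K + T) \<subseteq> {0<..<T} \<times> UNIV" using ab by auto
      fix z :: "real \<times> (real^3)" assume z: "z \<notin> {a..b} \<times> cball x0 (K + T)"
      show "?\<psi> z = 0"
      proof (cases "fst z \<in> {a..b}")
        case True
        then have "snd z \<notin> cball x0 (K + T)" using z by (cases z) auto
        then have "norm (snd z - x0) > K + \<bar>T - fst z\<bar>" using True ab by (auto simp: dist_norm norm_minus_commute)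
        then show ?thesis by (simp add: Theta_0_support[OF f(2) K])
      qed (use ab in simp)
    qed
    have w: "(LINT x|lebesgue. u t x * wave_op ?\<psi> t x) = \<theta>'' t * m t + 2 * \<theta>' t * p t" if t: "t \<in> {0..T}" for t
    proof -
      have "has_bochner_integral lebesgue (\<lambda>x. \<theta>'' t * (u t x * \<Psi> t x) + 2 * \<theta>' t * (u t x * \<Psi>' t x))
         (\<theta>'' t * m t + 2 * \<theta>' t * p t)"
        unfolding m_def p_def
        by (intro has_bochner_integral_add has_bochner_integral_mult_right has_bochner_integral_integrable
            L2_mult_integrable L t)
      moreover have "(\<lambda>x. u t x * wave_op ?\<psi> t x) = (\<lambda>x. \<theta>'' t * (u t x * \<Psi> t x) + 2 * \<theta>' t * (u t x * \<Psi>' t x))"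
        by (rule ext) (simp add: wave_op_Theta[OF sm(1) f(3) g2 th(2,3)] \<Psi>_def \<Psi>'_def algebra_simps)
      ultimately show ?thesis by (simp only: has_bochner_integral_integral_eq)
    qed
    have c2: "continuous_on {0..T} (\<lambda>t. \<theta>'' t * m t + 2 * \<theta>' t * p t)"
      by (intro continuous_intros cont smooth_continuous th')
    have "(LINT t:{0..T}|lebesgue. (LINT x|lebesgue. u t x * wave_op ?\<psi> t x)) = 0"
      using u test unfolding wave_cauchy_solution_def by blast
    moreover have "(LINT t:{0..T}|lebesgue. (LINT x|lebesgue. u t x * wave_op ?\<psi> t x)) =
       (LINT t:{0..T}|lebesgue. \<theta>'' t * m t + 2 * \<theta>' t * p t)"
      by (rule set_lebesgue_integral_cong) (use w in auto)
    moreover have "\<dots> = integral {0..T} (\<lambda>t. \<theta>'' t * m t + 2 * \<theta>' t * p t)"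
      by (rule set_lebesgue_integral_eq_integral(2)[OF absolutely_integrable_continuous_real[OF c2]])
    ultimately have 1: "((\<lambda>t. \<theta>'' t * m t + 2 * \<theta>' t * p t) has_integral 0) {0..T}"
      using integrable_integral[OF integrable_continuous_real[OF c2]] by simp
    have e: "\<theta>' 0 = 0" "\<theta>' T = 0"
    proof -
      have "\<theta>' t = 0" if "t \<notin> {a..b}" for t
      proof -
        have "((\<lambda>_. 0) has_vector_derivative \<theta>' t) (at t)"
          by (rule has_vector_derivative_transform_within_open[OF th(2), of "- {a..b}"]) (use ab(3) that in auto)
        then show ?thesis by (rule vector_derivative_unique_at[OF _ has_vector_derivative_const])
      qed
      then show "\<theta>' 0 = 0" "\<theta>' T = 0" using ab by auto
    qed
    \<comment> \<open>Subtracting the derivative of \<open>\<theta>' * m\<close>, whose integral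
      vanishes, removes the term with \<open>\<theta>''\<close> and leaves
      \<open>- (\<theta>' * (q - p))\<close>, as the du Bois-Reymond argument requires.\<close>
    have "((\<lambda>t. \<theta>' t * (q t + p t) + \<theta>'' t * m t) has_integral (\<theta>' T * m T - \<theta>' 0 * m 0)) {0..T}"
      using T by (intro fundamental_theorem_of_calculus has_vector_derivative_mult m'
          has_vector_derivative_at_within[OF th(3)]) auto
    from has_integral_diff[OF 1 this]
    have "((\<lambda>t. \<theta>'' t * m t + 2 * \<theta>' t * p t - (\<theta>' t * (q t + p t) + \<theta>'' t * m t)) has_integral 0) {0..T}"
      by (simp add: e)
    moreover have "(\<lambda>t. \<theta>'' t * m t + 2 * \<theta>' t * p t - (\<theta>' t * (q t + p t) + \<theta>'' t * m t)) = (\<lambda>t. - (\<theta>' t * (q t - p t)))"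
      by (rule ext) (simp add: algebra_simps)
    ultimately have "((\<lambda>t. - (\<theta>' t * (q t - p t))) has_integral 0) {0..T}" by simp
    from has_integral_neg[OF this] show "integral {0..T} (\<lambda>t. \<theta>' t * (q t - p t)) = 0"
      by (simp add: integral_unique)
  qed
  moreover have "p 0 = 0"
  proof -
    have "AE x in lebesgue. u 0 x = 0" using u unfolding wave_cauchy_solution_def by blast
    then have "AE x in lebesgue. u 0 x * \<Psi>' 0 x = 0" by eventually_elim simp
    then show ?thesis unfolding p_def by (rule integral_eq_zero_AE)
  qed
  moreover have "q 0 = (LINT x|lebesgue. F x * \<Psi> 0 x)"
    unfolding q_def
  proof (rule integral_cong_AE)
    have "AE x in lebesgue. u' 0 x = F x" using u unfolding wave_cauchy_solution_def by blast
    then show "AE x in lebesgue. u' 0 x * \<Psi> 0 x = F x * \<Psi> 0 x" by eventually_elim simp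
    have "u' 0 \<in> L2" using uC1 T unfolding L2_C1_on_def L2_continuous_on_def by auto
    then show "(\<lambda>x. u' 0 x * \<Psi> 0 x) \<in> borel_measurable lebesgue" "(\<lambda>x. F x * \<Psi> 0 x) \<in> borel_measurable lebesgue"
      using L(2)[of 0] T F by (auto intro!: borel_measurable_times[OF L2_measurable L2_measurable])
  qed
  ultimately show ?thesis unfolding q_def p_def \<Psi>_def \<Psi>'_def by simp
qed

section \<open>Radial integration by parts\<close>

lemma lborel_integral_affine:
  fixes f :: "'a::euclidean_space \<Rightarrow> complex"
  assumes "c \<noteq> 0" "f \<in> borel_measurable borel"
  shows "(LINT x|lborel. \<bar>c\<bar> ^ DIM('a) *\<^sub>R f (t + c *\<^sub>R x)) = (LINT x|lborel. f x)"
  using assms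
  by (subst (2) lborel_affine[OF assms(1), of t], subst integral_density)
    (auto simp: integral_distr)

lemma lebesgue_integral_affine:
  fixes f :: "'a::euclidean_space \<Rightarrow> complex"
  assumes "c > 0" "f \<in> borel_measurable borel"
  shows "(LINT x|lebesgue. f (t + c *\<^sub>R x)) = (LINT x|lebesgue. f x) / of_real (c ^ DIM('a))"
proof -
  have m: "(\<lambda>x. f (t + c *\<^sub>R x)) \<in> borel_measurable lborel" "f \<in> borel_measurable lborel" using assms by measurable
  show ?thesis
    using lborel_integral_affine[of c f t] assms
    unfolding integral_completion[OF m(1)] integral_completion[OF m(2)]
    by (simp add: scaleR_conv_of_real field_simps)
qed

lemma integral_norm_le:
  fixes f :: "'a::euclidean_space \<Rightarrow> complex"
  assumes "f \<in> borel_measurable lebesgue" "\<And>x. norm (f x) \<le> M" "\<And>x. x \<notin> cball x0 b \<Longrightarrow> f x = 0"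
  shows "integrable lebesgue f" "norm (LINT x|lebesgue. f x) \<le> M * measure lebesgue (cball x0 b)"
proof -
  have i: "integrable lebesgue (\<lambda>x. M * indicator (cball x0 b) x :: real)"
    using lmeasurable_cball[of x0 b] by (intro integrable_mult_right) (auto simp: fmeasurable_def)
  have le: "norm (f x) \<le> M * indicator (cball x0 b) x" for x
    using assms(2,3)[of x] by (auto simp: indicator_def)
  show f: "integrable lebesgue f"
    by (rule Bochner_Integration.integrable_bound[OF i assms(1)]) (use le in \<open>auto intro: order_trans[OF _ abs_ge_self]\<close>)
  show "norm (LINT x|lebesgue. f x) \<le> M * measure lebesgue (cball x0 b)"
    using Bochner_Integration.integral_norm_bound_integral[OF f i le] by simp
qed

lemma has_vector_derivative_quotient:
  fixes f :: "real \<Rightarrow> complex"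
  assumes "(f has_vector_derivative D) (at a)"
  shows "((\<lambda>t. (f t - f a) / of_real (t - a)) \<longlongrightarrow> D) (at a)"
proof -
  have "((\<lambda>y. norm ((1 / norm (y - a)) *\<^sub>R (f y - (f a + (y - a) *\<^sub>R D)))) \<longlongrightarrow> 0) (at a)"
    using assms unfolding has_vector_derivative_def has_derivative_within by (intro tendsto_norm_zero) auto
  then have "((\<lambda>y. norm ((f y - f a) / of_real (y - a) - D)) \<longlongrightarrow> 0) (at a)"
  proof (rule Lim_transform_eventually)
    show "\<forall>\<^sub>F y in at a. norm ((1 / norm (y - a)) *\<^sub>R (f y - (f a + (y - a) *\<^sub>R D))) = norm ((f y - f a) / of_real (y - a) - D)"
      unfolding eventually_at_filter
    proof (intro always_eventually allI impI)
      fix y assume "y \<noteq> a"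
      then have "(f y - f a) / of_real (y - a) - D = (f y - (f a + (y - a) *\<^sub>R D)) / of_real (y - a)"
        by (simp add: field_simps scaleR_conv_of_real)
      then show "norm ((1 / norm (y - a)) *\<^sub>R (f y - (f a + (y - a) *\<^sub>R D))) = norm ((f y - f a) / of_real (y - a) - D)"
        by (simp only: norm_divide norm_of_real norm_scaleR) simp
    qed
  qed
  then have "((\<lambda>y. (f y - f a) / of_real (y - a) - D) \<longlongrightarrow> 0) (at a)" by (rule tendsto_norm_zero_cancel)
  then show ?thesis by (rule LIM_zero_cancel)
qed

text \<open>The divergence theorem for the field \<open>x H(x)\<close>: the integral of \<open>t\<^sup>d H(t x)\<close> does not
  depend on \<open>t\<close>. Only radial differentiability of \<open>H\<close> is required.\<close>

lemma radial_integration_by_parts: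
  fixes H H' :: "'a::euclidean_space \<Rightarrow> complex"
  assumes H: "continuous_on UNIV H" "\<And>x. norm x > b \<Longrightarrow> H x = 0" "b > 0"
    and d: "\<And>x. ((\<lambda>t. H (t *\<^sub>R x)) has_vector_derivative H' x) (at 1)" "\<And>x. norm (H' x) \<le> C"
  shows "integrable lebesgue H'" "integrable lebesgue H"
    "(LINT x|lebesgue. H' x + of_nat DIM('a) * H x) = 0"
proof -
  define N where "N = DIM('a)"
  have "bounded (H ` cball 0 b)"
    by (intro compact_imp_bounded compact_continuous_image continuous_on_subset[OF H(1)]) auto
  then obtain M0 where M0: "M0 > 0" "\<And>x. x \<in> cball 0 b \<Longrightarrow> norm (H x) \<le> M0"
    unfolding bounded_pos by auto
  have M: "norm (H x) \<le> M0" for x using M0 H(2)[of x] by (cases "norm x \<le> b") auto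
  have C: "C \<ge> 0" using d(2)[of 0] norm_ge_zero order_trans by blast
  have Hb: "H \<in> borel_measurable borel" using H(1) by (rule borel_measurable_continuous_onI)
  have Hm: "H \<in> borel_measurable lebesgue" by (rule continuous_lebesgue_measurable[OF H(1)])
  have dt: "((\<lambda>t. H (t *\<^sub>R x)) has_vector_derivative (1 / t) *\<^sub>R H' (t *\<^sub>R x)) (at t)" if "t > 0" for t x
  proof -
    have "((\<lambda>s. s / t) has_vector_derivative 1 / t) (at t)"
      unfolding has_real_derivative_iff_has_vector_derivative[symmetric]
      using that by (auto intro!: derivative_eq_intros)
    moreover have "((\<lambda>s. H (s *\<^sub>R (t *\<^sub>R x))) has_vector_derivative H' (t *\<^sub>R x)) (at (t / t))"
      using d(1)[of "t *\<^sub>R x"] that by simp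
    ultimately have "((\<lambda>s. H (s *\<^sub>R (t *\<^sub>R x))) \<circ> (\<lambda>s. s / t) has_vector_derivative (1 / t) *\<^sub>R H' (t *\<^sub>R x)) (at t)"
      by (rule vector_diff_chain_at)
    then show ?thesis using that by (simp add: o_def)
  qed
  have dg: "((\<lambda>t. of_real (t ^ N) * H (t *\<^sub>R x)) has_vector_derivative
      (of_real (t ^ N) * ((1 / t) *\<^sub>R H' (t *\<^sub>R x)) + of_real (real N * t ^ (N - 1)) * H (t *\<^sub>R x))) (at t)" if "t > 0" for t x
    by (intro has_vector_derivative_mult has_vector_derivative_of_real dt that)
       (auto intro!: derivative_eq_intros)
  define K where "K = 2 ^ N * C + real N * 2 ^ N * M0"
  \<comment> \<open>Dilations slightly larger than \<open>1\<close>: with \<open>l n > 1\<close> the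
    dilated function still vanishes outside the ball of radius \<open>b\<close>, and
    \<open>l n \<le> 2\<close> allows one mean value bound for all \<open>n\<close>.\<close>
  define l where "l = (\<lambda>n. 1 + 1 / real (Suc n))"
  have l: "1 < l n" "l n \<le> 2" "l n - 1 = 1 / real (Suc n)" for n by (auto simp: l_def field_simps)
  \<comment> \<open>Difference quotients of \<open>t ^ N * H (t *\<^sub>R x)\<close> at
    \<open>t = 1\<close>. A change of variables makes each of their integrals zero, and dominated
    convergence passes this on to the derivative.\<close>
  define f where "f = (\<lambda>n x. (of_real (l n ^ N) * H (l n *\<^sub>R x) - H x) * of_real (real (Suc n)))"
  have fb: "norm (f n x) \<le> K" for n x
  proof -
    have "norm (of_real (l n ^ N) * H (l n *\<^sub>R x) - of_real (1 ^ N) * H (1 *\<^sub>R x)) \<le> K * norm (l n - 1)"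
    proof (rule differentiable_bound[of "{1..2}" "\<lambda>t. of_real (t ^ N) * H (t *\<^sub>R x)"
          "\<lambda>t h. h *\<^sub>R (of_real (t ^ N) * ((1 / t) *\<^sub>R H' (t *\<^sub>R x)) + of_real (real N * t ^ (N - 1)) * H (t *\<^sub>R x))"])
      fix t :: real assume t: "t \<in> {1..2}"
      show "((\<lambda>t. of_real (t ^ N) * H (t *\<^sub>R x)) has_derivative
         (\<lambda>h. h *\<^sub>R (of_real (t ^ N) * ((1 / t) *\<^sub>R H' (t *\<^sub>R x)) + of_real (real N * t ^ (N - 1)) * H (t *\<^sub>R x)))) (at t within {1..2})"
        using dg[of t x] t unfolding has_vector_derivative_def by (auto intro: has_derivative_at_withinI)
      have "norm (of_real (t ^ N) * ((1 / t) *\<^sub>R H' (t *\<^sub>R x)) + of_real (real N * t ^ (N - 1)) * H (t *\<^sub>R x)) \<le> K"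
        unfolding K_def
      proof (rule norm_triangle_mono)
        have "t ^ N \<le> 2 ^ N" "t ^ (N - 1) \<le> 2 ^ N"
          using t power_mono[of t 2 N] power_mono[of t 2 "N - 1"] power_increasing[of "N - 1" N "2::real"] by (auto intro: order_trans)
        then have p: "\<bar>t ^ N\<bar> \<le> 2 ^ N" "\<bar>t ^ (N - 1)\<bar> \<le> 2 ^ N" using t by auto
        have "\<bar>1 / t\<bar> * norm (H' (t *\<^sub>R x)) \<le> 1 * C" using t d(2) C by (intro mult_mono) auto
        then show "norm (complex_of_real (t ^ N) * ((1 / t) *\<^sub>R H' (t *\<^sub>R x))) \<le> 2 ^ N * C"
          unfolding norm_mult norm_scaleR norm_of_real using p(1) C by (intro mult_mono) auto
        have "\<bar>real N * t ^ (N - 1)\<bar> \<le> real N * 2 ^ N"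
          unfolding abs_mult using p(2) by (intro mult_mono) auto
        then show "norm (complex_of_real (real N * t ^ (N - 1)) * H (t *\<^sub>R x)) \<le> real N * 2 ^ N * M0"
          unfolding norm_mult norm_of_real using M M0 by (intro mult_mono) auto
      qed
      from mult_left_mono[OF this, of "\<bar>h\<bar>" for h]
      show "onorm (\<lambda>h. h *\<^sub>R (of_real (t ^ N) * ((1 / t) *\<^sub>R H' (t *\<^sub>R x)) + of_real (real N * t ^ (N - 1)) * H (t *\<^sub>R x))) \<le> K"
        by (intro onorm_le) (simp only: norm_scaleR mult.commute[of K] real_norm_def)
    qed (use l[of n] in auto)
    then have "norm (of_real (l n ^ N) * H (l n *\<^sub>R x) - H x) * real (Suc n) \<le> K * norm (l n - 1) * real (Suc n)"
      by (intro mult_right_mono) auto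
    also have "\<dots> = K" unfolding l(3) by simp
    finally show ?thesis unfolding f_def norm_mult norm_of_real by simp
  qed
  have fm: "f n \<in> borel_measurable lebesgue" for n
    unfolding f_def
    by (intro continuous_lebesgue_measurable continuous_intros continuous_on_compose2[OF H(1)]) auto
  have f0: "f n x = 0" if "x \<notin> cball 0 b" for n x
  proof -
    have "norm x > b" using that by simp
    moreover have "norm (l n *\<^sub>R x) > b"
      using l[of n] that H(3) mult_strict_mono[of 1 "l n" b "norm x"] by simp
    ultimately show ?thesis using H(2) unfolding f_def by simp
  qed
  have lim: "(\<lambda>n. f n x) \<longlonglongrightarrow> H' x + of_nat N * H x" for x
  proof -
    have "((\<lambda>t. (of_real (t ^ N) * H (t *\<^sub>R x) - of_real (1 ^ N) * H (1 *\<^sub>R x)) / of_real (t - 1)) \<longlongrightarrow> H' x + of_nat N * H x) (at 1)"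
      using has_vector_derivative_quotient[OF dg[of 1 x]] by simp
    moreover have "filterlim l (at 1) sequentially"
      unfolding filterlim_at
    proof
      have "(\<lambda>n. 1 + inverse (real (Suc n))) \<longlonglongrightarrow> 1 + 0"
        by (intro tendsto_add tendsto_const LIMSEQ_inverse_real_of_nat)
      then show "l \<longlonglongrightarrow> 1" by (simp add: l_def inverse_eq_divide)
      show "\<forall>\<^sub>F n in sequentially. l n \<in> UNIV \<and> l n \<noteq> 1" using l(1) by (auto intro!: always_eventually simp: less_imp_neq[symmetric])
    qed
    ultimately have "(\<lambda>n. (of_real (l n ^ N) * H (l n *\<^sub>R x) - of_real (1 ^ N) * H (1 *\<^sub>R x)) / of_real (l n - 1)) \<longlonglongrightarrow> H' x + of_nat N * H x"
      by (rule filterlim_compose)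
    then show ?thesis unfolding l(3) f_def by simp
  qed
  \<comment> \<open>Measurability of \<open>H'\<close> is inherited from the continuous functions
    \<open>f n\<close> through this pointwise limit.\<close>
  have lm: "(\<lambda>x. H' x + of_nat N * H x) \<in> borel_measurable lebesgue"
    by (rule borel_measurable_LIMSEQ_metric[OF fm lim])
  have "(\<lambda>x. (H' x + of_nat N * H x) - of_nat N * H x) \<in> borel_measurable lebesgue"
    by (intro borel_measurable_diff lm borel_measurable_times borel_measurable_const Hm)
  then have H'm: "H' \<in> borel_measurable lebesgue" by simp
  have H'0: "H' x = 0" if "x \<notin> cball 0 b" for x
  proof -
    have "(\<lambda>n. f n x) \<longlonglongrightarrow> 0" using f0[OF that] by simp
    then have "H' x + of_nat N * H x = 0" using lim LIMSEQ_unique by blast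
    then show ?thesis using H(2)[of x] that by simp
  qed
  show "integrable lebesgue H'" by (rule integral_norm_le(1)[OF H'm d(2) H'0])
  show "integrable lebesgue H" by (rule integral_norm_le(1)[OF Hm M, of 0 b]) (use H in auto)
  have "(\<lambda>n. LINT x|lebesgue. f n x) \<longlonglongrightarrow> (LINT x|lebesgue. H' x + of_nat N * H x)"
  proof (rule integral_dominated_convergence[where w = "\<lambda>x. K * indicator (cball 0 b) x"])
    show "integrable lebesgue (\<lambda>x. K * indicator (cball 0 b) x :: real)"
      using lmeasurable_cball[of 0 b] by (intro integrable_mult_right) (auto simp: fmeasurable_def)
    show "AE x in lebesgue. norm (f n x) \<le> K * indicator (cball 0 b) x" for n
      using fb f0 by (auto simp: indicator_def)
  qed (use lm fm lim in auto)
  moreover have "(LINT x|lebesgue. f n x) = 0" for n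
  proof -
    have ln: "l n > 0" using l(1)[of n] by simp
    have i1: "integrable lebesgue (\<lambda>x. of_real (l n ^ N) * H (l n *\<^sub>R x))"
    proof (rule integral_norm_le(1)[of _ "l n ^ N * M0" 0 b])
      show "(\<lambda>x. of_real (l n ^ N) * H (l n *\<^sub>R x)) \<in> borel_measurable lebesgue"
        by (intro continuous_lebesgue_measurable continuous_intros continuous_on_compose2[OF H(1)]) auto
      show "norm (of_real (l n ^ N) * H (l n *\<^sub>R x)) \<le> l n ^ N * M0" for x
        unfolding norm_mult norm_of_real using ln M by (intro mult_mono) auto
      show "of_real (l n ^ N) * H (l n *\<^sub>R x) = 0" if "x \<notin> cball 0 b" for x
        using l[of n] that H(2,3) mult_strict_mono[of 1 "l n" b "norm x"] by simp
    qed
    have "(LINT x|lebesgue. f n x) = (of_real (l n ^ N) * (LINT x|lebesgue. H (0 + l n *\<^sub>R x)) - (LINT x|lebesgue. H x)) * of_real (real (Suc n))"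
      unfolding f_def using i1 \<open>integrable lebesgue H\<close>
      by (simp add: Bochner_Integration.integral_diff)
    also have "\<dots> = 0"
      unfolding lebesgue_integral_affine[OF ln Hb] N_def using ln by simp
    finally show ?thesis .
  qed
  ultimately show "(LINT x|lebesgue. H' x + of_nat DIM('a) * H x) = 0"
    unfolding N_def using LIMSEQ_unique by (simp add: LIMSEQ_const_iff)
qed

lemma continuous_on_cutoff:
  fixes H :: "'a::real_normed_vector \<Rightarrow> complex"
  assumes "R < a" "continuous_on {x. norm x > R} H" "\<And>x. norm x < a \<Longrightarrow> H x = 0"
  shows "continuous_on UNIV H"
proof -
  have "continuous_on {x. norm x < a} H"
    using assms(3) by (subst continuous_on_cong[of _ "{x. norm x < a}" H "\<lambda>_. 0"]) auto
  moreover have "open {x::'a. norm x < a}" "open {x::'a. norm x > R}"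
    by (intro open_Collect_less continuous_intros)+
  ultimately have "continuous_on ({x. norm x < a} \<union> {x. norm x > R}) H"
    using assms(2) by (intro continuous_on_open_Un)
  moreover have "{x. norm x < a} \<union> {x. norm x > R} = (UNIV::'a set)" using assms(1) by auto
  ultimately show ?thesis by simp
qed

text \<open>One step of the oscillatory estimate. Here \<open>Z\<close> behaves like \<open>exp (2 i k |x|)\<close> up to the
  error \<open>g\<close>, and all radial derivatives are taken in the form \<open>x \<bullet> \<nabla>\<close>.\<close>

lemma oscillatory_step:
  fixes Z B B' g :: "real^3 \<Rightarrow> complex"
  assumes R: "0 < R" "R < a" "0 < b"
    and Z: "continuous_on UNIV Z"
      "\<And>x. norm x > R \<Longrightarrow> ((\<lambda>t. Z (t *\<^sub>R x)) has_vector_derivative (2 * \<i> * of_real (k * norm x) * Z x + g x)) (at 1)"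
    and B: "continuous_on {x. norm x > R} B" "continuous_on {x. norm x > R} B'"
      "\<And>x. norm x > R \<Longrightarrow> ((\<lambda>t. B (t *\<^sub>R x)) has_vector_derivative B' x) (at 1)"
      "\<And>x. norm x < a \<or> norm x > b \<Longrightarrow> B x = 0 \<and> B' x = 0"
    and K: "\<And>x. norm x > R \<Longrightarrow> norm (g x) * norm (B x) / norm x \<le> K"
  shows "integrable lebesgue (\<lambda>x. Z x * B x)" "integrable lebesgue (\<lambda>x. Z x * ((B' x + 2 * B x) / of_real (norm x)))"
    "norm (2 * \<i> * of_real k * (LINT x|lebesgue. Z x * B x) + (LINT x|lebesgue. Z x * ((B' x + 2 * B x) / of_real (norm x))))
      \<le> K * measure lebesgue (cball 0 b :: (real^3) set)"
proof -
  let ?r = "\<lambda>x::real^3. complex_of_real (norm x)"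
  have K0: "K \<ge> 0"
  proof -
    obtain x :: "real^3" where "norm x = R + 1" using R vector_choose_size[of "R + 1"] by auto
    then show ?thesis using K[of x] by (smt (verit) divide_nonneg_nonneg mult_nonneg_nonneg norm_ge_zero)
  qed
  have cont: "continuous_on UNIV (\<lambda>x. Z x * f x)" and int: "integrable lebesgue (\<lambda>x. Z x * f x)"
    if f: "continuous_on {x. norm x > R} f" "\<And>x. norm x < a \<or> norm x > b \<Longrightarrow> f x = 0" for f
  proof -
    show c: "continuous_on UNIV (\<lambda>x. Z x * f x)"
      by (rule continuous_on_cutoff[OF R(2)])
        (use f in \<open>auto intro!: continuous_intros continuous_on_subset[OF Z(1)]\<close>)
    have "bounded ((\<lambda>x. Z x * f x) ` cball 0 b)"
      by (intro compact_imp_bounded compact_continuous_image continuous_on_subset[OF c]) auto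
    then obtain M where M: "M > 0" "\<And>x. x \<in> cball 0 b \<Longrightarrow> norm (Z x * f x) \<le> M"
      unfolding bounded_pos by auto
    show "integrable lebesgue (\<lambda>x. Z x * f x)"
    proof (rule integral_norm_le(1)[of _ M 0 b])
      show "norm (Z x * f x) \<le> M" for x using M f(2)[of x] by (cases "x \<in> cball 0 b") auto
      show "Z x * f x = 0" if "x \<notin> cball 0 b" for x using f(2)[of x] that by simp
    qed (rule continuous_lebesgue_measurable[OF c])
  qed
  have rc: "continuous_on {x. norm x > R} ?r" "\<And>x. norm x > R \<Longrightarrow> ?r x \<noteq> 0" using R by (auto intro!: continuous_intros)
  show i1: "integrable lebesgue (\<lambda>x. Z x * B x)" by (rule int) (use B in auto)
  show i2: "integrable lebesgue (\<lambda>x. Z x * ((B' x + 2 * B x) / ?r x))"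
    by (rule int) (use B rc in \<open>auto intro!: continuous_intros\<close>)
  \<comment> \<open>Dividing by \<open>norm x\<close> cancels the factor \<open>norm x\<close> in
    the Euler derivative of \<open>Z\<close>. The derivative of \<open>1 / norm x\<close>
    contributes \<open>- B\<close> and the divergence in three dimensions \<open>3 * B\<close>,
    hence the \<open>2 * B\<close> in the conclusion.\<close>
  define H where "H = (\<lambda>x. Z x * (B x / ?r x))"
  define H' where "H' = (\<lambda>x. if norm x > R then 2 * \<i> * of_real k * (Z x * B x) + g x * B x / ?r x + Z x * ((B' x - B x) / ?r x) else 0)"
  have H: "continuous_on UNIV H" unfolding H_def by (rule cont) (use B rc in \<open>auto intro!: continuous_intros\<close>)
  have H0: "H x = 0" if "norm x < a \<or> norm x > b" for x using B(4)[OF that] by (simp add: H_def)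
  have d: "((\<lambda>t. H (t *\<^sub>R x)) has_vector_derivative H' x) (at 1)" for x
  proof (cases "norm x > R")
    case True
    then have x: "norm x \<noteq> 0" using R by auto
    have "((\<lambda>t. inverse (t * norm x)) has_real_derivative - 1 / norm x) (at 1)"
      using x by (auto intro!: derivative_eq_intros simp: field_simps power2_eq_square)
    then have "((\<lambda>t. complex_of_real (inverse (t * norm x))) has_vector_derivative complex_of_real (- 1 / norm x)) (at 1)"
      by (rule has_vector_derivative_of_real)
    from has_vector_derivative_mult[OF Z(2)[OF True] has_vector_derivative_mult[OF B(3)[OF True] this]]
    have "((\<lambda>t. Z (t *\<^sub>R x) * (B (t *\<^sub>R x) * complex_of_real (inverse (t * norm x)))) has_vector_derivative H' x) (at 1)"
      by (rule has_vector_derivative_eq_rhs) (use True x in \<open>simp add: H'_def field_simps\<close>)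
    then show ?thesis
      by (rule has_vector_derivative_transform_within_open[of _ _ _ "{0<..}"])
        (auto simp: H_def divide_inverse)
  next
    case False
    \<comment> \<open>Here \<open>norm x \<le> R < a\<close>, so \<open>H\<close> vanishes along the
      ray for all parameters near \<open>1\<close>.\<close>
    have "((\<lambda>t. 0) has_vector_derivative H' x) (at 1)" using False by (simp add: H'_def)
    then show ?thesis
    proof (rule has_vector_derivative_transform_within_open)
      show "open {t. \<bar>t\<bar> * norm x < a}" by (intro open_Collect_less continuous_intros)
    qed (use False R H0 in auto)
  qed
  have z1: "continuous_on UNIV (\<lambda>x. Z x * (2 * \<i> * of_real k * B x + (B' x - B x) / ?r x))"
    by (rule cont) (use B rc in \<open>auto intro!: continuous_intros\<close>)
  have "bounded ((\<lambda>x. Z x * (2 * \<i> * of_real k * B x + (B' x - B x) / ?r x)) ` cball 0 b)"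
    by (intro compact_imp_bounded compact_continuous_image continuous_on_subset[OF z1]) auto
  then obtain M where M: "M > 0" "\<And>x. x \<in> cball 0 b \<Longrightarrow> norm (Z x * (2 * \<i> * of_real k * B x + (B' x - B x) / ?r x)) \<le> M"
    unfolding bounded_pos by auto
  have gB: "norm (g x * B x / ?r x) \<le> K" if "norm x > R" for x
    using K[OF that] by (simp add: norm_divide norm_mult)
  have H'b: "norm (H' x) \<le> M + K" for x
  proof (cases "norm x > R \<and> norm x \<le> b")
    case True
    then have "H' x = Z x * (2 * \<i> * of_real k * B x + (B' x - B x) / ?r x) + g x * B x / ?r x"
      by (simp add: H'_def algebra_simps)
    then show ?thesis using M(2)[of x] gB[of x] True by (auto intro: norm_triangle_mono)
  next
    case False
    then have "H' x = 0" using B(4)[of x] by (auto simp: H'_def)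
    then show ?thesis using M(1) K0 by simp
  qed
  note ibp = radial_integration_by_parts[OF H _ R(3) d H'b]
  have hb: "\<And>x. b < norm x \<Longrightarrow> H x = 0" using H0 by auto
  have iH: "integrable lebesgue H'" "integrable lebesgue H" "(LINT x|lebesgue. H' x + of_nat 3 * H x) = 0"
    using ibp[OF hb] by simp_all
  let ?G = "\<lambda>x. if norm x > R then g x * B x / ?r x else 0"
  have eq: "H' x + of_nat 3 * H x - (2 * \<i> * of_real k * (Z x * B x) + Z x * ((B' x + 2 * B x) / ?r x)) = ?G x" for x
  proof (cases "norm x > R")
    case True
    then show ?thesis using rc(2)[OF True] by (simp add: H'_def H_def field_simps)
  next
    case False
    then show ?thesis using B(4)[of x] R by (simp add: H'_def H_def)
  qed
  have hb1: "has_bochner_integral lebesgue (\<lambda>x. H' x + of_nat 3 * H x - (2 * \<i> * of_real k * (Z x * B x) + Z x * ((B' x + 2 * B x) / ?r x)))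
     ((LINT x|lebesgue. H' x + of_nat 3 * H x) - (2 * \<i> * of_real k * (LINT x|lebesgue. Z x * B x) + (LINT x|lebesgue. Z x * ((B' x + 2 * B x) / ?r x))))"
    by (intro has_bochner_integral_diff has_bochner_integral_add has_bochner_integral_mult_right has_bochner_integral_integrable
        Bochner_Integration.integrable_add integrable_mult_right iH(1,2) i1 i2)
  then have hb2: "has_bochner_integral lebesgue ?G (- (2 * \<i> * of_real k * (LINT x|lebesgue. Z x * B x) + (LINT x|lebesgue. Z x * ((B' x + 2 * B x) / ?r x))))"
    unfolding eq iH(3) by simp
  have "norm (LINT x|lebesgue. ?G x) \<le> K * measure lebesgue (cball 0 b :: (real^3) set)"
  proof (rule integral_norm_le(2))
    show "?G \<in> borel_measurable lebesgue" using hb2 by (auto simp: has_bochner_integral_iff)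
    show "norm (?G x) \<le> K" for x using gB[of x] K0 by auto
    show "?G x = 0" if "x \<notin> cball 0 b" for x using B(4)[of x] that by auto
  qed
  moreover have "(LINT x|lebesgue. ?G x) = - (2 * \<i> * of_real k * (LINT x|lebesgue. Z x * B x) + (LINT x|lebesgue. Z x * ((B' x + 2 * B x) / ?r x)))"
    using hb2 by (rule has_bochner_integral_integral_eq)
  ultimately show "norm (2 * \<i> * of_real k * (LINT x|lebesgue. Z x * B x) + (LINT x|lebesgue. Z x * ((B' x + 2 * B x) / ?r x)))
      \<le> K * measure lebesgue (cball 0 b :: (real^3) set)" by (simp only: norm_minus_cancel)
qed

section \<open>The radiation condition\<close>

lemma radiation_uniform:
  assumes "outgoing_radiation k W" "e > 0"
  obtains R where "R > 0" "\<And>r \<omega>. r > R \<Longrightarrow> \<omega> \<in> sphere 0 1 \<Longrightarrow> (\<lambda>s::real. W (s *\<^sub>R \<omega>)) differentiable (at r)"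
    "\<And>r \<omega>. r > R \<Longrightarrow> \<omega> \<in> sphere 0 1 \<Longrightarrow>
       r * norm (vector_derivative (\<lambda>s. W (s *\<^sub>R \<omega>)) (at r) - \<i> * of_real k * W (r *\<^sub>R \<omega>)) \<le> e"
proof -
  have 1: "\<forall>\<^sub>F r in at_top. \<forall>\<omega>\<in>sphere 0 1. (\<lambda>s::real. W (s *\<^sub>R \<omega>)) differentiable (at r)"
    using assms unfolding outgoing_radiation_def by blast
  have 2: "\<forall>\<^sub>F r in at_top. \<forall>\<omega>\<in>sphere 0 1. dist (complex_of_real r *
          (vector_derivative (\<lambda>s. W (s *\<^sub>R \<omega>)) (at r) - \<i> * complex_of_real k * W (r *\<^sub>R \<omega>))) 0 < e"
    using assms unfolding outgoing_radiation_def uniform_limit_iff by blast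
  have "\<forall>\<^sub>F r in at_top. (\<forall>\<omega>\<in>sphere 0 1. (\<lambda>s::real. W (s *\<^sub>R \<omega>)) differentiable (at r)) \<and>
     (\<forall>\<omega>\<in>sphere 0 1. dist (complex_of_real r *
          (vector_derivative (\<lambda>s. W (s *\<^sub>R \<omega>)) (at r) - \<i> * complex_of_real k * W (r *\<^sub>R \<omega>))) 0 < e)"
    using 1 2 by (rule eventually_conj)
  then obtain R where R: "\<And>r. r \<ge> R \<Longrightarrow> (\<forall>\<omega>\<in>sphere 0 1. (\<lambda>s::real. W (s *\<^sub>R \<omega>)) differentiable (at r)) \<and>
     (\<forall>\<omega>\<in>sphere 0 1. dist (complex_of_real r *
          (vector_derivative (\<lambda>s. W (s *\<^sub>R \<omega>)) (at r) - \<i> * complex_of_real k * W (r *\<^sub>R \<omega>))) 0 < e)"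
    unfolding eventually_at_top_linorder by blast
  show ?thesis
  proof (rule that[of "max R 1"])
    fix r \<omega> assume r: "r > max R 1" "\<omega> \<in> sphere (0::real^3) 1"
    show "(\<lambda>s::real. W (s *\<^sub>R \<omega>)) differentiable (at r)" using R[of r] r by auto
    have "dist (complex_of_real r *
          (vector_derivative (\<lambda>s. W (s *\<^sub>R \<omega>)) (at r) - \<i> * complex_of_real k * W (r *\<^sub>R \<omega>))) 0 < e"
      using R[of r] r by auto
    then show "r * norm (vector_derivative (\<lambda>s. W (s *\<^sub>R \<omega>)) (at r) - \<i> * of_real k * W (r *\<^sub>R \<omega>)) \<le> e"
      using r by (simp add: norm_mult)
  qed auto
qed

lemma radial_chain:
  fixes x :: "real^3" and f :: "real \<Rightarrow> complex"
  assumes "(f has_vector_derivative D) (at (norm x))" "x \<noteq> 0"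
  shows "((\<lambda>t. f (norm (t *\<^sub>R x))) has_vector_derivative norm x *\<^sub>R D) (at 1)"
proof -
  have "((\<lambda>t. t * norm x) has_vector_derivative norm x) (at 1)"
    unfolding has_real_derivative_iff_has_vector_derivative[symmetric] by (auto intro!: derivative_eq_intros)
  moreover have "(f has_vector_derivative D) (at (1 * norm x))" using assms by simp
  ultimately have "(f \<circ> (\<lambda>t. t * norm x) has_vector_derivative norm x *\<^sub>R D) (at 1)"
    by (rule vector_diff_chain_at)
  then show ?thesis
    by (rule has_vector_derivative_transform_within_open[of _ _ _ "{0<..}"]) (auto simp: o_def)
qed

lemma exp_has_vector_derivative:
  assumes "(\<phi> has_real_derivative \<phi>') (at t within A)"
  shows "((\<lambda>t. exp (\<i> * complex_of_real (\<phi> t))) has_vector_derivative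
    \<i> * complex_of_real \<phi>' * exp (\<i> * complex_of_real (\<phi> t))) (at t within A)"
proof -
  have "((\<lambda>t. \<i> * complex_of_real (\<phi> t)) has_vector_derivative \<i> * complex_of_real \<phi>') (at t within A)"
    by (intro has_vector_derivative_mult_right has_vector_derivative_of_real assms)
  from field_vector_diff_chain_within[OF this, of exp "exp (\<i> * complex_of_real (\<phi> t))"]
  show ?thesis by (auto simp: o_def intro: DERIV_subset[OF DERIV_exp])
qed

text \<open>Along rays \<open>W\<close> oscillates like the outgoing exponential, so multiplying by
  that exponential doubles the frequency instead of cancelling it. Up to a factor of modulus one,
  \<open>g\<close> is the quantity in the radiation condition. A single \<open>g\<close> serves all
  tolerances; only the radius depends on \<open>e\<close>.\<close>

lemma radiation_euler:
  fixes W :: "real^3 \<Rightarrow> complex"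
  assumes "outgoing_radiation k W"
  obtains g where "\<And>e. e > 0 \<Longrightarrow> \<exists>R>0. \<forall>x. norm x > R \<longrightarrow> norm (g x) \<le> e \<and>
     ((\<lambda>t. W (t *\<^sub>R x) * exp (\<i> * of_real (k * norm (t *\<^sub>R x)))) has_vector_derivative
       (2 * \<i> * of_real (k * norm x) * (W x * exp (\<i> * of_real (k * norm x))) + g x)) (at 1)"
proof -
  define D where "D = (\<lambda>x. vector_derivative (\<lambda>s. W (s *\<^sub>R sgn x)) (at (norm x)))"
  define g where "g = (\<lambda>x. exp (\<i> * of_real (k * norm x)) * of_real (norm x) * (D x - \<i> * of_real k * W x))"
  show ?thesis
  proof (rule that[of g])
    fix e :: real assume "e > 0"
    obtain R where R: "R > 0" "\<And>r \<omega>. r > R \<Longrightarrow> \<omega> \<in> sphere 0 1 \<Longrightarrow> (\<lambda>s::real. W (s *\<^sub>R \<omega>)) differentiable (at r)"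
      "\<And>r \<omega>. r > R \<Longrightarrow> \<omega> \<in> sphere 0 1 \<Longrightarrow>
       r * norm (vector_derivative (\<lambda>s. W (s *\<^sub>R \<omega>)) (at r) - \<i> * of_real k * W (r *\<^sub>R \<omega>)) \<le> e"
      using radiation_uniform[OF assms \<open>e > 0\<close>] by blast
    have "norm (g x) \<le> e \<and>
     ((\<lambda>t. W (t *\<^sub>R x) * exp (\<i> * of_real (k * norm (t *\<^sub>R x)))) has_vector_derivative
       (2 * \<i> * of_real (k * norm x) * (W x * exp (\<i> * of_real (k * norm x))) + g x)) (at 1)" if x: "norm x > R" for x
    proof
      have x0: "x \<noteq> 0" using x R by auto
      have s: "sgn x \<in> sphere 0 1" using x0 by (simp add: norm_sgn)
      have rs: "norm x *\<^sub>R sgn x = x" using x0 by (simp add: sgn_div_norm)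
      show "norm (g x) \<le> e"
        using R(3)[OF x s] unfolding g_def D_def rs by (simp add: norm_mult norm_exp_i_times)
      have "((\<lambda>s. W (s *\<^sub>R sgn x)) has_vector_derivative D x) (at (norm x))"
        unfolding D_def using R(2)[OF x s] by (simp add: vector_derivative_works)
      from radial_chain[OF this x0]
      have "((\<lambda>t. W (norm (t *\<^sub>R x) *\<^sub>R sgn x)) has_vector_derivative norm x *\<^sub>R D x) (at 1)" .
      then have 1: "((\<lambda>t. W (t *\<^sub>R x)) has_vector_derivative norm x *\<^sub>R D x) (at 1)"
        by (rule has_vector_derivative_transform_within_open[of _ _ _ "{0<..}"]) (use x0 in \<open>auto simp: sgn_div_norm mult.assoc\<close>)
      have "((\<lambda>s. k * s) has_real_derivative k) (at (norm x))" by (auto intro!: derivative_eq_intros)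
      from radial_chain[OF exp_has_vector_derivative[OF this] x0]
      have "((\<lambda>t. exp (\<i> * of_real (k * norm (t *\<^sub>R x)))) has_vector_derivative
         norm x *\<^sub>R (\<i> * of_real k * exp (\<i> * of_real (k * norm x)))) (at 1)" .
      from has_vector_derivative_mult[OF 1 this]
      show "((\<lambda>t. W (t *\<^sub>R x) * exp (\<i> * of_real (k * norm (t *\<^sub>R x)))) has_vector_derivative
       (2 * \<i> * of_real (k * norm x) * (W x * exp (\<i> * of_real (k * norm x))) + g x)) (at 1)"
        by (rule has_vector_derivative_eq_rhs) (simp add: g_def scaleR_conv_of_real algebra_simps)
    qed
    then show "\<exists>R>0. \<forall>x. norm x > R \<longrightarrow> norm (g x) \<le> e \<and>
     ((\<lambda>t. W (t *\<^sub>R x) * exp (\<i> * of_real (k * norm (t *\<^sub>R x)))) has_vector_derivative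
       (2 * \<i> * of_real (k * norm x) * (W x * exp (\<i> * of_real (k * norm x))) + g x)) (at 1)"
      using R(1) by blast
  qed
qed

text \<open>With the phase removed, \<open>W\<close> has along each ray a derivative of size at most
  \<open>1 / s\<close> far out, and integration gives the logarithm. The constant \<open>M\<close>
  is a bound on one sphere.\<close>

lemma radiation_growth:
  fixes W :: "real^3 \<Rightarrow> complex"
  assumes "outgoing_radiation k W" "continuous_on UNIV W"
  obtains M R where "R \<ge> 1" "\<And>x. norm x \<ge> R \<Longrightarrow> norm (W x) \<le> M + ln (norm x)"
proof -
  obtain R0 where R0: "R0 > 0" "\<And>r \<omega>. r > R0 \<Longrightarrow> \<omega> \<in> sphere 0 1 \<Longrightarrow> (\<lambda>s::real. W (s *\<^sub>R \<omega>)) differentiable (at r)"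
      "\<And>r \<omega>. r > R0 \<Longrightarrow> \<omega> \<in> sphere 0 1 \<Longrightarrow>
       r * norm (vector_derivative (\<lambda>s. W (s *\<^sub>R \<omega>)) (at r) - \<i> * of_real k * W (r *\<^sub>R \<omega>)) \<le> 1"
    using radiation_uniform[OF assms(1), of 1] by auto
  define R where "R = R0 + 1"
  have "bounded (W ` sphere 0 R)"
    by (intro compact_imp_bounded compact_continuous_image continuous_on_subset[OF assms(2)]) auto
  then obtain M where M: "M > 0" "\<And>x. x \<in> sphere 0 R \<Longrightarrow> norm (W x) \<le> M" unfolding bounded_pos by auto
  show ?thesis
  proof (rule that[of R M])
    show "R \<ge> 1" using R0 by (simp add: R_def)
    fix x :: "real^3" assume x: "norm x \<ge> R"
    then have x0: "x \<noteq> 0" using R0 by (auto simp: R_def)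
    have s: "sgn x \<in> sphere 0 1" using x0 by (simp add: norm_sgn)
    have rs: "norm x *\<^sub>R sgn x = x" using x0 by (simp add: sgn_div_norm)
    have MR: "norm (W (R *\<^sub>R sgn x)) \<le> M" using s R0 by (intro M) (simp add: R_def norm_sgn)
    show "norm (W x) \<le> M + ln (norm x)"
    proof (cases "norm x = R")
      case True
      then have "norm (W x) \<le> M" using M by simp
      then show ?thesis using True R0 by (simp add: R_def add_increasing2)
    next
      case False
      let ?v = "\<lambda>s. W (s *\<^sub>R sgn x) * exp (\<i> * of_real (- k * s))"
      let ?D = "\<lambda>s. vector_derivative (\<lambda>s. W (s *\<^sub>R sgn x)) (at s)"
      have "norm (?v (norm x) - ?v R) \<le> ln (norm x) - ln R"
      proof (rule differentiable_bound_general[where f' = "\<lambda>s. (?D s - \<i> * of_real k * W (s *\<^sub>R sgn x)) * exp (\<i> * of_real (- k * s))"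
            and \<phi>' = "\<lambda>s. 1 / s"])
        show "R < norm x" using x False by simp
        show "continuous_on {R..norm x} ?v"
          by (intro continuous_intros continuous_on_compose2[OF assms(2)]) auto
        show "continuous_on {R..norm x} ln" using R0 by (intro continuous_intros) (auto simp: R_def)
        fix s assume s1: "R < s" "s < norm x"
        then have sR: "s > R0" "s > 0" using R0 by (auto simp: R_def)
        show "(ln has_vector_derivative 1 / s) (at s)"
          unfolding has_real_derivative_iff_has_vector_derivative[symmetric]
          using sR by (auto intro!: derivative_eq_intros)
        have 1: "((\<lambda>s. W (s *\<^sub>R sgn x)) has_vector_derivative ?D s) (at s)"
          using R0(2)[OF sR(1) s] by (simp add: vector_derivative_works)
        have "((\<lambda>s. - k * s) has_real_derivative - k) (at s)" by (auto intro!: derivative_eq_intros)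
        from has_vector_derivative_mult[OF 1 exp_has_vector_derivative[OF this]]
        show "(?v has_vector_derivative (?D s - \<i> * of_real k * W (s *\<^sub>R sgn x)) * exp (\<i> * of_real (- k * s))) (at s)"
          by (rule has_vector_derivative_eq_rhs) (simp add: algebra_simps)
        show "norm ((?D s - \<i> * of_real k * W (s *\<^sub>R sgn x)) * exp (\<i> * of_real (- k * s))) \<le> 1 / s"
          using R0(3)[OF sR(1) s] sR unfolding norm_mult norm_exp_i_times by (simp add: field_simps)
      qed
      moreover have "ln R \<ge> 0" using R0 by (simp add: R_def)
      moreover have "norm (?v R) = norm (W (R *\<^sub>R sgn x))" "norm (?v (norm x)) = norm (W x)"
        unfolding norm_mult norm_exp_i_times rs by simp_all
      ultimately show ?thesis using MR norm_triangle_ineq2[of "?v (norm x)" "?v R"] by linarith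
    qed
  qed
qed

text \<open>\<open>\<sigma>\<close> and \<open>\<sigma>2\<close> are the first and second
  derivatives of \<open>norm (x - x0)\<close> by \<open>x \<bullet> \<nabla>\<close>. Both differ
  from \<open>norm x\<close> by a bounded amount only: the phase
  \<open>norm (x - x0) - norm x\<close> has bounded derivatives of both orders although each
  distance grows.\<close>

lemma ray_distance:
  fixes x x0 :: "real^3"
  assumes r: "norm x \<ge> 2 * norm x0" "x \<noteq> 0"
  defines "s \<equiv> norm (x - x0)"
  defines "\<sigma> \<equiv> ((norm x)\<^sup>2 - x \<bullet> x0) / s"
  defines "\<sigma>2 \<equiv> (2 * (norm x)\<^sup>2 - x \<bullet> x0 - \<sigma>\<^sup>2) / s"
  shows "s > 0" and "norm x \<le> 2 * s"
    and "((\<lambda>t. norm (t *\<^sub>R x - x0)) has_real_derivative \<sigma>) (at 1)"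
    and "((\<lambda>t. ((norm (t *\<^sub>R x))\<^sup>2 - (t *\<^sub>R x) \<bullet> x0) / norm (t *\<^sub>R x - x0)) has_real_derivative \<sigma>2) (at 1)"
    and "\<bar>\<sigma>\<bar> \<le> norm x" and "\<bar>\<sigma> - norm x\<bar> \<le> 4 * norm x0" and "\<bar>\<sigma>2 - norm x\<bar> \<le> 20 * norm x0"
proof -
  let ?r = "norm x" and ?d = "norm x0" and ?c = "x \<bullet> x0"
  have rp: "?r > 0" using r by simp
  have rs: "\<bar>?r - s\<bar> \<le> ?d" unfolding s_def using norm_triangle_ineq3[of x "x - x0"] by simp
  then show r2: "?r \<le> 2 * s" using r by linarith
  then show s0: "s > 0" using rp by linarith
  have c: "\<bar>?c\<bar> \<le> ?r * ?d" by (rule Cauchy_Schwarz_ineq2)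
  define S where "S = (\<lambda>t. sqrt (t\<^sup>2 * ?r\<^sup>2 - 2 * t * ?c + ?d\<^sup>2))"
  have S: "norm (t *\<^sub>R x - x0) = S t" for t
    unfolding S_def norm_eq_sqrt_inner[of "t *\<^sub>R x - x0"] power2_norm_eq_inner
    by (simp add: inner_diff inner_commute power2_eq_square algebra_simps)
  have S1: "S 1 = s" using S[of 1] by (simp add: s_def)
  have ss: "s\<^sup>2 = ?r\<^sup>2 - 2 * ?c + ?d\<^sup>2"
    unfolding s_def power2_norm_eq_inner by (simp add: inner_diff inner_commute algebra_simps)
  have dS: "(S has_real_derivative \<sigma>) (at 1)"
  proof -
    have pos: "1\<^sup>2 * ?r\<^sup>2 - 2 * 1 * ?c + ?d\<^sup>2 > 0" using ss s0 by (simp flip: ss)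
    have "((\<lambda>t. t\<^sup>2 * ?r\<^sup>2 - 2 * t * ?c + ?d\<^sup>2) has_real_derivative (2 * ?r\<^sup>2 - 2 * ?c)) (at 1)"
      by (auto intro!: derivative_eq_intros)
    from DERIV_chain2[OF DERIV_real_sqrt[OF pos] this]
    have "(S has_real_derivative inverse (sqrt (1\<^sup>2 * ?r\<^sup>2 - 2 * 1 * ?c + ?d\<^sup>2)) / 2 * (2 * ?r\<^sup>2 - 2 * ?c)) (at 1)"
      unfolding S_def .
    moreover have "sqrt (1\<^sup>2 * ?r\<^sup>2 - 2 * 1 * ?c + ?d\<^sup>2) = s" using S1 by (simp add: S_def)
    moreover have "inverse s / 2 * (2 * ?r\<^sup>2 - 2 * ?c) = \<sigma>"
      using s0 by (simp add: \<sigma>_def field_simps)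
    ultimately show ?thesis by (simp only:)
  qed
  show "((\<lambda>t. norm (t *\<^sub>R x - x0)) has_real_derivative \<sigma>) (at 1)" unfolding S by (rule dS)
  have n: "((norm (t *\<^sub>R x))\<^sup>2 - (t *\<^sub>R x) \<bullet> x0) = t\<^sup>2 * ?r\<^sup>2 - t * ?c" for t
    by (simp add: power_mult_distrib)
  have "((\<lambda>t. t\<^sup>2 * ?r\<^sup>2 - t * ?c) has_real_derivative (2 * ?r\<^sup>2 - ?c)) (at 1)"
    by (auto intro!: derivative_eq_intros)
  from DERIV_divide[OF this dS]
  have "((\<lambda>t. (t\<^sup>2 * ?r\<^sup>2 - t * ?c) / S t) has_real_derivative
      ((2 * ?r\<^sup>2 - ?c) * S 1 - (1\<^sup>2 * ?r\<^sup>2 - 1 * ?c) * \<sigma>) / (S 1 * S 1)) (at 1)"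
    using S1 s0 by simp
  moreover have "((2 * ?r\<^sup>2 - ?c) * S 1 - (1\<^sup>2 * ?r\<^sup>2 - 1 * ?c) * \<sigma>) / (S 1 * S 1) = \<sigma>2"
    unfolding S1 \<sigma>2_def using s0 by (simp add: \<sigma>_def field_simps power2_eq_square)
  ultimately show "((\<lambda>t. ((norm (t *\<^sub>R x))\<^sup>2 - (t *\<^sub>R x) \<bullet> x0) / norm (t *\<^sub>R x - x0)) has_real_derivative \<sigma>2) (at 1)"
    unfolding S n by simp
  have xc: "?r\<^sup>2 - ?c = x \<bullet> (x - x0)" by (simp add: inner_diff_right power2_norm_eq_inner)
  show sg: "\<bar>\<sigma>\<bar> \<le> ?r"
    unfolding \<sigma>_def xc abs_divide using Cauchy_Schwarz_ineq2[of x "x - x0"] s0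
    by (simp add: s_def divide_le_eq)
  have rrs: "\<bar>?r * (?r - s)\<bar> \<le> ?r * ?d" unfolding abs_mult using rs by (intro mult_mono) auto
  have dl: "\<bar>\<sigma> - ?r\<bar> \<le> 4 * ?d"
  proof -
    \<comment> \<open>Both terms of the numerator carry a factor \<open>norm x0\<close>:
      \<open>norm x - s\<close> by the triangle inequality, the inner product by
      Cauchy-Schwarz.\<close>
    have "\<sigma> - ?r = (?r * (?r - s) - ?c) / s" using s0 by (simp add: \<sigma>_def field_simps power2_eq_square)
    then have "\<bar>\<sigma> - ?r\<bar> = \<bar>?r * (?r - s) - ?c\<bar> / s" using s0 by simp
    also have "\<dots> \<le> (2 * (?r * ?d)) / s" using rrs c s0 by (intro divide_right_mono) linarith+
    also have "\<dots> \<le> (2 * ((2 * s) * ?d)) / s" using r2 s0 by (intro divide_right_mono mult_left_mono mult_right_mono) auto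
    also have "\<dots> = 4 * ?d" using s0 by simp
    finally show ?thesis .
  qed
  then show "\<bar>\<sigma> - ?r\<bar> \<le> 4 * ?d" .
  have "\<sigma>2 - ?r = ((?r - \<sigma>) * (?r + \<sigma>) + ?r * (?r - s) - ?c) / s"
    using s0 unfolding \<sigma>2_def by (simp add: field_simps power2_eq_square)
  then have "\<bar>\<sigma>2 - ?r\<bar> = \<bar>(?r - \<sigma>) * (?r + \<sigma>) + ?r * (?r - s) - ?c\<bar> / s" using s0 by simp
  also have "\<dots> \<le> (10 * (?r * ?d)) / s"
  proof (rule divide_right_mono)
    have "\<bar>(?r - \<sigma>) * (?r + \<sigma>)\<bar> \<le> (4 * ?d) * (2 * ?r)"
      unfolding abs_mult using dl sg by (intro mult_mono) auto
    then have "\<bar>(?r - \<sigma>) * (?r + \<sigma>)\<bar> \<le> 8 * (?r * ?d)" by (simp add: mult_ac)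
    then show "\<bar>(?r - \<sigma>) * (?r + \<sigma>) + ?r * (?r - s) - ?c\<bar> \<le> 10 * (?r * ?d)" using rrs c by linarith
  qed (use s0 in simp)
  also have "\<dots> \<le> (10 * ((2 * s) * ?d)) / s" using r2 s0 by (intro divide_right_mono mult_left_mono mult_right_mono) auto
  also have "\<dots> = 20 * ?d" using s0 by simp
  finally show "\<bar>\<sigma>2 - ?r\<bar> \<le> 20 * ?d" .
qed

text \<open>The amplitude \<open>q(s) exp (i k (s - |x|))\<close>, \<open>s = |x - x\<^sub>0|\<close>, is a symbol: its
  iterated derivatives \<open>B'\<close>, \<open>B''\<close> by \<open>x \<bullet> \<nabla>\<close> are of the order of \<open>B\<close>.\<close>

lemma amplitude:
  fixes x0 :: "real^3" and q q1 q2 :: "real \<Rightarrow> complex"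
  assumes k: "k > 0" and L: "L \<ge> 1" "L \<ge> 2 * norm x0"
    and q: "\<And>s. s > 0 \<Longrightarrow> (q has_vector_derivative q1 s) (at s)" "\<And>s. s > 0 \<Longrightarrow> (q1 has_vector_derivative q2 s) (at s)"
      "continuous_on {0<..} q2"
    and z: "\<And>s. s > 0 \<Longrightarrow> s < L \<or> s > 2 * L \<Longrightarrow> q s = 0 \<and> q1 s = 0 \<and> q2 s = 0"
    and b: "\<And>s. s > 0 \<Longrightarrow> norm (q s) \<le> C / L^2" "\<And>s. s > 0 \<Longrightarrow> norm (q1 s) \<le> C / L^3" "\<And>s. s > 0 \<Longrightarrow> norm (q2 s) \<le> C / L^4"
    and C0_def: "C0 = C * (22 + 44 * (k * norm x0) + 16 * (k * norm x0)\<^sup>2)"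
    and B_def: "B = (\<lambda>x. q (norm (x - x0)) * exp (\<i> * of_real (k * (norm (x - x0) - norm x))))"
  defines "R \<equiv> 2 * norm x0"
  obtains B' B'' where
    "\<And>x. norm x > R \<Longrightarrow> ((\<lambda>t. B (t *\<^sub>R x)) has_vector_derivative B' x) (at 1)"
    "\<And>x. norm x > R \<Longrightarrow> ((\<lambda>t. B' (t *\<^sub>R x)) has_vector_derivative B'' x) (at 1)"
    "continuous_on {x. norm x > R} B" "continuous_on {x. norm x > R} B'" "continuous_on {x. norm x > R} B''"
    "\<And>x. norm x > R \<Longrightarrow> norm (B x) \<le> C0 / L^2 \<and> norm (B' x) \<le> C0 / L^2 \<and> norm (B'' x) \<le> C0 / L^2"
    "\<And>x. norm x > R \<Longrightarrow> norm x < L - norm x0 \<or> norm x > 3 * L \<Longrightarrow> B x = 0 \<and> B' x = 0 \<and> B'' x = 0"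
proof -
  define E where "E = (\<lambda>x. exp (\<i> * complex_of_real (k * (norm (x - x0) - norm x))))"
  define \<sigma> where "\<sigma> = (\<lambda>x. ((norm x)\<^sup>2 - x \<bullet> x0) / norm (x - x0))"
  define \<sigma>2 where "\<sigma>2 = (\<lambda>x. (2 * (norm x)\<^sup>2 - x \<bullet> x0 - (\<sigma> x)\<^sup>2) / norm (x - x0))"
  define \<delta> where "\<delta> = (\<lambda>x. \<sigma> x - norm x)"
  define A1 where "A1 = (\<lambda>x. of_real (\<sigma> x) * q1 (norm (x - x0)) + \<i> * of_real (k * \<delta> x) * q (norm (x - x0)))"
  define A2 where "A2 = (\<lambda>x. of_real ((\<sigma> x)\<^sup>2) * q2 (norm (x - x0)) + of_real (\<sigma>2 x) * q1 (norm (x - x0)) +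
     2 * \<i> * of_real (k * \<delta> x * \<sigma> x) * q1 (norm (x - x0)) + \<i> * of_real (k * (\<sigma>2 x - norm x)) * q (norm (x - x0))
      - of_real ((k * \<delta> x)\<^sup>2) * q (norm (x - x0)))"
  have x0: "x \<noteq> 0" "norm x \<ge> 2 * norm x0" if "norm x > R" for x
    using that unfolding R_def by (auto simp: not_less)
  note ray = ray_distance[OF x0(2) x0(1)]
  have pos: "norm (x - x0) > 0" if "norm x > R" for x using ray(1)[OF that that] .
  have ds: "((\<lambda>t. norm (t *\<^sub>R x - x0)) has_real_derivative \<sigma> x) (at 1)" if "norm x > R" for x
    using ray(3)[OF that that] by (simp only: \<sigma>_def)
  have dsg: "((\<lambda>t. \<sigma> (t *\<^sub>R x)) has_real_derivative \<sigma>2 x) (at 1)" if "norm x > R" for x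
    using ray(4)[OF that that] by (simp only: \<sigma>_def \<sigma>2_def)
  have dn: "((\<lambda>t. norm (t *\<^sub>R x)) has_real_derivative norm x) (at 1)" if "norm x > R" for x
    by (rule has_field_derivative_transform_within_open[of "\<lambda>t. t * norm x" _ _ "{0<..}"]) (auto intro!: derivative_eq_intros)
  have dd: "((\<lambda>t. \<delta> (t *\<^sub>R x)) has_real_derivative (\<sigma>2 x - norm x)) (at 1)" if "norm x > R" for x
    unfolding \<delta>_def by (intro DERIV_diff dsg dn that)
  have dq: "((\<lambda>t. f (norm (t *\<^sub>R x - x0))) has_vector_derivative of_real (\<sigma> x) * f' (norm (x - x0))) (at 1)"
    if "norm x > R" "\<And>s. s > 0 \<Longrightarrow> (f has_vector_derivative f' s) (at s)" for f f' :: "real \<Rightarrow> complex" and x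
  proof -
    have "(f has_vector_derivative f' (norm (x - x0))) (at (norm (1 *\<^sub>R x - x0)))"
      using that(2)[OF pos[OF that(1)]] by simp
    from vector_diff_chain_at[OF ds[OF that(1), unfolded has_real_derivative_iff_has_vector_derivative] this]
    show ?thesis by (simp add: o_def scaleR_conv_of_real)
  qed
  have dE: "((\<lambda>t. E (t *\<^sub>R x)) has_vector_derivative \<i> * of_real (k * \<delta> x) * E x) (at 1)" if "norm x > R" for x
  proof -
    have "((\<lambda>t. k * (norm (t *\<^sub>R x - x0) - norm (t *\<^sub>R x))) has_real_derivative k * \<delta> x) (at 1)"
      unfolding \<delta>_def by (intro DERIV_cmult DERIV_diff ds dn that)
    from exp_has_vector_derivative[OF this] show ?thesis by (simp add: E_def)
  qed
  have Beq: "B = (\<lambda>x. q (norm (x - x0)) * E x)" by (simp add: B_def E_def)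
  have 1: "((\<lambda>t. B (t *\<^sub>R x)) has_vector_derivative A1 x * E x) (at 1)" if x: "norm x > R" for x
  proof -
    have "q (norm (1 *\<^sub>R x - x0)) * (\<i> * of_real (k * \<delta> x) * E x) + of_real (\<sigma> x) * q1 (norm (x - x0)) * E (1 *\<^sub>R x) = A1 x * E x"
      unfolding A1_def scaleR_one by (simp only: algebra_simps)
    with has_vector_derivative_mult[OF dq[OF x q(1)] dE[OF x]] show ?thesis unfolding Beq by simp
  qed
  have 2: "((\<lambda>t. A1 (t *\<^sub>R x) * E (t *\<^sub>R x)) has_vector_derivative A2 x * E x) (at 1)" if x: "norm x > R" for x
  proof -
    have "((\<lambda>t. complex_of_real (\<sigma> (t *\<^sub>R x)) * q1 (norm (t *\<^sub>R x - x0)) + \<i> * (complex_of_real (k * \<delta> (t *\<^sub>R x)) * q (norm (t *\<^sub>R x - x0))))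
      has_vector_derivative (complex_of_real (\<sigma> (1 *\<^sub>R x)) * (of_real (\<sigma> x) * q2 (norm (x - x0))) + complex_of_real (\<sigma>2 x) * q1 (norm (1 *\<^sub>R x - x0)) +
        \<i> * (complex_of_real (k * \<delta> (1 *\<^sub>R x)) * (of_real (\<sigma> x) * q1 (norm (x - x0))) + complex_of_real (k * (\<sigma>2 x - norm x)) * q (norm (1 *\<^sub>R x - x0))))) (at 1)"
      by (intro has_vector_derivative_add has_vector_derivative_mult has_vector_derivative_mult_right
          has_vector_derivative_of_real DERIV_cmult dsg dd dq x q)
    from has_vector_derivative_mult[OF this dE[OF x]]
    show ?thesis unfolding A1_def mult.assoc[of \<i>]
      by (rule has_vector_derivative_eq_rhs) (simp add: A2_def \<delta>_def power2_eq_square algebra_simps)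
  qed
  have cs: "continuous_on {x. norm x > R} (\<lambda>x. norm (x - x0))" by (intro continuous_intros)
  have nz: "norm (x - x0) \<noteq> 0" if "x \<in> {x. norm x > R}" for x using pos that by auto
  have qc: "continuous_on {0<..} q" "continuous_on {0<..} q1"
    using q by (auto intro!: continuous_at_imp_continuous_on has_vector_derivative_continuous)
  have cq: "continuous_on {x. norm x > R} (\<lambda>x. f (norm (x - x0)))" if "continuous_on {0<..} f" for f :: "real \<Rightarrow> complex"
    by (rule continuous_on_compose2[OF that cs]) (use pos in auto)
  note cqs = cq[OF qc(1)] cq[OF qc(2)] cq[OF q(3)]
  have csg: "continuous_on {x. norm x > R} \<sigma>" unfolding \<sigma>_def by (intro continuous_intros ballI nz)
  have csg2: "continuous_on {x. norm x > R} \<sigma>2" unfolding \<sigma>2_def by (intro continuous_intros csg ballI nz)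
  have cd: "continuous_on {x. norm x > R} \<delta>" unfolding \<delta>_def by (intro continuous_intros csg)
  have cE: "continuous_on {x. norm x > R} E" unfolding E_def by (intro continuous_intros)
  have c: "continuous_on {x. norm x > R} B" "continuous_on {x. norm x > R} (\<lambda>x. A1 x * E x)" "continuous_on {x. norm x > R} (\<lambda>x. A2 x * E x)"
    unfolding Beq A1_def A2_def by (intro continuous_intros csg csg2 cd cE cqs)+
  have nE: "norm (E x) = 1" for x unfolding E_def norm_exp_i_times ..
  let ?\<kappa> = "k * norm x0"
  have \<kappa>: "?\<kappa> \<ge> 0" using k by simp
  have C: "C \<ge> 0" using order_trans[OF norm_ge_zero b(1)[of 1]] L by (simp add: zero_le_divide_iff)
  \<comment> \<open>The shell \<open>L \<le> s \<le> 2 * L\<close> around \<open>x0\<close> lies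
    between the radii \<open>L - norm x0\<close> and \<open>3 * L\<close> around the origin.\<close>
  have zero: "q (norm (x - x0)) = 0 \<and> q1 (norm (x - x0)) = 0 \<and> q2 (norm (x - x0)) = 0"
    if "norm x > R" "norm x < L - norm x0 \<or> norm x > 3 * L" for x
  proof (rule z[OF pos[OF that(1)]])
    show "norm (x - x0) < L \<or> norm (x - x0) > 2 * L"
      using that(2) norm_triangle_ineq4[of x x0] norm_triangle_ineq2[of x x0] L(2) norm_ge_zero[of x0] by linarith
  qed
  have bd: "norm (B x) \<le> C0 / L^2 \<and> norm (A1 x * E x) \<le> C0 / L^2 \<and> norm (A2 x * E x) \<le> C0 / L^2" if x: "norm x > R" for x
  proof (cases "norm x < L - norm x0 \<or> norm x > 3 * L")
    case True
    have "C0 \<ge> 0" using C k unfolding C0_def by (intro mult_nonneg_nonneg add_nonneg_nonneg) auto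
    then show ?thesis using zero[OF x True] unfolding Beq A1_def A2_def by simp
  next
    case False
    then have r3: "norm x \<le> 3 * L" by simp
    note p = b[OF pos[OF x]]
    have s: "\<bar>\<sigma> x\<bar> \<le> 3 * L" "\<bar>\<delta> x\<bar> \<le> 4 * norm x0" "\<bar>\<sigma>2 x - norm x\<bar> \<le> 20 * norm x0"
      using ray(5-7)[OF x x] r3 unfolding \<delta>_def \<sigma>2_def \<sigma>_def by linarith+
    \<comment> \<open>The bound is \<open>3 * L\<close> for \<open>norm x\<close> plus
      \<open>10 * L\<close> for \<open>20 * norm x0\<close>.\<close>
    have s2: "\<bar>\<sigma>2 x\<bar> \<le> 13 * L" using s(3) r3 L(2) norm_ge_zero[of x] by linarith
    have kd: "\<bar>k * \<delta> x\<bar> \<le> 4 * ?\<kappa>" "\<bar>k * (\<sigma>2 x - norm x)\<bar> \<le> 20 * ?\<kappa>"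
      unfolding abs_mult using s k mult_left_mono[of _ _ k] by (fastforce simp: algebra_simps)+
    have L0: "L > 0" using L by simp
    have t1: "norm (of_real a * f :: complex) \<le> A * D" if "\<bar>a\<bar> \<le> A" "norm f \<le> D" for a A D and f :: complex
      unfolding norm_mult norm_of_real using that by (intro mult_mono) auto
    have n0: "norm (q (norm (x - x0))) \<le> C / L^2" "norm (of_real (\<sigma> x) * q1 (norm (x - x0))) \<le> 3 * (C / L^2)"
      "norm (of_real (k * \<delta> x) * q (norm (x - x0))) \<le> 4 * ?\<kappa> * (C / L^2)"
      using p(1) t1[OF s(1) p(2)] t1[OF kd(1) p(1)] L0 by (auto simp: field_simps power2_eq_square power3_eq_cube)
    have sq: "\<bar>(\<sigma> x)\<^sup>2\<bar> \<le> 9 * L^2" "\<bar>k * \<delta> x * \<sigma> x\<bar> \<le> 12 * ?\<kappa> * L" "\<bar>(k * \<delta> x)\<^sup>2\<bar> \<le> 16 * ?\<kappa>\<^sup>2"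
    proof -
      have "\<bar>\<sigma> x\<bar>\<^sup>2 \<le> (3 * L)\<^sup>2" using s(1) by (intro power_mono) auto
      then show "\<bar>(\<sigma> x)\<^sup>2\<bar> \<le> 9 * L^2" by (simp add: power_mult_distrib)
      have "\<bar>k * \<delta> x\<bar> * \<bar>\<sigma> x\<bar> \<le> (4 * ?\<kappa>) * (3 * L)" using s(1) kd(1) \<kappa> by (intro mult_mono) auto
      then show "\<bar>k * \<delta> x * \<sigma> x\<bar> \<le> 12 * ?\<kappa> * L" unfolding abs_mult by simp
      have "\<bar>k * \<delta> x\<bar>\<^sup>2 \<le> (4 * ?\<kappa>)\<^sup>2" using kd(1) by (intro power_mono) auto
      then show "\<bar>(k * \<delta> x)\<^sup>2\<bar> \<le> 16 * ?\<kappa>\<^sup>2" by (simp add: power_mult_distrib)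
    qed
    have n2: "norm (of_real ((\<sigma> x)\<^sup>2) * q2 (norm (x - x0))) \<le> 9 * (C / L^2)"
      "norm (of_real (\<sigma>2 x) * q1 (norm (x - x0))) \<le> 13 * (C / L^2)"
      "norm (of_real (k * \<delta> x * \<sigma> x) * q1 (norm (x - x0))) \<le> 12 * ?\<kappa> * (C / L^2)"
      "norm (of_real (k * (\<sigma>2 x - norm x)) * q (norm (x - x0))) \<le> 20 * ?\<kappa> * (C / L^2)"
      "norm (of_real ((k * \<delta> x)\<^sup>2) * q (norm (x - x0))) \<le> 16 * ?\<kappa>\<^sup>2 * (C / L^2)"
      using t1[OF sq(1) p(3)] t1[OF s2 p(2)] t1[OF sq(2) p(2)] t1[OF kd(2) p(1)] t1[OF sq(3) p(1)] L0
      by (auto simp: field_simps power2_eq_square power3_eq_cube power4_eq_xxxx)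
    \<comment> \<open>The coefficients of \<open>C0\<close> collect the second derivative:
      \<open>9 + 13\<close> without \<open>?\<kappa>\<close>, \<open>2 * 12 + 20\<close> with
      \<open>?\<kappa>\<close>, and \<open>16\<close> with its square. They also cover the smaller
      bounds for \<open>B\<close> and its first derivative.\<close>
    define P where "P = C / L^2"
    have P: "P \<ge> 0" "?\<kappa> * P \<ge> 0" "?\<kappa>\<^sup>2 * P \<ge> 0" using C L0 \<kappa> unfolding P_def by auto
    have C0: "C0 / L^2 = 22 * P + 44 * (?\<kappa> * P) + 16 * (?\<kappa>\<^sup>2 * P)"
      unfolding C0_def P_def by (simp add: algebra_simps add_divide_distrib)
    have a1: "norm (A1 x) \<le> 3 * P + 4 * ?\<kappa> * P"
      unfolding A1_def mult.assoc[of \<i>] P_def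
      by (rule norm_triangle_mono[OF n0(2)]) (use n0(3) in \<open>simp add: norm_mult\<close>)
    have a2: "norm (A2 x) \<le> 9 * P + 13 * P + 2 * (12 * ?\<kappa> * P) + 20 * ?\<kappa> * P + 16 * ?\<kappa>\<^sup>2 * P"
      unfolding A2_def mult.assoc[of "2 * \<i>"] mult.assoc[of \<i>] P_def
      by (intro norm_triangle_mono norm_triangle_le_diff order_trans[OF norm_triangle_ineq4 add_mono] n2)
        (use n2(3,4) in \<open>auto simp: norm_mult\<close>)
    have "norm (A1 x) \<le> 3 * P + 4 * (?\<kappa> * P)" using a1 by (simp only: mult.assoc)
    moreover have "norm (A2 x) \<le> 9 * P + 13 * P + 2 * (12 * (?\<kappa> * P)) + 20 * (?\<kappa> * P) + 16 * (?\<kappa>\<^sup>2 * P)"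
      using a2 by (simp only: mult.assoc)
    moreover have "norm (q (norm (x - x0))) \<le> P" using n0(1) by (simp only: P_def)
    ultimately have "norm (q (norm (x - x0))) \<le> C0 / L^2" "norm (A1 x) \<le> C0 / L^2" "norm (A2 x) \<le> C0 / L^2"
      using P unfolding C0 by linarith+
    then show ?thesis unfolding Beq norm_mult nE by simp
  qed
  show ?thesis
    by (rule that[OF 1 2 c bd]) (use zero in \<open>auto simp: Beq A1_def A2_def\<close>)
qed

section \<open>Decay of the oscillatory integral over the shell\<close>

lemma measure_cball_R3:
  "r \<ge> 0 \<Longrightarrow> measure lebesgue (cball c r :: (real^3) set) = unit_ball_vol 3 * r ^ 3"
  using content_cball[of r c] by simp

text \<open>Power counting on a region of volume of order \<open>L^3\<close>. The amplitude has size
  \<open>L^-2\<close>, and each integration by parts divides it by another \<open>L\<close>. The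
  first leaves an error of order \<open>e\<close>, because \<open>g\<close> is small, the second one
  of order \<open>e / L\<close>, and the remaining integral is of order
  \<open>(M + ln 3 + ln L) / L\<close> by the logarithmic growth of \<open>W\<close>.\<close>

lemma oscillatory_bound:
  fixes W :: "real^3 \<Rightarrow> complex" and x0 :: "real^3" and q q1 q2 :: "real \<Rightarrow> complex"
  assumes k: "k > 0" and W: "continuous_on UNIV W"
    and g: "e \<ge> 0" "R > 0" "\<And>x. norm x > R \<Longrightarrow> norm (g x) \<le> e"
     "\<And>x. norm x > R \<Longrightarrow> ((\<lambda>t. W (t *\<^sub>R x) * exp (\<i> * of_real (k * norm (t *\<^sub>R x)))) has_vector_derivative
       (2 * \<i> * of_real (k * norm x) * (W x * exp (\<i> * of_real (k * norm x))) + g x)) (at 1)"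
    and M: "M \<ge> 0" "\<And>x. norm x > R \<Longrightarrow> norm (W x) \<le> M + ln (norm x)"
    and L: "L \<ge> 1" "L > R + 3 * norm x0"
    and q: "\<And>s. s > 0 \<Longrightarrow> (q has_vector_derivative q1 s) (at s)" "\<And>s. s > 0 \<Longrightarrow> (q1 has_vector_derivative q2 s) (at s)"
      "continuous_on {0<..} q2"
      "\<And>s. s > 0 \<Longrightarrow> s < L \<or> s > 2 * L \<Longrightarrow> q s = 0 \<and> q1 s = 0 \<and> q2 s = 0"
      "q 0 = 0"
      "\<And>s. s > 0 \<Longrightarrow> norm (q s) \<le> C / L^2" "\<And>s. s > 0 \<Longrightarrow> norm (q1 s) \<le> C / L^3" "\<And>s. s > 0 \<Longrightarrow> norm (q2 s) \<le> C / L^4"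
  defines "D \<equiv> unit_ball_vol 3 * (C * (22 + 44 * (k * norm x0) + 16 * (k * norm x0)\<^sup>2))"
  shows "norm (LINT x|lebesgue. W x * (q (norm (x - x0)) * exp (\<i> * of_real (k * norm (x - x0)))))
     \<le> (54 * D * e + (324 * D * e + 648 * D * ((M + ln 3 + ln L) / L)) / (2 * k)) / (2 * k)"
proof -
  define C0 where "C0 = C * (22 + 44 * (k * norm x0) + 16 * (k * norm x0)\<^sup>2)"
  define U where "U = unit_ball_vol 3"
  have D: "D = U * C0" by (simp add: D_def U_def C0_def)
  define B where "B = (\<lambda>x. q (norm (x - x0)) * exp (\<i> * of_real (k * (norm (x - x0) - norm x))))"
  have L2: "L \<ge> 2 * norm x0" using L g(2) norm_ge_zero[of x0] by linarith
  obtain B' B'' where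
    B': "\<And>x. norm x > 2 * norm x0 \<Longrightarrow> ((\<lambda>t. B (t *\<^sub>R x)) has_vector_derivative B' x) (at 1)"
    "\<And>x. norm x > 2 * norm x0 \<Longrightarrow> ((\<lambda>t. B' (t *\<^sub>R x)) has_vector_derivative B'' x) (at 1)" and
    Bc: "continuous_on {x. norm x > 2 * norm x0} B" "continuous_on {x. norm x > 2 * norm x0} B'" "continuous_on {x. norm x > 2 * norm x0} B''" and
    Bb: "\<And>x. norm x > 2 * norm x0 \<Longrightarrow> norm (B x) \<le> C0 / L^2 \<and> norm (B' x) \<le> C0 / L^2 \<and> norm (B'' x) \<le> C0 / L^2" and
    Bz: "\<And>x. norm x > 2 * norm x0 \<Longrightarrow> norm x < L - norm x0 \<or> norm x > 3 * L \<Longrightarrow> B x = 0 \<and> B' x = 0 \<and> B'' x = 0"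
  proof (rule amplitude[OF k L(1) L2 q(1-4) q(6-8) C0_def B_def])
    fix B' B''
    assume A: "\<And>x. norm x > 2 * norm x0 \<Longrightarrow> ((\<lambda>t. B (t *\<^sub>R x)) has_vector_derivative B' x) (at 1)"
    "\<And>x. norm x > 2 * norm x0 \<Longrightarrow> ((\<lambda>t. B' (t *\<^sub>R x)) has_vector_derivative B'' x) (at 1)"
       "continuous_on {x. norm x > 2 * norm x0} B" "continuous_on {x. norm x > 2 * norm x0} B'" "continuous_on {x. norm x > 2 * norm x0} B''"
       "\<And>x. norm x > 2 * norm x0 \<Longrightarrow> norm (B x) \<le> C0 / L^2 \<and> norm (B' x) \<le> C0 / L^2 \<and> norm (B'' x) \<le> C0 / L^2"
       "\<And>x. norm x > 2 * norm x0 \<Longrightarrow> norm x < L - norm x0 \<or> norm x > 3 * L \<Longrightarrow> B x = 0 \<and> B' x = 0 \<and> B'' x = 0"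
    show thesis by (rule that[OF A])
  qed
  let ?r = "\<lambda>x::real^3. complex_of_real (norm x)"
  define R' where "R' = max R (2 * norm x0)"
  define a where "a = L - norm x0"
  have R': "R' > 0" "R' < a" "R \<le> R'" "2 * norm x0 \<le> R'"
  proof -
    have "R' \<le> R + 2 * norm x0" "R \<le> R'" "2 * norm x0 \<le> R'" using g(2) by (simp_all add: R'_def)
    then show "R' > 0" "R' < a" "R \<le> R'" "2 * norm x0 \<le> R'"
      using g(2) L unfolding a_def by linarith+
  qed
  have aL: "a \<ge> L / 2" using L2 unfolding a_def by linarith
  have L0: "L > 0" using L by simp
  have sub: "{x::real^3. norm x > R'} \<subseteq> {x. norm x > 2 * norm x0}" using R' by auto
  have C0: "C0 \<ge> 0"
  proof -
    obtain x :: "real^3" where "norm x = 2 * norm x0 + 1" using vector_choose_size[of "2 * norm x0 + 1"] norm_ge_zero[of x0] by auto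
    then have "norm (B x) \<le> C0 / L^2" using Bb[of x] by simp
    then have "0 \<le> C0 / L^2" by (rule order_trans[OF norm_ge_zero])
    then show ?thesis using L0 by (simp add: zero_le_divide_iff)
  qed
  define Z where "Z = (\<lambda>x. W x * exp (\<i> * of_real (k * norm x)))"
  have Z: "continuous_on UNIV Z" unfolding Z_def by (intro continuous_intros W)
  have nZ: "norm (Z x) = norm (W x)" for x unfolding Z_def norm_mult norm_exp_i_times by simp
  have dZ: "((\<lambda>t. Z (t *\<^sub>R x)) has_vector_derivative (2 * \<i> * of_real (k * norm x) * Z x + g x)) (at 1)"
    if "norm x > R'" for x using g(4)[of x] that R' unfolding Z_def by auto
  \<comment> \<open>The representatives \<open>B'\<close>, \<open>B''\<close> are only controlled away from the origin.\<close>
  define b where "b = (\<lambda>x. if norm x > R' then B x else 0)"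
  define b1 where "b1 = (\<lambda>x. if norm x > R' then B' x else 0)"
  define b2 where "b2 = (\<lambda>x. if norm x > R' then B'' x else 0)"
  have opn: "open {t. R' < norm (t *\<^sub>R x)}" for x :: "real^3" by (intro open_Collect_less continuous_intros)
  have db: "((\<lambda>t. b (t *\<^sub>R x)) has_vector_derivative b1 x) (at 1)" "((\<lambda>t. b1 (t *\<^sub>R x)) has_vector_derivative b2 x) (at 1)"
    if x: "norm x > R'" for x
  proof -
    have "2 * norm x0 < norm x" using x R' by linarith
    note d = B'(1)[OF this] B'(2)[OF this]
    show "((\<lambda>t. b (t *\<^sub>R x)) has_vector_derivative b1 x) (at 1)"
      by (rule has_vector_derivative_transform_within_open[OF _ opn[of x]]) (use d x in \<open>auto simp: b_def b1_def\<close>)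
    show "((\<lambda>t. b1 (t *\<^sub>R x)) has_vector_derivative b2 x) (at 1)"
      by (rule has_vector_derivative_transform_within_open[OF _ opn[of x]]) (use d x in \<open>auto simp: b1_def b2_def\<close>)
  qed
  have cb: "continuous_on {x. norm x > R'} b" "continuous_on {x. norm x > R'} b1" "continuous_on {x. norm x > R'} b2"
    by (rule continuous_on_eq[OF continuous_on_subset[OF Bc(1) sub]], simp add: b_def,
        rule continuous_on_eq[OF continuous_on_subset[OF Bc(2) sub]], simp add: b1_def,
        rule continuous_on_eq[OF continuous_on_subset[OF Bc(3) sub]], simp add: b2_def)
  have nb: "norm (b x) \<le> C0 / L^2" "norm (b1 x) \<le> C0 / L^2" "norm (b2 x) \<le> C0 / L^2" for x
  proof -
    have "0 \<le> C0 / L^2" using C0 by simp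
    then show "norm (b x) \<le> C0 / L^2" "norm (b1 x) \<le> C0 / L^2" "norm (b2 x) \<le> C0 / L^2"
      using Bb[of x] R' by (auto simp: b_def b1_def b2_def)
  qed
  have zb: "b x = 0 \<and> b1 x = 0 \<and> b2 x = 0" if "norm x < a \<or> norm x > 3 * L" for x
    using Bz[of x] that R' by (auto simp: b_def b1_def b2_def a_def)
  \<comment> \<open>\<open>c\<close> is the amplitude produced by the first integration by parts and
    \<open>c1\<close> its Euler derivative, so that the step can be applied a second time.\<close>
  define c where "c = (\<lambda>x. (b1 x + 2 * b x) / ?r x)"
  define c1 where "c1 = (\<lambda>x. (b2 x + b1 x - 2 * b x) / ?r x)"
  have rc: "continuous_on {x. norm x > R'} ?r" "\<And>x. norm x > R' \<Longrightarrow> ?r x \<noteq> 0" using R' by (auto intro!: continuous_intros)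
  have cc: "continuous_on {x. norm x > R'} c" "continuous_on {x. norm x > R'} c1"
    unfolding c_def c1_def using rc by (auto intro!: continuous_intros cb)
  have zc: "c x = 0 \<and> c1 x = 0" if "norm x < a \<or> norm x > 3 * L" for x
    using zb[OF that] by (simp add: c_def c1_def)
  have dc: "((\<lambda>t. c (t *\<^sub>R x)) has_vector_derivative c1 x) (at 1)" if x: "norm x > R'" for x
  proof -
    have x0: "norm x \<noteq> 0" using x R' by auto
    have "((\<lambda>t. inverse (t * norm x)) has_real_derivative - 1 / norm x) (at 1)"
      using x0 by (auto intro!: derivative_eq_intros simp: field_simps power2_eq_square)
    then have "((\<lambda>t. complex_of_real (inverse (t * norm x))) has_vector_derivative complex_of_real (- 1 / norm x)) (at 1)"
      by (rule has_vector_derivative_of_real)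
    from has_vector_derivative_mult[OF has_vector_derivative_add[OF db(2)[OF x] has_vector_derivative_mult_right[OF db(1)[OF x], of 2]] this]
    have "((\<lambda>t. (b1 (t *\<^sub>R x) + 2 * b (t *\<^sub>R x)) * complex_of_real (inverse (t * norm x))) has_vector_derivative c1 x) (at 1)"
      by (rule has_vector_derivative_eq_rhs) (use x0 in \<open>simp add: c1_def field_simps\<close>)
    then show ?thesis
      by (rule has_vector_derivative_transform_within_open[of _ _ _ "{0<..}"])
        (auto simp: c_def divide_inverse)
  qed
  have rL: "norm x \<ge> L / 2" if "\<not> (norm x < a \<or> norm x > 3 * L)" for x :: "real^3" using that aL by simp
  have nc: "norm (c x) \<le> 6 * C0 / L^3" for x
  proof (cases "norm x < a \<or> norm x > 3 * L")
    case True
    then show ?thesis using zc C0 L0 by simp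
  next
    case False
    have "norm (c x) = norm (b1 x + 2 * b x) / norm x" by (simp add: c_def norm_divide)
    also have "\<dots> \<le> (3 * (C0 / L^2)) / (L / 2)"
    proof (rule frac_le)
      have "norm (b1 x + 2 * b x) \<le> norm (b1 x) + 2 * norm (b x)"
        using norm_triangle_ineq[of "b1 x" "2 * b x"] by (simp add: norm_mult)
      then show "norm (b1 x + 2 * b x) \<le> 3 * (C0 / L^2)" using nb[of x] by linarith
    qed (use rL[OF False] L0 C0 in auto)
    also have "\<dots> = 6 * C0 / L^3" using L0 by (simp add: field_simps power2_eq_square power3_eq_cube)
    finally show ?thesis .
  qed
  have gK: "norm (g x) * norm (f x) / norm x \<le> e * A / (L / 2)"
    if "norm x > R'" "\<And>x. norm (f x) \<le> A" "\<And>x. norm x < a \<or> norm x > 3 * L \<Longrightarrow> f x = 0" for x A and f :: "real^3 \<Rightarrow> complex"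
  proof (cases "norm x < a \<or> norm x > 3 * L")
    case True
    have "A \<ge> 0" using that(2)[of x] norm_ge_zero order_trans by blast
    then show ?thesis using that(3)[OF True] g(1) L0 by simp
  next
    case False
    have "A \<ge> 0" using that(2)[of x] norm_ge_zero order_trans by blast
    then show ?thesis using rL[OF False] g(1) g(3)[of x] that(1,2) R' L0 by (intro frac_le mult_mono) auto
  qed
  have gb: "norm (g x) * norm (b x) / norm x \<le> e * (C0 / L^2) / (L / 2)" if "norm x > R'" for x
    using gK[of x b "C0 / L^2"] that nb(1) zb by blast
  have gc: "norm (g x) * norm (c x) / norm x \<le> e * (6 * C0 / L^3) / (L / 2)" if "norm x > R'" for x
    using gK[of x c "6 * C0 / L^3"] that nc zc by blast
  have zb': "b x = 0 \<and> b1 x = 0" if "norm x < a \<or> norm x > 3 * L" for x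
    using zb[OF that] by blast
  define A where "A = (LINT x|lebesgue. Z x * b x)"
  define A1 where "A1 = (LINT x|lebesgue. Z x * c x)"
  define A2 where "A2 = (LINT x|lebesgue. Z x * ((c1 x + 2 * c x) / ?r x))"
  have L3: "3 * L > 0" using L0 by simp
  have vol: "measure lebesgue (cball 0 (3 * L) :: (real^3) set) = U * (27 * L^3)"
    using measure_cball_R3[of "3 * L" 0] L0 by (simp add: U_def power_mult_distrib)
  have "norm (2 * \<i> * of_real k * A + A1) \<le> (e * (C0 / L^2) / (L / 2)) * measure lebesgue (cball 0 (3 * L) :: (real^3) set)"
    unfolding A_def A1_def c_def
    by (rule oscillatory_step(3)[where Z = Z and B = b and B' = b1 and g = g and R = R' and a = a and b = "3 * L" and k = k,
        OF R'(1,2) L3 Z dZ cb(1,2) db(1) zb' gb])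
  \<comment> \<open>A factor \<open>2\<close> comes from \<open>norm x \<ge> L / 2\<close> and
    \<open>27\<close> from the ball of radius \<open>3 * L\<close>. In the same way
    \<open>324\<close> is \<open>54 * 6\<close> and \<open>648\<close> is
    \<open>27 * 24\<close>.\<close>
  also have "\<dots> = 54 * D * e" unfolding vol D using L0 by (simp add: field_simps power2_eq_square power3_eq_cube)
  finally have s1: "norm (2 * \<i> * of_real k * A + A1) \<le> 54 * D * e" .
  have U: "U \<ge> 0" unfolding U_def by simp
  have "norm (2 * \<i> * of_real k * A1 + A2) \<le> (e * (6 * C0 / L^3) / (L / 2)) * measure lebesgue (cball 0 (3 * L) :: (real^3) set)"
    unfolding A1_def A2_def
    by (rule oscillatory_step(3)[where Z = Z and B = c and B' = c1 and g = g and R = R' and a = a and b = "3 * L" and k = k,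
        OF R'(1,2) L3 Z dZ cc dc zc gc])
  also have "\<dots> = (324 * D * e) * (1 / L)" unfolding vol D using L0 by (simp add: field_simps power2_eq_square power3_eq_cube)
  also have "\<dots> \<le> (324 * D * e) * 1" using L U C0 g(1) unfolding D by (intro mult_left_mono) auto
  finally have s2: "norm (2 * \<i> * of_real k * A1 + A2) \<le> 324 * D * e" by simp
  define MM where "MM = M + ln 3 + ln L"
  have MM: "MM \<ge> 0" using M(1) L(1) unfolding MM_def by simp
  have s3: "norm A2 \<le> 648 * D * (MM / L)"
  proof -
    have "norm A2 \<le> (24 * C0 * MM / L^4) * measure lebesgue (cball 0 (3 * L) :: (real^3) set)"
      unfolding A2_def
    proof (rule integral_norm_le(2))
      show "(\<lambda>x. Z x * ((c1 x + 2 * c x) / ?r x)) \<in> borel_measurable lebesgue"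
        by (rule borel_measurable_integrable, rule oscillatory_step(2)[where Z = Z and B = c and B' = c1 and g = g and R = R' and a = a and b = "3 * L" and k = k,
        OF R'(1,2) L3 Z dZ cc dc zc gc])
      show "Z x * ((c1 x + 2 * c x) / ?r x) = 0" if "x \<notin> cball 0 (3 * L)" for x using zc[of x] that by simp
      show "norm (Z x * ((c1 x + 2 * c x) / ?r x)) \<le> 24 * C0 * MM / L^4" for x
      proof (cases "norm x < a \<or> norm x > 3 * L")
        case True
        then show ?thesis using zc[OF True] C0 MM L0 by simp
      next
        case False
        have xp: "norm x > 0" using rL[OF False] L0 by linarith
        have xR: "norm x > R" using False R' by simp
        have "ln (norm x) \<le> ln (3 * L)" using False xp L0 by (subst ln_le_cancel_iff) auto
        also have "\<dots> = ln 3 + ln L" using L0 by (simp add: ln_mult)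
        finally have w: "norm (Z x) \<le> MM" using M(2)[OF xR] unfolding nZ MM_def by linarith
        \<comment> \<open>The coefficients add up to \<open>1 + 3 + 2 = 6\<close>; two divisions by
          \<open>norm x \<ge> L / 2\<close> contribute \<open>4\<close>, hence the
          \<open>24\<close>.\<close>
        have "c1 x + 2 * c x = (b2 x + 3 * b1 x + 2 * b x) / ?r x"
          by (simp add: c_def c1_def add_divide_distrib diff_divide_distrib)
        then have "norm ((c1 x + 2 * c x) / ?r x) = norm (b2 x + 3 * b1 x + 2 * b x) / (norm x * norm x)"
          by (simp add: norm_divide norm_mult)
        also have "\<dots> \<le> (6 * (C0 / L^2)) / (L / 2 * (L / 2))"
        proof (rule frac_le)
          have "norm (b2 x + 3 * b1 x + 2 * b x) \<le> norm (b2 x) + norm (3 * b1 x) + norm (2 * b x)"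
            by (intro norm_triangle_mono order_refl)
          then show "norm (b2 x + 3 * b1 x + 2 * b x) \<le> 6 * (C0 / L^2)"
            using nb[of x] unfolding norm_mult by simp
          show "L / 2 * (L / 2) \<le> norm x * norm x" using rL[OF False] L0 by (intro mult_mono) auto
        qed (use L0 C0 in auto)
        finally have "norm (Z x * ((c1 x + 2 * c x) / ?r x)) \<le> MM * ((6 * (C0 / L^2)) / (L / 2 * (L / 2)))"
          unfolding norm_mult using w MM by (intro mult_mono) auto
        also have "\<dots> = 24 * C0 * MM / L^4" using L0 by (simp add: field_simps power2_eq_square power4_eq_xxxx)
        finally show ?thesis .
      qed
    qed
    also have "\<dots> = 648 * D * (MM / L)" unfolding vol D using L0 by (simp add: field_simps power3_eq_cube power4_eq_xxxx)
    finally show ?thesis .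
  qed
  have inv: "norm X \<le> (p + norm Y) / (2 * k)" if "norm (2 * \<i> * of_real k * X + Y) \<le> p" for X Y :: complex and p
  proof -
    have "norm (2 * \<i> * of_real k * X) \<le> norm (2 * \<i> * of_real k * X + Y) + norm Y"
      using norm_triangle_ineq4[of "2 * \<i> * of_real k * X + Y" Y] by simp
    then have "2 * k * norm X \<le> p + norm Y" using that k by (simp add: norm_mult)
    then show ?thesis using k by (simp add: field_simps)
  qed
  have "norm A1 \<le> (324 * D * e + 648 * D * (MM / L)) / (2 * k)"
    using inv[OF s2] s3 k by (smt (verit) divide_right_mono)
  then have main: "norm A \<le> (54 * D * e + (324 * D * e + 648 * D * (MM / L)) / (2 * k)) / (2 * k)"
    using inv[OF s1] k by (smt (verit) divide_right_mono)
  have "Z x * b x = W x * (q (norm (x - x0)) * exp (\<i> * of_real (k * norm (x - x0))))" for x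
  proof (cases "norm x > R'")
    case True
    have "exp (\<i> * of_real (k * norm x)) * exp (\<i> * of_real (k * (norm (x - x0) - norm x))) = exp (\<i> * of_real (k * norm (x - x0)))"
      unfolding exp_add[symmetric] by (simp add: algebra_simps)
    then show ?thesis using True by (simp add: Z_def b_def B_def mult_ac)
  next
    case False
    \<comment> \<open>Points inside radius \<open>R'\<close> are closer than \<open>L\<close> to
      \<open>x0\<close>. The support condition speaks of positive distances only, so
      \<open>x0\<close> itself is covered by \<open>q 0 = 0\<close>.\<close>
    have "q (norm (x - x0)) = 0"
    proof (cases "x = x0")
      case True
      then show ?thesis using q(5) by simp
    next
      case False
      have "norm (x - x0) < L"
        using \<open>\<not> norm x > R'\<close> R'(2) norm_triangle_ineq4[of x x0] unfolding a_def by linarith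
      then show ?thesis using q(4)[of "norm (x - x0)"] False by simp
    qed
    then show ?thesis using False by (simp add: b_def)
  qed
  then have "(LINT x|lebesgue. W x * (q (norm (x - x0)) * exp (\<i> * of_real (k * norm (x - x0))))) = A"
    unfolding A_def by simp
  then show ?thesis using main unfolding MM_def by simp
qed

text \<open>For a fixed tolerance \<open>e\<close> the bound tends, as \<open>L\<close> grows, to
  \<open>e\<close> times a constant that depends on neither \<open>e\<close> nor \<open>L\<close>;
  letting \<open>e\<close> be small afterwards gives the limit.\<close>

lemma oscillatory_decay:
  fixes W :: "real^3 \<Rightarrow> complex" and x0 :: "real^3" and q q1 q2 :: "real \<Rightarrow> real \<Rightarrow> complex"
  assumes k: "k > 0" and W: "continuous_on UNIV W" "outgoing_radiation k W"
    and q: "\<And>L s. L \<ge> 1 \<Longrightarrow> s > 0 \<Longrightarrow> (q L has_vector_derivative q1 L s) (at s)"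
      "\<And>L s. L \<ge> 1 \<Longrightarrow> s > 0 \<Longrightarrow> (q1 L has_vector_derivative q2 L s) (at s)"
      "\<And>L. L \<ge> 1 \<Longrightarrow> continuous_on {0<..} (q2 L)"
      "\<And>L s. L \<ge> 1 \<Longrightarrow> s > 0 \<Longrightarrow> s < L \<or> s > 2 * L \<Longrightarrow> q L s = 0 \<and> q1 L s = 0 \<and> q2 L s = 0"
      "\<And>L. q L 0 = 0"
      "\<And>L s. L \<ge> 1 \<Longrightarrow> s > 0 \<Longrightarrow> norm (q L s) \<le> C / L^2" "\<And>L s. L \<ge> 1 \<Longrightarrow> s > 0 \<Longrightarrow> norm (q1 L s) \<le> C / L^3"
      "\<And>L s. L \<ge> 1 \<Longrightarrow> s > 0 \<Longrightarrow> norm (q2 L s) \<le> C / L^4"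
  shows "((\<lambda>L. LINT x|lebesgue. W x * (q L (norm (x - x0)) * exp (\<i> * of_real (k * norm (x - x0))))) \<longlongrightarrow> 0) at_top"
proof -
  obtain g where g: "\<And>e. e > 0 \<Longrightarrow> \<exists>R>0. \<forall>x. norm x > R \<longrightarrow> norm (g x) \<le> e \<and>
     ((\<lambda>t. W (t *\<^sub>R x) * exp (\<i> * of_real (k * norm (t *\<^sub>R x)))) has_vector_derivative
       (2 * \<i> * of_real (k * norm x) * (W x * exp (\<i> * of_real (k * norm x))) + g x)) (at 1)"
    using radiation_euler[OF W(2)] by blast
  obtain M Rg where M: "Rg \<ge> 1" "\<And>x. norm x \<ge> Rg \<Longrightarrow> norm (W x) \<le> M + ln (norm x)"
    using radiation_growth[OF W(2,1)] by blast
  define D where "D = unit_ball_vol 3 * (C * (22 + 44 * (k * norm x0) + 16 * (k * norm x0)\<^sup>2))"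
  let ?I = "\<lambda>L. LINT x|lebesgue. W x * (q L (norm (x - x0)) * exp (\<i> * of_real (k * norm (x - x0))))"
  let ?F = "\<lambda>e L. (54 * D * e + (324 * D * e + 648 * D * ((\<bar>M\<bar> + ln 3 + ln L) / L)) / (2 * k)) / (2 * k)"
  have bound: "\<forall>\<^sub>F L in at_top. norm (?I L) \<le> ?F e L" if e: "e > 0" for e
  proof -
    obtain R0 where R0: "R0 > 0" "\<And>x. norm x > R0 \<Longrightarrow> norm (g x) \<le> e"
     "\<And>x. norm x > R0 \<Longrightarrow> ((\<lambda>t. W (t *\<^sub>R x) * exp (\<i> * of_real (k * norm (t *\<^sub>R x)))) has_vector_derivative
       (2 * \<i> * of_real (k * norm x) * (W x * exp (\<i> * of_real (k * norm x))) + g x)) (at 1)"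
      using g[OF e] by auto
    define R where "R = max R0 Rg"
    have R: "R > 0" "R \<ge> R0" "R \<ge> Rg" using R0 by (auto simp: R_def)
    have "norm (?I L) \<le> ?F e L" if L: "L \<ge> R + 3 * norm x0 + 1" for L
      unfolding D_def
    proof (rule oscillatory_bound[OF k W(1), where e = e and R = R and g = g and M = "\<bar>M\<bar>"
          and L = L and q = "q L" and ?q1.0 = "q1 L" and ?q2.0 = "q2 L" and C = C])
      have L1: "L \<ge> 1" using L R norm_ge_zero[of x0] by linarith
      show "L \<ge> 1" by (rule L1)
      show "norm (W x) \<le> \<bar>M\<bar> + ln (norm x)" if "norm x > R" for x
        using M(2)[of x] that R by linarith
      show "(q L has_vector_derivative q1 L s) (at s)" if "s > 0" for s by (rule q(1)[OF L1 that])
      show "(q1 L has_vector_derivative q2 L s) (at s)" if "s > 0" for s by (rule q(2)[OF L1 that])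
      show "continuous_on {0<..} (q2 L)" by (rule q(3)[OF L1])
      show "q L s = 0 \<and> q1 L s = 0 \<and> q2 L s = 0" if "s > 0" "s < L \<or> s > 2 * L" for s
        by (rule q(4)[OF L1 that])
      show "q L 0 = 0" by (rule q(5))
      show "norm (q L s) \<le> C / L^2" if "s > 0" for s by (rule q(6)[OF L1 that])
      show "norm (q1 L s) \<le> C / L^3" if "s > 0" for s by (rule q(7)[OF L1 that])
      show "norm (q2 L s) \<le> C / L^4" if "s > 0" for s by (rule q(8)[OF L1 that])
    qed (use e R R0 L in auto)
    then show ?thesis unfolding eventually_at_top_linorder by blast
  qed
  have lim: "((\<lambda>L. ?F e L) \<longlongrightarrow> (54 * D * e + (324 * D * e + 648 * D * 0) / (2 * k)) / (2 * k)) at_top" for e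
  proof -
    have "((\<lambda>L::real. (\<bar>M\<bar> + ln 3) / L + ln L / L) \<longlongrightarrow> 0 + 0) at_top"
      by (intro tendsto_add ln_x_over_x_tendsto_0 tendsto_divide_0[OF tendsto_const] filterlim_at_top_imp_at_infinity filterlim_ident)
    then have "((\<lambda>L::real. (\<bar>M\<bar> + ln 3 + ln L) / L) \<longlongrightarrow> 0) at_top" by (simp add: add_divide_distrib)
    then show ?thesis using k by (intro tendsto_intros) auto
  qed
  define c where "c = (54 * D + 324 * D / (2 * k)) / (2 * k)"
  have c: "(54 * D * e + (324 * D * e + 648 * D * 0) / (2 * k)) / (2 * k) = c * e" for e
    using k by (simp add: c_def field_simps)
  show ?thesis
    unfolding tendsto_iff dist_norm
  proof (intro allI impI)
    fix \<epsilon> :: real assume "\<epsilon> > 0"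
    define e where "e = \<epsilon> / (2 * (\<bar>c\<bar> + 1))"
    have e: "e > 0" using \<open>\<epsilon> > 0\<close> by (simp add: e_def add_pos_nonneg)
    have "c * e \<le> (\<bar>c\<bar> + 1) * e" using e by (intro mult_right_mono) auto
    also have "\<dots> = \<epsilon> / 2" by (simp add: e_def field_simps)
    finally have "c * e < \<epsilon>" using \<open>\<epsilon> > 0\<close> by simp
    then have "\<forall>\<^sub>F L in at_top. ?F e L < \<epsilon>"
      using order_tendstoD(2)[OF lim[of e]] unfolding c by blast
    with bound[OF e] show "\<forall>\<^sub>F L in at_top. norm (?I L - 0) < \<epsilon>"
      by eventually_elim simp
  qed
qed

section \<open>The test functions\<close>

lemma parity_derivative:
  fixes f f' :: "real \<Rightarrow> complex"
  assumes "\<And>x. (f has_vector_derivative f' x) (at x)" "\<And>s. f (- s) = c * f s"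
  shows "f' (- s) = - c * f' s"
proof -
  have "((\<lambda>s. f (0 + (-1) * s)) has_vector_derivative (-1) *\<^sub>R f' (0 + (-1) * s)) (at s)"
    by (rule vector_derivative_affine[OF assms(1)])
  then have "((\<lambda>s. c * f s) has_vector_derivative - f' (- s)) (at s)" using assms(2) by simp
  moreover have "((\<lambda>s. c * f s) has_vector_derivative c * f' s) (at s)"
    by (rule has_vector_derivative_mult_right[OF assms(1)])
  ultimately have "- f' (- s) = c * f' s" by (rule vector_derivative_unique_at)
  then show ?thesis by (metis minus_minus mult_minus_left)
qed

lemma constant_on_interval:
  fixes f :: "real \<Rightarrow> complex"
  assumes "\<And>x. (f has_vector_derivative f' x) (at x)" "\<And>x. a < x \<Longrightarrow> x < b \<Longrightarrow> f' x = 0"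
    and "p \<in> {a..b}" "q \<in> {a..b}"
  shows "f p = f q"
proof -
  have *: "f p = f q" if "a \<le> p" "p < q" "q \<le> b" for p q
  proof -
    have "(f' has_integral (f q - f p)) {p..q}"
      using that by (intro fundamental_theorem_of_calculus) (auto intro: has_vector_derivative_at_within assms(1))
    moreover have "(f' has_integral 0) {p..q}"
      by (rule has_integral_spike_finite[of "{p, q}" _ _ "\<lambda>_. 0"]) (use assms(2) that in auto)
    ultimately have "f q - f p = 0" by (rule has_integral_unique)
    then show ?thesis by simp
  qed
  consider "p < q" | "p = q" | "q < p" by linarith
  then show ?thesis
  proof cases
    case 1 then show ?thesis using assms by (intro *) auto
  next
    case 2 then show ?thesis by simp
  next
    case 3 then show ?thesis using assms by (intro *[symmetric]) auto
  qed
qed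

text \<open>With the exponential taken out, this is \<open>(cut'' + 2 i k cut') / s\<close> for the
  outer cut-off of the profile: the commutator of the Helmholtz operator with that cut-off. The
  argument \<open>2 / L * s - 3\<close> runs through \<open>[-1, 1]\<close> on the shell.\<close>

definition far :: "real \<Rightarrow> (real \<Rightarrow> complex) \<Rightarrow> (real \<Rightarrow> complex) \<Rightarrow> real \<Rightarrow> real \<Rightarrow> complex" where
  "far k K1 K2 L s = - (of_real (2 / L^2) * K2 (2 / L * s - 3) + \<i> * of_real (2 * k / L) * K1 (2 / L * s - 3)) / of_real s"

text \<open>For \<open>s > 0\<close> this is the Helmholtz operator applied to
  \<open>K0 (s / \<eta>) * cos (k * s) / s\<close> with \<open>K0'' = K2\<close>; the sine part of
  the profile is annihilated. In both definitions division by zero gives the value \<open>0\<close>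
  at \<open>s = 0\<close>.\<close>

definition near :: "real \<Rightarrow> (real \<Rightarrow> complex) \<Rightarrow> (real \<Rightarrow> complex) \<Rightarrow> real \<Rightarrow> real \<Rightarrow> complex" where
  "near k K1 K2 \<eta> s = (K2 (s / \<eta>) / of_real (\<eta>^2) * of_real (cos (k * s)) -
     of_real (2 * k / \<eta>) * K1 (s / \<eta>) * of_real (sin (k * s))) / of_real s"

text \<open>The odd profile \<open>a(s) = f(s) - f(-s)\<close> is \<open>cut(s) (K0(s/\<eta>) cos ks + i sin ks)\<close>, with the even
  cut-off \<open>cut\<close> defined in the proof. It equals
  \<open>exp (i k s)\<close> for \<open>\<eta> \<le> s \<le> L\<close>, where the wave generated by \<open>f\<close> travels in one direction only.\<close>

lemma profile_exists:
  fixes K0 K1 K2 :: "real \<Rightarrow> complex"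
  assumes pos: "k > 0" "0 < \<eta>" "\<eta> \<le> L"
    and K: "smooth K0" "\<And>s. (K0 has_vector_derivative K1 s) (at s)" "\<And>s. (K1 has_vector_derivative K2 s) (at s)"
    and odd: "\<And>s. K0 (- s) = - K0 s" and one: "\<And>s. s \<ge> 1 \<Longrightarrow> K0 s = 1"
    and zero: "\<And>s. \<bar>s\<bar> \<ge> 1 \<Longrightarrow> K1 s = 0 \<and> K2 s = 0"
  obtains f g g' where "smooth f" "\<And>s. (f has_vector_derivative g s) (at s)" "\<And>s. (g has_vector_derivative g' s) (at s)"
    "\<And>s. \<bar>s\<bar> > 2 * L \<Longrightarrow> f s = 0"
    "\<And>s. g s - g (- s) = \<i> * of_real k * (f s - f (- s))"
    "\<And>p q. p \<in> {\<eta>..L} \<Longrightarrow> q \<in> {\<eta>..L} \<Longrightarrow> f p - f (- q) = exp (\<i> * of_real (k * p))"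
    "\<And>s. s > 0 \<Longrightarrow> ((g' s - g' (- s)) + of_real (k^2) * (f s - f (- s))) / of_real s =
       near k K1 K2 \<eta> s + far k K1 K2 L s * exp (\<i> * of_real (k * s))"
proof -
  have L: "L > 0" using pos by simp
  have smK: "smooth K1" "smooth K2" using smooth_vector_derivative K by blast+
  have zero': "K1 s = 0" "K2 s = 0" if "s \<ge> 1 \<or> s \<le> -1" for s
    using zero[of s] that by auto
  have mone: "K0 s = -1" if "s \<le> -1" for s using one[of "- s"] odd[of s] that by (metis le_minus_iff minus_minus)
  have par: "K1 (- s) = K1 s" "K2 (- s) = - K2 s" for s
  proof -
    show K1: "K1 (- s) = K1 s" for s using parity_derivative[OF K(2), of "-1" s] odd by simp
    show "K2 (- s) = - K2 s" using parity_derivative[OF K(3), of 1 s] K1 by simp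
  qed
  define h where "h = 1 / complex_of_real 2"
  \<comment> \<open>Two shifted steps with transitions on \<open>[-2 * L, -L]\<close> and
    \<open>[L, 2 * L]\<close>: half their difference is \<open>1\<close> between the transitions and
    \<open>0\<close> outside.\<close>
  define cut where "cut = (\<lambda>s. h * (K0 (3 + 2 / L * s) - K0 (- 3 + 2 / L * s)))"
  define cut1 where "cut1 = (\<lambda>s. of_real (1 / L) * (K1 (3 + 2 / L * s) - K1 (- 3 + 2 / L * s)))"
  define cut2 where "cut2 = (\<lambda>s. of_real (2 / L^2) * (K2 (3 + 2 / L * s) - K2 (- 3 + 2 / L * s)))"
  define co where "co = (\<lambda>s. complex_of_real (cos (k * s)))"
  define si where "si = (\<lambda>s. complex_of_real (sin (k * s)))"
  \<comment> \<open>For \<open>s \<ge> \<eta>\<close> the step is \<open>1\<close> and this is the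
    exponential. An odd step in place of the constant \<open>1\<close> makes \<open>b\<close> odd,
    as \<open>f(s) - f(-s)\<close> must be, at the price of a defect confined to
    \<open>\<bar>s\<bar> \<le> \<eta>\<close>.\<close>
  define b where "b = (\<lambda>s. K0 (0 + 1 / \<eta> * s) * co s + \<i> * si s)"
  define b1 where "b1 = (\<lambda>s. of_real (1 / \<eta>) * K1 (0 + 1 / \<eta> * s) * co s - of_real k * K0 (0 + 1 / \<eta> * s) * si s + \<i> * of_real k * co s)"
  define b2 where "b2 = (\<lambda>s. of_real (1 / \<eta>^2) * K2 (0 + 1 / \<eta> * s) * co s - of_real (2 * k / \<eta>) * K1 (0 + 1 / \<eta> * s) * si s
     - of_real (k^2) * K0 (0 + 1 / \<eta> * s) * co s - \<i> * of_real (k^2) * si s)"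
  define a where "a = (\<lambda>s. cut s * b s)"
  define a1 where "a1 = (\<lambda>s. cut s * b1 s + cut1 s * b s)"
  define a2 where "a2 = (\<lambda>s. cut s * b2 s + 2 * cut1 s * b1 s + cut2 s * b s)"
  have dco: "(co has_vector_derivative - (of_real k * si s)) (at s)" for s
    unfolding co_def si_def
    by (rule has_vector_derivative_eq_rhs[OF has_vector_derivative_of_real[of _ "- k * sin (k * s)"]]) (auto intro!: derivative_eq_intros)
  have dsi: "(si has_vector_derivative (of_real k * co s)) (at s)" for s
    unfolding co_def si_def
    by (rule has_vector_derivative_eq_rhs[OF has_vector_derivative_of_real[of _ "k * cos (k * s)"]]) (auto intro!: derivative_eq_intros)
  have dK: "((\<lambda>s. K0 (c + m * s)) has_vector_derivative of_real m * K1 (c + m * s)) (at s)"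
    "((\<lambda>s. K1 (c + m * s)) has_vector_derivative of_real m * K2 (c + m * s)) (at s)" for c m s
    using vector_derivative_affine[OF K(2)] vector_derivative_affine[OF K(3)] by (simp_all add: scaleR_conv_of_real)
  note di = has_vector_derivative_add has_vector_derivative_diff has_vector_derivative_mult has_vector_derivative_mult_right dK dco dsi
  have dcut: "(cut has_vector_derivative cut1 s) (at s)" for s
  proof -
    have "(cut has_vector_derivative h * (of_real (2 / L) * K1 (3 + 2 / L * s) - of_real (2 / L) * K1 (- 3 + 2 / L * s))) (at s)"
      unfolding cut_def by (intro di)
    then show ?thesis by (rule has_vector_derivative_eq_rhs) (simp add: cut1_def h_def algebra_simps)
  qed
  have dcut1: "(cut1 has_vector_derivative cut2 s) (at s)" for s
  proof -
    have "(cut1 has_vector_derivative of_real (1 / L) * (of_real (2 / L) * K2 (3 + 2 / L * s) - of_real (2 / L) * K2 (- 3 + 2 / L * s))) (at s)"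
      unfolding cut1_def by (intro di)
    then show ?thesis by (rule has_vector_derivative_eq_rhs) (simp add: cut2_def power2_eq_square diff_divide_distrib right_diff_distrib)
  qed
  have db: "(b has_vector_derivative b1 s) (at s)" for s
  proof -
    have "(b has_vector_derivative (K0 (0 + 1 / \<eta> * s) * (- (of_real k * si s)) + of_real (1 / \<eta>) * K1 (0 + 1 / \<eta> * s) * co s) + \<i> * (of_real k * co s)) (at s)"
      unfolding b_def by (intro di)
    then show ?thesis by (rule has_vector_derivative_eq_rhs) (simp add: b1_def algebra_simps)
  qed
  have db1: "(b1 has_vector_derivative b2 s) (at s)" for s
  proof -
    have "(b1 has_vector_derivative
        ((of_real (1 / \<eta>) * K1 (0 + 1 / \<eta> * s)) * (- (of_real k * si s)) + (of_real (1 / \<eta>) * (of_real (1 / \<eta>) * K2 (0 + 1 / \<eta> * s))) * co s)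
        - ((of_real k * K0 (0 + 1 / \<eta> * s)) * (of_real k * co s) + (of_real k * (of_real (1 / \<eta>) * K1 (0 + 1 / \<eta> * s))) * si s)
        + \<i> * of_real k * (- (of_real k * si s))) (at s)"
      unfolding b1_def by (intro di)
    then show ?thesis
      by (rule has_vector_derivative_eq_rhs) (use pos in \<open>simp add: b2_def field_simps power2_eq_square\<close>)
  qed
  have da: "(a has_vector_derivative a1 s) (at s)" for s
    unfolding a_def a1_def by (intro has_vector_derivative_mult dcut db)
  have da1: "(a1 has_vector_derivative a2 s) (at s)" for s
  proof -
    have "(a1 has_vector_derivative (cut s * b2 s + cut1 s * b1 s) + (cut1 s * b1 s + cut2 s * b s)) (at s)"
      unfolding a1_def by (intro has_vector_derivative_add has_vector_derivative_mult dcut dcut1 db db1)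
    then show ?thesis by (rule has_vector_derivative_eq_rhs) (simp add: a2_def algebra_simps)
  qed
  have sma: "smooth a"
  proof -
    have aff: "smooth (\<lambda>s. K0 (c + m * s))" for c m
      using smooth_affine[OF K(1), of m c] by (simp add: add.commute)
    have "smooth (\<lambda>s. complex_of_real (cos (k * s + 0)))" "smooth (\<lambda>s. complex_of_real (sin (k * s + 0)))"
      by (rule smooth_affine[OF smooth_cos_sin(1)], rule smooth_affine[OF smooth_cos_sin(2)])
    then have "smooth co" "smooth si" unfolding co_def si_def by simp_all
    then show ?thesis unfolding a_def cut_def b_def by (intro smooth_mult smooth_add smooth_diff smooth_const aff)
  qed
  have cuteven: "cut (- s) = cut s" for s
  proof -
    have e: "3 + 2 / L * (- s) = - (- 3 + 2 / L * s)" "- 3 + 2 / L * (- s) = - (3 + 2 / L * s)" by simp_all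
    show ?thesis unfolding cut_def e odd by simp
  qed
  have bodd: "b (- s) = - b s" for s
    using odd[of "1 / \<eta> * s"] by (simp add: b_def co_def si_def)
  have aodd: "a (- s) = - a s" for s by (simp add: a_def cuteven bodd)
  have a1even: "a1 (- s) = a1 s" for s using parity_derivative[OF da, of "-1" s] aodd by simp
  have a2odd: "a2 (- s) = - a2 s" for s using parity_derivative[OF da1, of 1 s] a1even by simp
  have a0: "a s = 0" if "\<bar>s\<bar> \<ge> 2 * L" for s
  proof -
    have "cut s = 0"
    proof (cases "s \<ge> 0")
      case True
      then have "2 / L * s \<ge> 4" using that L by (simp add: field_simps)
      then show ?thesis using one by (simp add: cut_def)
    next
      case False
      then have "2 / L * s \<le> -4" using that L by (simp add: field_simps)
      then show ?thesis using mone by (simp add: cut_def)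
    qed
    then show ?thesis by (simp add: a_def)
  qed
  obtain A where A0: "A 0 = 0" and A: "\<And>s. (A has_vector_derivative a s) (at s)"
    using antiderivative_real[OF smooth_continuous[OF sma]] by blast
  have Aeven: "A (- s) = A s" for s
  proof -
    have "((\<lambda>s. A s - A (0 + (-1) * s)) has_vector_derivative (a s - (-1) *\<^sub>R a (0 + (-1) * s))) (at s)" for s
      by (intro has_vector_derivative_diff A vector_derivative_affine[OF A])
    then have "((\<lambda>s. A s - A (- s)) has_vector_derivative 0) (at s)" for s using aodd by simp
    from constant_on_interval[OF this, of "- \<bar>s\<bar>" "\<bar>s\<bar>" s 0]
    have "A s - A (- s) = A 0 - A (- 0)" by (simp add: abs_le_iff[of s "\<bar>s\<bar>", simplified])
    then show ?thesis by simp
  qed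
  have Ainf: "A s = A (2 * L)" if "\<bar>s\<bar> \<ge> 2 * L" for s
  proof -
    have "A \<bar>s\<bar> = A (2 * L)"
      by (rule constant_on_interval[OF A, of "2 * L" "\<bar>s\<bar>"]) (use that a0 L in auto)
    then show ?thesis using Aeven[of s] by (cases "s \<ge> 0") auto
  qed
  \<comment> \<open>The odd part \<open>a / 2\<close> fixes \<open>f(s) - f(-s)\<close>. The even
    part is chosen so that \<open>f'\<close> at \<open>-s\<close> is half of
    \<open>a'(s) - i k a(s)\<close>, which vanishes where \<open>a\<close> is the exponential. Since
    \<open>A\<close> is even and constant beyond \<open>2 * L\<close>, subtracting
    \<open>A (2 * L)\<close> makes \<open>f\<close> compactly supported.\<close>
  define f where "f = (\<lambda>s. h * a s + \<i> * of_real (k / 2) * (A s - A (2 * L)))"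
  define g where "g = (\<lambda>s. h * a1 s + \<i> * of_real (k / 2) * a s)"
  define g' where "g' = (\<lambda>s. h * a2 s + \<i> * of_real (k / 2) * a1 s)"
  have df: "(f has_vector_derivative g s) (at s)" for s
  proof -
    have "(f has_vector_derivative h * a1 s + \<i> * of_real (k / 2) * (a s - 0)) (at s)"
      unfolding f_def by (intro has_vector_derivative_add has_vector_derivative_mult_right has_vector_derivative_diff
        da A has_vector_derivative_const)
    then show ?thesis by (simp add: g_def)
  qed
  have dg: "(g has_vector_derivative g' s) (at s)" for s
    unfolding g_def g'_def by (intro has_vector_derivative_add has_vector_derivative_mult_right da da1)
  have smf: "smooth f"
  proof -
    have "smooth A" using A sma by (rule smoothI)
    then show ?thesis unfolding f_def by (intro smooth_add smooth_mult smooth_diff smooth_const sma)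
  qed
  have fa: "f s - f (- s) = a s" for s
    by (simp add: f_def Aeven aodd h_def)
  have ga: "g s - g (- s) = \<i> * of_real k * a s" for s
    by (simp add: g_def a1even aodd algebra_simps flip: of_real_add)
  have cut1: "cut s = 1" if "\<bar>s\<bar> \<le> L" for s
  proof -
    have "2 / L * s \<ge> -2" "2 / L * s \<le> 2" using that L by (auto simp: field_simps)
    then show ?thesis using one[of "3 + 2 / L * s"] mone[of "- 3 + 2 / L * s"] by (simp add: cut_def h_def)
  qed
  have exp_eq: "exp (\<i> * of_real (k * s)) = co s + \<i> * si s" for s
    unfolding co_def si_def cis_conv_exp[symmetric] by (simp add: complex_eq_iff)
  have bexp: "b s = exp (\<i> * of_real (k * s))" "b1 s = \<i> * of_real k * exp (\<i> * of_real (k * s))" if "s \<ge> \<eta>" for s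
  proof -
    have "1 / \<eta> * s \<ge> 1" using that pos by (simp add: field_simps)
    then have "K0 (0 + 1 / \<eta> * s) = 1" "K1 (0 + 1 / \<eta> * s) = 0" using one[of "1 / \<eta> * s"] zero'[of "1 / \<eta> * s"] by simp_all
    then show "b s = exp (\<i> * of_real (k * s))" "b1 s = \<i> * of_real k * exp (\<i> * of_real (k * s))"
      unfolding exp_eq b_def b1_def by (simp_all add: algebra_simps)
  qed
  have aexp: "a p = exp (\<i> * of_real (k * p))" if "p \<in> {\<eta>..L}" for p
    using cut1[of p] bexp(1)[of p] that pos by (simp add: a_def)
  show ?thesis
  proof (rule that[OF smf df dg])
    show "f s = 0" if "\<bar>s\<bar> > 2 * L" for s using a0[of s] Ainf[of s] that by (simp add: f_def)
    show "g s - g (- s) = \<i> * of_real k * (f s - f (- s))" for s unfolding fa ga ..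
    show "f p - f (- q) = exp (\<i> * of_real (k * p))" if p: "p \<in> {\<eta>..L}" and q: "q \<in> {\<eta>..L}" for p q
    proof -
      have "f (0 + (-1) * p) = f (0 + (-1) * q)"
      proof (rule constant_on_interval[OF vector_derivative_affine[OF df] _ p q])
        fix s assume s: "\<eta> < s" "s < L"
        have "cut1 s = 0"
        proof -
          have "2 / L * s \<ge> 0" "2 / L * s \<le> 2" using s pos by (auto simp: field_simps)
          then show ?thesis using zero'[of "3 + 2 / L * s"] zero'[of "- 3 + 2 / L * s"] by (simp add: cut1_def)
        qed
        then have "a1 s = \<i> * of_real k * a s"
          using cut1[of s] bexp[of s] s pos by (simp add: a1_def a_def)
        then show "(-1) *\<^sub>R g (0 + (-1) * s) = 0"
          by (simp add: g_def a1even aodd h_def)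
      qed
      then show ?thesis using fa[of p] aexp[OF p] by simp
    qed
    show "((g' s - g' (- s)) + of_real (k^2) * (f s - f (- s))) / of_real s =
       near k K1 K2 \<eta> s + far k K1 K2 L s * exp (\<i> * of_real (k * s))" if s: "s > 0" for s
    proof -
      have g'a: "g' s - g' (- s) = a2 s" by (simp add: g'_def a1even a2odd h_def)
      have bb: "b2 s + of_real (k^2) * b s = of_real (1 / \<eta>^2) * K2 (1 / \<eta> * s) * co s - of_real (2 * k / \<eta>) * K1 (1 / \<eta> * s) * si s"
        by (simp add: b2_def b_def algebra_simps)
      \<comment> \<open>The defect of \<open>b\<close> vanishes for \<open>s \<ge> \<eta>\<close>,
        and the cut-off is \<open>1\<close> up to \<open>L \<ge> \<eta>\<close>, so the two do not
        interact.\<close>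
      have 1: "cut s * (b2 s + of_real (k^2) * b s) = b2 s + of_real (k^2) * b s"
      proof (cases "s \<le> L")
        case True
        then show ?thesis using cut1[of s] s by simp
      next
        case False
        then have "1 / \<eta> * s \<ge> 1" using pos by (simp add: field_simps)
        then have "b2 s + of_real (k^2) * b s = 0" unfolding bb using zero'[of "1 / \<eta> * s"] by simp
        then show ?thesis by simp
      qed
      have "2 / L * s > 0" using s L by simp
      then have z3: "K1 (3 + 2 / L * s) = 0" "K2 (3 + 2 / L * s) = 0" using zero'[of "3 + 2 / L * s"] by simp_all
      have c1: "cut1 s = - of_real (1 / L) * K1 (2 / L * s - 3)" "cut2 s = - of_real (2 / L^2) * K2 (2 / L * s - 3)"
        using z3 by (simp_all add: cut1_def cut2_def)
      \<comment> \<open>Conversely, for positive \<open>s\<close> the derivatives of the cut-off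
        live where \<open>b\<close> is already the exponential.\<close>
      have 2: "2 * cut1 s * b1 s + cut2 s * b s = (2 * \<i> * of_real k * cut1 s + cut2 s) * exp (\<i> * of_real (k * s))"
      proof (cases "s \<le> L")
        case True
        then have "2 / L * s \<le> 2" using L by (simp add: field_simps)
        then have "K1 (2 / L * s - 3) = 0" "K2 (2 / L * s - 3) = 0" using zero'[of "2 / L * s - 3"] by simp_all
        then show ?thesis unfolding c1 by simp
      next
        case False
        then show ?thesis using bexp[of s] pos by (simp add: algebra_simps)
      qed
      have "(g' s - g' (- s)) + of_real (k^2) * (f s - f (- s)) = cut s * (b2 s + of_real (k^2) * b s) + (2 * cut1 s * b1 s + cut2 s * b s)"
        unfolding g'a fa a2_def a_def by (simp add: algebra_simps)
      also have "\<dots> = (of_real (1 / \<eta>^2) * K2 (1 / \<eta> * s) * co s - of_real (2 * k / \<eta>) * K1 (1 / \<eta> * s) * si s)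
          + (2 * \<i> * of_real k * cut1 s + cut2 s) * exp (\<i> * of_real (k * s))"
        unfolding 1 2 unfolding bb ..
      finally have E: "(g' s - g' (- s)) + of_real (k^2) * (f s - f (- s)) = \<dots>" .
      show ?thesis
        unfolding E c1 near_def far_def co_def si_def
        by (simp add: add_divide_distrib diff_divide_distrib algebra_simps)
    qed
  qed
qed

section \<open>Separating the shell from the neighbourhood of the point\<close>

lemma outgoing_radiation_add:
  assumes "outgoing_radiation k w" "outgoing_radiation k w'"
  shows "outgoing_radiation k (\<lambda>x. w x + w' x)"
proof -
  have d: "\<forall>\<^sub>F r in at_top. \<forall>\<omega>\<in>sphere 0 1. (\<lambda>s::real. w (s *\<^sub>R \<omega>)) differentiable (at r) \<and>
     (\<lambda>s::real. w' (s *\<^sub>R \<omega>)) differentiable (at r)"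
    using assms unfolding outgoing_radiation_def by (auto elim: eventually_elim2)
  have "\<forall>\<^sub>F r in at_top. \<forall>\<omega>\<in>sphere 0 1. (\<lambda>s::real. w (s *\<^sub>R \<omega>) + w' (s *\<^sub>R \<omega>)) differentiable (at r)"
    using d by eventually_elim (auto intro: differentiable_add)
  moreover have "uniform_limit (sphere 0 1)
       (\<lambda>r \<omega>. complex_of_real r *
          (vector_derivative (\<lambda>s. w (s *\<^sub>R \<omega>) + w' (s *\<^sub>R \<omega>)) (at r) - \<i> * complex_of_real k * (w (r *\<^sub>R \<omega>) + w' (r *\<^sub>R \<omega>))))
       (\<lambda>\<omega>. 0) at_top"
  proof (rule uniform_limit_cong[THEN iffD1])
    show "uniform_limit (sphere 0 1)
       (\<lambda>r \<omega>. complex_of_real r * (vector_derivative (\<lambda>s. w (s *\<^sub>R \<omega>)) (at r) - \<i> * complex_of_real k * w (r *\<^sub>R \<omega>)) +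
          complex_of_real r * (vector_derivative (\<lambda>s. w' (s *\<^sub>R \<omega>)) (at r) - \<i> * complex_of_real k * w' (r *\<^sub>R \<omega>)))
       (\<lambda>\<omega>. 0 + 0) at_top"
      using assms unfolding outgoing_radiation_def by (intro uniform_limit_add) blast+
    show "\<forall>\<^sub>F r in at_top. \<forall>\<omega>\<in>sphere 0 1.
        complex_of_real r * (vector_derivative (\<lambda>s. w (s *\<^sub>R \<omega>)) (at r) - \<i> * complex_of_real k * w (r *\<^sub>R \<omega>)) +
          complex_of_real r * (vector_derivative (\<lambda>s. w' (s *\<^sub>R \<omega>)) (at r) - \<i> * complex_of_real k * w' (r *\<^sub>R \<omega>))
      = complex_of_real r *
          (vector_derivative (\<lambda>s. w (s *\<^sub>R \<omega>) + w' (s *\<^sub>R \<omega>)) (at r) - \<i> * complex_of_real k * (w (r *\<^sub>R \<omega>) + w' (r *\<^sub>R \<omega>)))"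
      using d by eventually_elim (simp add: vector_derivative_add_at algebra_simps)
  qed simp
  ultimately show ?thesis unfolding outgoing_radiation_def by blast
qed

text \<open>As a function of \<open>s \<ge> L\<close> the amplitude has size \<open>L^-2\<close>,
  and each derivative gains a factor \<open>1 / L\<close>, whether it falls on the scaled step or on
  \<open>1 / s\<close>. These are the bounds asked for by \<open>oscillatory_decay\<close>.\<close>

lemma far_decay:
  fixes W :: "real^3 \<Rightarrow> complex" and x0 :: "real^3" and K0 K1 K2 :: "real \<Rightarrow> complex"
  assumes k: "k > 0" and W: "continuous_on UNIV W" "outgoing_radiation k W"
    and K: "smooth K0" "\<And>s. (K0 has_vector_derivative K1 s) (at s)" "\<And>s. (K1 has_vector_derivative K2 s) (at s)"
    and zero: "\<And>s. \<bar>s\<bar> \<ge> 1 \<Longrightarrow> K1 s = 0 \<and> K2 s = 0"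
  shows "((\<lambda>L. LINT x|lebesgue. W x * (far k K1 K2 L (norm (x - x0)) * exp (\<i> * of_real (k * norm (x - x0))))) \<longlongrightarrow> 0) at_top"
proof -
  have smK: "smooth K1" "smooth K2" using smooth_vector_derivative K by blast+
  obtain K3 where K3: "\<And>s. (K2 has_vector_derivative K3 s) (at s)" "smooth K3" using smooth_deriv[OF smK(2)] by metis
  obtain K4 where K4: "\<And>s. (K3 has_vector_derivative K4 s) (at s)" "smooth K4" using smooth_deriv[OF K3(2)] by metis
  have z1: "K1 s = 0" "K2 s = 0" if "\<bar>s\<bar> > 1" for s using zero[of s] that by auto
  have z3: "K3 s = 0" if "\<bar>s\<bar> > 1" for s using support_derivative[OF K3(1) z1(2)] that by blast
  have z4: "K4 s = 0" if "\<bar>s\<bar> > 1" for s using support_derivative[OF K4(1) z3] that by blast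
  obtain B1 where B1: "B1 \<ge> 0" "\<And>s. norm (K1 s) \<le> B1" using compact_support_bounded[OF smK(1) z1(1)] by blast
  obtain B2 where B2: "B2 \<ge> 0" "\<And>s. norm (K2 s) \<le> B2" using compact_support_bounded[OF smK(2) z1(2)] by blast
  obtain B3 where B3: "B3 \<ge> 0" "\<And>s. norm (K3 s) \<le> B3" using compact_support_bounded[OF K3(2) z3] by blast
  obtain B4 where B4: "B4 \<ge> 0" "\<And>s. norm (K4 s) \<le> B4" using compact_support_bounded[OF K4(2) z4] by blast
  define B where "B = B1 + B2 + B3 + B4"
  have B0: "B \<ge> 0" and B: "norm (K1 s) \<le> B" "norm (K2 s) \<le> B" "norm (K3 s) \<le> B" "norm (K4 s) \<le> B" for s
    using B1(1) B2(1) B3(1) B4(1) B1(2)[of s] B2(2)[of s] B3(2)[of s] B4(2)[of s] unfolding B_def by linarith+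
  define C where "C = (1 + k) * B"
  have C0: "C \<ge> 0" using k B0 by (simp add: C_def)
  define M where "M = (\<lambda>L s. of_real (2 / L^2) * K2 (- 3 + 2 / L * s) + \<i> * of_real (2 * k / L) * K1 (- 3 + 2 / L * s))"
  define M1 where "M1 = (\<lambda>L s. of_real (4 / L^3) * K3 (- 3 + 2 / L * s) + \<i> * of_real (4 * k / L^2) * K2 (- 3 + 2 / L * s))"
  define M2 where "M2 = (\<lambda>L s. of_real (8 / L^4) * K4 (- 3 + 2 / L * s) + \<i> * of_real (8 * k / L^3) * K3 (- 3 + 2 / L * s))"
  have dK: "((\<lambda>s. f (- 3 + 2 / L * s)) has_vector_derivative of_real (2 / L) * f' (- 3 + 2 / L * s)) (at s)"
    if "\<And>s. (f has_vector_derivative f' s) (at s)" for f f' :: "real \<Rightarrow> complex" and L s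
    using vector_derivative_affine[OF that, of "-3" "2 / L" s UNIV] by (simp add: scaleR_conv_of_real)
  have dM: "(M L has_vector_derivative M1 L s) (at s)" for L s
  proof -
    have "(M L has_vector_derivative of_real (2 / L^2) * (of_real (2 / L) * K3 (- 3 + 2 / L * s)) +
        \<i> * of_real (2 * k / L) * (of_real (2 / L) * K2 (- 3 + 2 / L * s))) (at s)"
      unfolding M_def by (intro has_vector_derivative_add has_vector_derivative_mult_right dK K3 K)
    then show ?thesis
      by (rule has_vector_derivative_eq_rhs) (simp add: M1_def power2_eq_square power3_eq_cube)
  qed
  have dM1: "(M1 L has_vector_derivative M2 L s) (at s)" for L s
  proof -
    have "(M1 L has_vector_derivative of_real (4 / L^3) * (of_real (2 / L) * K4 (- 3 + 2 / L * s)) +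
        \<i> * of_real (4 * k / L^2) * (of_real (2 / L) * K3 (- 3 + 2 / L * s))) (at s)"
      unfolding M1_def by (intro has_vector_derivative_add has_vector_derivative_mult_right dK K3 K4)
    then show ?thesis
      by (rule has_vector_derivative_eq_rhs) (simp add: M2_def power2_eq_square power3_eq_cube power4_eq_xxxx)
  qed
  \<comment> \<open>The first term carries one more power of \<open>1 / L\<close>; since
    \<open>L \<ge> 1\<close>, both fit under one bound.\<close>
  have bM: "norm (of_real (c / L ^ Suc n) * X + \<i> * of_real (c * k / L ^ n) * Y) \<le> c * C / L ^ n"
    if "L \<ge> 1" "c \<ge> 0" "norm X \<le> B" "norm Y \<le> B" for c L n and X Y :: complex
  proof -
    have "norm (of_real (c / L ^ Suc n) * X) \<le> (c / L ^ n) * B"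
      unfolding norm_mult norm_of_real
    proof (intro mult_mono that)
      have "L ^ n \<le> L ^ Suc n" using that by (intro power_increasing) auto
      then show "\<bar>c / L ^ Suc n\<bar> \<le> c / L ^ n" using that by (simp add: divide_left_mono)
    qed (use that in auto)
    moreover have "norm (\<i> * of_real (c * k / L ^ n) * Y) \<le> (c * k / L ^ n) * B"
      unfolding norm_mult norm_of_real norm_ii using that k by (intro mult_mono) auto
    ultimately have "norm (of_real (c / L ^ Suc n) * X + \<i> * of_real (c * k / L ^ n) * Y) \<le> (c / L ^ n) * B + (c * k / L ^ n) * B"
      by (rule norm_triangle_mono)
    also have "\<dots> = c * C / L ^ n" by (simp add: C_def algebra_simps add_divide_distrib)
    finally show ?thesis .
  qed
  have b: "norm (M L s) \<le> 2 * C / L" "norm (M1 L s) \<le> 4 * C / L^2" "norm (M2 L s) \<le> 8 * C / L^3" if "L \<ge> 1" for L s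
    using bM[OF that _ B(2,1), of 2 1] bM[OF that _ B(3,2), of 4 2] bM[OF that _ B(4,3), of 8 3]
    by (simp_all add: M_def M1_def M2_def numeral_2_eq_2 numeral_3_eq_3 eval_nat_numeral)
  have zM: "M L s = 0 \<and> M1 L s = 0 \<and> M2 L s = 0" if "L \<ge> 1" "s < L \<or> s > 2 * L" for L s
  proof -
    have "2 / L * s < 2 \<or> 2 / L * s > 4" using that by (auto simp: field_simps)
    then have "\<bar>- 3 + 2 / L * s\<bar> > 1" by linarith
    then show ?thesis using z1 z3 z4 unfolding M_def M1_def M2_def by simp
  qed
  define q where "q = (\<lambda>L s. M L s * of_real (- 1 / s))"
  define q1 where "q1 = (\<lambda>L s. M L s * of_real (1 / s^2) + M1 L s * of_real (- 1 / s))"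
  define q2 where "q2 = (\<lambda>L s. M L s * of_real (- 2 / s^3) + 2 * M1 L s * of_real (1 / s^2) + M2 L s * of_real (- 1 / s))"
  have inv: "((\<lambda>s. complex_of_real (- 1 / s)) has_vector_derivative of_real (1 / s^2)) (at s)"
    "((\<lambda>s. complex_of_real (1 / s^2)) has_vector_derivative of_real (- 2 / s^3)) (at s)" if "s > 0" for s
  proof -
    have r: "((\<lambda>s. - 1 / s) has_real_derivative 1 / s^2) (at s)" "((\<lambda>s. 1 / s^2) has_real_derivative - 2 / s^3) (at s)"
      using that by (auto intro!: derivative_eq_intros simp: field_simps power2_eq_square power3_eq_cube)
    show "((\<lambda>s. complex_of_real (- 1 / s)) has_vector_derivative of_real (1 / s^2)) (at s)"
      by (rule has_vector_derivative_of_real[OF r(1)])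
    show "((\<lambda>s. complex_of_real (1 / s^2)) has_vector_derivative of_real (- 2 / s^3)) (at s)"
      by (rule has_vector_derivative_of_real[OF r(2)])
  qed
  have feq: "far k K1 K2 L s = q L s" for L s
    by (simp add: far_def q_def M_def add_divide_distrib diff_divide_distrib)
  have cM2: "continuous_on A (M2 L)" "continuous_on A (M1 L)" "continuous_on A (M L)" if "L \<ge> 1" for A L
  proof -
    have c: "continuous_on A (\<lambda>s. f (- 3 + 2 / L * s))" if "smooth f" for f
      by (rule continuous_on_compose2[OF smooth_continuous[OF that, of UNIV]])
        (use \<open>L \<ge> 1\<close> in \<open>auto intro!: continuous_intros\<close>)
    show "continuous_on A (M2 L)" "continuous_on A (M1 L)" "continuous_on A (M L)"
      unfolding M2_def M1_def M_def by (intro continuous_intros c K4(2) K3(2) smK)+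
  qed
  have sL: "norm (X * of_real (d / s ^ n)) \<le> \<bar>d\<bar> * E / L ^ n"
    if "L \<ge> 1" "s \<ge> L" "norm X \<le> E" for X :: complex and d s E n L
  proof -
    have "E \<ge> 0" using that(3) norm_ge_zero order_trans by blast
    have "L ^ n \<le> s ^ n" using that by (intro power_mono) auto
    moreover have "L ^ n > 0" using that by simp
    ultimately have "\<bar>d\<bar> / s ^ n \<le> \<bar>d\<bar> / L ^ n" by (intro divide_left_mono) auto
    moreover have "\<bar>d / s ^ n\<bar> = \<bar>d\<bar> / s ^ n" using that by simp
    ultimately have "norm X * \<bar>d / s ^ n\<bar> \<le> E * (\<bar>d\<bar> / L ^ n)" using that \<open>E \<ge> 0\<close> by (intro mult_mono) auto
    then show ?thesis
      unfolding norm_mult norm_of_real by (simp only: times_divide_eq_right mult.commute[of E])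
  qed
  \<comment> \<open>The constant \<open>20\<close> is \<open>4 + 8 + 8\<close>, from the three terms
    of \<open>q2\<close>; it dominates the constants for \<open>q\<close> and
    \<open>q1\<close>.\<close>
  show ?thesis unfolding feq
  proof (rule oscillatory_decay[OF k W, where ?q1.0 = q1 and ?q2.0 = q2 and C = "20 * C"])
    fix L s :: real assume L: "L \<ge> 1" and s: "s > 0"
    show "(q L has_vector_derivative q1 L s) (at s)"
      unfolding q_def q1_def by (intro has_vector_derivative_mult dM inv s)
    have "(q1 L has_vector_derivative (M L s * of_real (- 2 / s^3) + M1 L s * of_real (1 / s^2)) + (M1 L s * of_real (1 / s^2) + M2 L s * of_real (- 1 / s))) (at s)"
      unfolding q1_def by (intro has_vector_derivative_add has_vector_derivative_mult dM dM1 inv s)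
    then show "(q1 L has_vector_derivative q2 L s) (at s)"
      by (rule has_vector_derivative_eq_rhs) (simp add: q2_def)
    show "q L s = 0 \<and> q1 L s = 0 \<and> q2 L s = 0" if "s < L \<or> s > 2 * L"
      using zM[OF L that] by (simp add: q_def q1_def q2_def)
    have all: "norm (q L s) \<le> 20 * C / L^2 \<and> norm (q1 L s) \<le> 20 * C / L^3 \<and> norm (q2 L s) \<le> 20 * C / L^4"
    proof (cases "s < L")
      case True
      have "L > 0" using L by simp
      then show ?thesis using zM[OF L, of s] True C0 by (simp add: q_def q1_def q2_def)
    next
      case False
      then have sl: "s \<ge> L" by simp
      have Lp: "L > 0" using L by simp
      have e: "norm (M L s * of_real (- 1 / s)) \<le> 2 * C / L^2" "norm (M L s * of_real (1 / s^2)) \<le> 2 * C / L^3"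
        "norm (M1 L s * of_real (- 1 / s)) \<le> 4 * C / L^3" "norm (M L s * of_real (- 2 / s^3)) \<le> 4 * C / L^4"
        "norm (M1 L s * of_real (1 / s^2)) \<le> 4 * C / L^4" "norm (M2 L s * of_real (- 1 / s)) \<le> 8 * C / L^4"
        using sL[OF L sl b(1)[OF L, of s], of "-1" 1] sL[OF L sl b(1)[OF L, of s], of 1 2] sL[OF L sl b(2)[OF L, of s], of "-1" 1]
          sL[OF L sl b(1)[OF L, of s], of "-2" 3] sL[OF L sl b(2)[OF L, of s], of 1 2] sL[OF L sl b(3)[OF L, of s], of "-1" 1] Lp
        by (simp_all add: power2_eq_square power3_eq_cube power4_eq_xxxx mult_ac)
      have p: "C / L^2 \<ge> 0" "C / L^3 \<ge> 0" "C / L^4 \<ge> 0" using C0 Lp by simp_all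
      have 0: "norm (q L s) \<le> 20 * C / L^2" using e(1) p(1) unfolding q_def by linarith
      have 1: "norm (q1 L s) \<le> 20 * C / L^3"
        using norm_triangle_mono[OF e(2) e(3)] p(2) unfolding q1_def by linarith
      have "norm (2 * M1 L s * of_real (1 / s^2)) \<le> 8 * C / L^4"
        using e(5) unfolding mult.assoc norm_mult[of 2] by simp
      from norm_triangle_mono[OF norm_triangle_mono[OF e(4) this] e(6)]
      have 2: "norm (q2 L s) \<le> 20 * C / L^4" unfolding q2_def by simp
      show ?thesis using 0 1 2 by blast
    qed
    then show "norm (q L s) \<le> 20 * C / L^2" "norm (q1 L s) \<le> 20 * C / L^3" "norm (q2 L s) \<le> 20 * C / L^4" by blast+
  next
    show "continuous_on {0<..} (q2 L)" if "L \<ge> 1" for L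
      unfolding q2_def by (intro continuous_intros cM2 that) auto
    show "q L 0 = 0" for L by (simp add: q_def)
  qed
qed

lemma AE_neq: "AE x in lebesgue. x \<noteq> (a::'a::euclidean_space)"
  using AE_completion[OF AE_lborel_singleton[of a]] by simp

text \<open>The test function depends on \<open>L\<close>, its part near \<open>x0\<close> does not.
  The two parts cancel for every large \<open>L\<close>, so the decay of the shell part forces the
  other, constant one to be zero.\<close>

lemma near_integral_zero:
  fixes F G w w' :: "real^3 \<Rightarrow> complex" and u u' :: "real \<Rightarrow> real^3 \<Rightarrow> complex" and x0 :: "real^3"
  assumes k: "k > 0" and eps: "\<epsilon> > 0" and T: "T > 0"
    and F: "F \<in> L2" "AE x in lebesgue. x \<notin> cball 0 \<epsilon> \<longrightarrow> F x = 0"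
    and w: "outgoing_solution k F w" and u: "wave_cauchy_solution T F u u'"
    and G: "\<And>x. G x = - exp (- \<i> * complex_of_real (k * T)) * (u' T x + \<i> * complex_of_real k * u T x)"
    and w': "outgoing_solution k G w'"
    and K: "smooth K0" "\<And>s. (K0 has_vector_derivative K1 s) (at s)" "\<And>s. (K1 has_vector_derivative K2 s) (at s)"
    and odd: "\<And>s. K0 (- s) = - K0 s" and one: "\<And>s. s \<ge> 1 \<Longrightarrow> K0 s = 1"
    and zero: "\<And>s. \<bar>s\<bar> \<ge> 1 \<Longrightarrow> K1 s = 0 \<and> K2 s = 0"
    and \<eta>: "\<eta> > 0" "norm x0 \<ge> T + \<epsilon> + \<eta>"
  shows "(LINT x|lebesgue. (w x + w' x) * near k K1 K2 \<eta> (norm (x - x0))) = 0"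
proof -
  define W where "W = (\<lambda>x. w x + w' x)"
  have wc: "continuous_on UNIV w" "continuous_on UNIV w'"
    and eqw: "\<And>\<phi>. test_function UNIV \<phi> \<Longrightarrow> (LINT x|lebesgue. w x * (laplacian \<phi> x + complex_of_real (k\<^sup>2) * \<phi> x)) +
        (LINT x|lebesgue. F x * \<phi> x) = 0"
       "\<And>\<phi>. test_function UNIV \<phi> \<Longrightarrow> (LINT x|lebesgue. w' x * (laplacian \<phi> x + complex_of_real (k\<^sup>2) * \<phi> x)) +
        (LINT x|lebesgue. G x * \<phi> x) = 0"
    using w w' unfolding outgoing_solution_def by blast+
  have W: "continuous_on UNIV W" "outgoing_radiation k W"
    using w w' outgoing_radiation_add unfolding W_def outgoing_solution_def by (auto intro: continuous_intros)
  let ?far = "\<lambda>L x. W x * (far k K1 K2 L (norm (x - x0)) * exp (\<i> * of_real (k * norm (x - x0))))"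
  let ?near = "\<lambda>x. W x * near k K1 K2 \<eta> (norm (x - x0))"
  have smK: "smooth K1" "smooth K2" using smooth_vector_derivative K by blast+
  have Kb: "K1 \<in> borel_measurable borel" "K2 \<in> borel_measurable borel"
    by (intro borel_measurable_continuous_onI smooth_continuous smK)+
  have Wb: "W \<in> borel_measurable borel" by (rule borel_measurable_continuous_onI[OF W(1)])
  have mnear: "?near \<in> borel_measurable lebesgue" and mfar: "\<And>L. ?far L \<in> borel_measurable lebesgue"
    unfolding near_def far_def using Kb Wb by (intro measurable_completion; measurable)+
  have key: "(LINT x|lebesgue. ?far L x) = - (LINT x|lebesgue. ?near x)" if L: "L \<ge> max 1 (norm x0 + \<epsilon> + T)" for L
  proof -
    have L1: "L \<ge> 1" "\<eta> \<le> L" "norm x0 + \<epsilon> + T \<le> L" using L \<eta> eps T by auto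
    obtain f g g1 where f: "smooth f" "\<And>s. (f has_vector_derivative g s) (at s)" "\<And>s. (g has_vector_derivative g1 s) (at s)"
      "\<And>s. \<bar>s\<bar> > 2 * L \<Longrightarrow> f s = 0"
      "\<And>s. g s - g (- s) = \<i> * of_real k * (f s - f (- s))"
      "\<And>p q. p \<in> {\<eta>..L} \<Longrightarrow> q \<in> {\<eta>..L} \<Longrightarrow> f p - f (- q) = exp (\<i> * of_real (k * p))"
      "\<And>s. s > 0 \<Longrightarrow> ((g1 s - g1 (- s)) + of_real (k^2) * (f s - f (- s))) / of_real s =
         near k K1 K2 \<eta> s + far k K1 K2 L s * exp (\<i> * of_real (k * s))"
      using profile_exists[OF k \<eta>(1) L1(2) K odd one zero] by blast
    have sm: "smooth g" "smooth g1" using smooth_vector_derivative f(1-3) by blast+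
    obtain g2 where g2: "\<And>s. (g1 has_vector_derivative g2 s) (at s)" "smooth g2" using smooth_deriv[OF sm(2)] by metis
    have L0: "2 * L \<ge> 0" using L1 by simp
    define \<psi> where "\<psi> = (\<lambda>x. Theta 0 g 0 (x - x0))"
    have test: "test_function UNIV \<psi>"
      unfolding \<psi>_def
    proof (rule theta_alg_test_function[OF theta_alg_Theta0[OF sm(1)], of "cball x0 (2 * L)"])
      show "Theta 0 g 0 (x - x0) = 0" if "x \<notin> cball x0 (2 * L)" for x
        using that by (intro Theta_0_support[OF f(2,4) L0]) (auto simp: dist_norm norm_minus_commute)
    qed auto
    have \<psi>eq: "\<psi> x = (f (norm (x - x0)) - f (- norm (x - x0))) / of_real (norm (x - x0))" if "x \<noteq> x0" for x
      unfolding \<psi>_def using that by (subst Theta_0_eq[OF f(2)]) auto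
    have lap: "laplacian \<psi> x = Theta 0 g2 0 (x - x0)" for x
      using laplacian_Theta[OF sm(1) f(3) g2(1), of 1 0 x0 x] by (simp add: \<psi>_def)
    have near_far: "laplacian \<psi> x + of_real (k\<^sup>2) * \<psi> x =
        near k K1 K2 \<eta> (norm (x - x0)) + far k K1 K2 L (norm (x - x0)) * exp (\<i> * of_real (k * norm (x - x0)))"
      if x: "x \<noteq> x0" for x
    proof -
      have p: "norm (x - x0) > 0" using x by simp
      have "Theta 0 g2 0 (x - x0) = (g1 (norm (x - x0)) - g1 (- norm (x - x0))) / of_real (norm (x - x0))"
        using x by (subst Theta_0_eq[OF g2(1)]) auto
      then show ?thesis
        unfolding lap \<psi>eq[OF x] f(7)[OF p, symmetric] by (simp only: add_divide_distrib times_divide_eq_right)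
    qed
    have c: "continuous_on UNIV (\<lambda>x. laplacian \<psi> x + of_real (k\<^sup>2) * \<psi> x)"
      unfolding lap unfolding \<psi>_def by (intro continuous_intros theta_alg_continuous theta_alg_Theta0 sm g2)
    have supp: "laplacian \<psi> x + of_real (k\<^sup>2) * \<psi> x = 0" if "x \<notin> cball x0 (2 * L)" for x
    proof -
      have "norm (x - x0) > 2 * L + \<bar>0\<bar>" using that by (simp add: dist_norm norm_minus_commute)
      then show ?thesis unfolding lap unfolding \<psi>_def
        by (simp add: Theta_0_support[OF f(2,4) L0] Theta_0_support[OF g2(1) support_derivative[OF f(3) support_derivative[OF f(2,4)]] L0])
    qed
    have int: "integrable lebesgue (\<lambda>x. h x * (laplacian \<psi> x + of_real (k\<^sup>2) * \<psi> x))" if h: "continuous_on UNIV h" for h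
    proof -
      have ch: "continuous_on UNIV (\<lambda>x. h x * (laplacian \<psi> x + of_real (k\<^sup>2) * \<psi> x))"
        by (intro continuous_on_mult h c)
      have "bounded ((\<lambda>x. h x * (laplacian \<psi> x + of_real (k\<^sup>2) * \<psi> x)) ` cball x0 (2 * L))"
        by (intro compact_imp_bounded compact_continuous_image continuous_on_subset[OF ch]) auto
      then obtain M where M: "M > 0" "\<And>x. x \<in> cball x0 (2 * L) \<Longrightarrow> norm (h x * (laplacian \<psi> x + of_real (k\<^sup>2) * \<psi> x)) \<le> M"
        unfolding bounded_pos by auto
      show ?thesis
      proof (rule integral_norm_le(1)[OF continuous_lebesgue_measurable[OF ch]])
        show "norm (h x * (laplacian \<psi> x + of_real (k\<^sup>2) * \<psi> x)) \<le> M" for x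
          using M supp[of x] by (cases "x \<in> cball x0 (2 * L)") auto
        show "h x * (laplacian \<psi> x + of_real (k\<^sup>2) * \<psi> x) = 0" if "x \<notin> cball x0 (2 * L)" for x
          using supp[OF that] by simp
      qed
    qed
    have uL: "u T \<in> L2" "u' T \<in> L2"
      using u T unfolding wave_cauchy_solution_def L2_C1_on_def L2_continuous_on_def by auto
    have m\<psi>: "\<psi> \<in> borel_measurable lebesgue" unfolding \<psi>_def by (rule Theta_0_measurable[OF sm(1)])
    have \<psi>L: "\<psi> \<in> L2"
    proof -
      have c\<psi>: "continuous_on UNIV \<psi>" unfolding \<psi>_def by (intro theta_alg_continuous theta_alg_Theta0 sm)
      have "bounded (\<psi> ` cball x0 (2 * L))"
        by (intro compact_imp_bounded compact_continuous_image continuous_on_subset[OF c\<psi>]) auto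
      then obtain M where M: "M > 0" "\<And>x. x \<in> cball x0 (2 * L) \<Longrightarrow> norm (\<psi> x) \<le> M" unfolding bounded_pos by auto
      have z: "\<psi> x = 0" if "x \<notin> cball x0 (2 * L)" for x
        unfolding \<psi>_def using that by (intro Theta_0_support[OF f(2,4) L0]) (auto simp: dist_norm norm_minus_commute)
      show ?thesis
        by (rule L2_bounded_support(1)[OF m\<psi>, of M x0 "2 * L"]) (use M z in \<open>force, auto\<close>)
    qed
    \<comment> \<open>The relation between \<open>g s - g (- s)\<close> and
      \<open>f s - f (- s)\<close> says that the test wave has final velocity
      \<open>- i k \<psi>\<close>. The quotient formulas hold off \<open>x0\<close>, hence almost
      everywhere.\<close>
    have "(LINT x|lebesgue. u T x * Theta 0 g1 0 (x - x0)) = (LINT x|lebesgue. \<i> * of_real k * (u T x * \<psi> x))"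
    proof (rule integral_cong_AE)
      show "AE x in lebesgue. u T x * Theta 0 g1 0 (x - x0) = \<i> * of_real k * (u T x * \<psi> x)"
        using AE_neq[of x0]
      proof eventually_elim
        case (elim x)
        then have "Theta 0 g1 0 (x - x0) = (g (norm (x - x0)) - g (- norm (x - x0))) / of_real (norm (x - x0))"
          by (subst Theta_0_eq[OF f(3)]) auto
        then show ?case unfolding f(5) \<psi>eq[OF elim] by simp
      qed
    qed (use uL m\<psi> Theta_0_measurable[OF sm(2)] in \<open>auto intro!: borel_measurable_times dest: L2_measurable\<close>)
    then have 1: "(LINT x|lebesgue. u T x * Theta 0 g1 0 (x - x0)) = \<i> * of_real k * (LINT x|lebesgue. u T x * \<psi> x)"
      by simp
    have 2: "(LINT x|lebesgue. F x * Theta 0 g T (x - x0)) = exp (\<i> * of_real (k * T)) * (LINT x|lebesgue. F x * \<psi> x)"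
    proof -
      have "(LINT x|lebesgue. F x * Theta 0 g T (x - x0)) = (LINT x|lebesgue. exp (\<i> * of_real (k * T)) * (F x * \<psi> x))"
      proof (rule integral_cong_AE)
        show "AE x in lebesgue. F x * Theta 0 g T (x - x0) = exp (\<i> * of_real (k * T)) * (F x * \<psi> x)"
          using F(2)
        proof eventually_elim
          case (elim x)
          show ?case
          proof (cases "x \<in> cball 0 \<epsilon>")
            case False
            then show ?thesis using elim by simp
          next
            case True
            define s where "s = norm (x - x0)"
            have s: "norm x0 - \<epsilon> \<le> s" "s \<le> norm x0 + \<epsilon>"
              using True norm_triangle_ineq4[of x x0] norm_triangle_ineq2[of x0 x] unfolding s_def by (auto simp: norm_minus_commute)
            \<comment> \<open>On the support of \<open>F\<close> all three arguments stay in
              \<open>[\<eta>, L]\<close>: the lower end uses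
              \<open>norm x0 \<ge> T + \<epsilon> + \<eta>\<close>, the upper end
              \<open>L \<ge> norm x0 + \<epsilon> + T\<close>. This is where the position of
              \<open>x0\<close> outside the larger ball enters.\<close>
            then have r: "T + s \<in> {\<eta>..L}" "s - T \<in> {\<eta>..L}" "s \<in> {\<eta>..L}" using \<eta> L1 T eps by auto
            have x: "x \<noteq> x0" using s \<eta> T by (auto simp: s_def)
            have "Theta 0 g T (x - x0) = (f (T + s) - f (T - s)) / of_real s"
              unfolding s_def using x by (subst Theta_0_eq[OF f(2)]) auto
            moreover have "f (T + s) - f (T - s) = exp (\<i> * of_real (k * (T + s)))" using f(6)[OF r(1,2)] by simp
            moreover have "exp (\<i> * of_real (k * (T + s))) = exp (\<i> * of_real (k * T)) * exp (\<i> * of_real (k * s))"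
              unfolding exp_add[symmetric] by (simp add: algebra_simps)
            moreover have "\<psi> x = exp (\<i> * of_real (k * s)) / of_real s"
              using \<psi>eq[OF x] f(6)[OF r(3,3)] by (simp add: s_def)
            ultimately show ?thesis by simp
          qed
        qed
      qed (use F m\<psi> Theta_0_measurable[OF sm(1)] in \<open>auto intro!: borel_measurable_times dest: L2_measurable\<close>)
      then show ?thesis by simp
    qed
    \<comment> \<open>The factor in the definition of \<open>G\<close> is minus the inverse of the
      phase by which the test wave at time \<open>0\<close> differs from \<open>\<psi>\<close> on
      the support of \<open>F\<close>.\<close>
    have 3: "(LINT x|lebesgue. G x * \<psi> x) = - (LINT x|lebesgue. F x * \<psi> x)"
    proof -
      let ?e = "exp (- \<i> * complex_of_real (k * T))"
      have "has_bochner_integral lebesgue (\<lambda>x. - ?e * (u' T x * \<psi> x + \<i> * of_real k * (u T x * \<psi> x)))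
         (- ?e * ((LINT x|lebesgue. u' T x * \<psi> x) + \<i> * of_real k * (LINT x|lebesgue. u T x * \<psi> x)))"
        by (intro has_bochner_integral_mult_right has_bochner_integral_add has_bochner_integral_integrable L2_mult_integrable uL \<psi>L)
      moreover have "(\<lambda>x. G x * \<psi> x) = (\<lambda>x. - ?e * (u' T x * \<psi> x + \<i> * of_real k * (u T x * \<psi> x)))"
        unfolding G by (rule ext) (simp only: algebra_simps)
      ultimately have "(LINT x|lebesgue. G x * \<psi> x) = - ?e * ((LINT x|lebesgue. u' T x * \<psi> x) + \<i> * of_real k * (LINT x|lebesgue. u T x * \<psi> x))"
        by (simp only: has_bochner_integral_integral_eq)
      also have "\<dots> = - ?e * (exp (\<i> * of_real (k * T)) * (LINT x|lebesgue. F x * \<psi> x))"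
        using wave_duality[OF T F(1) u f(1-4) L0, of x0] unfolding 1 2 by (simp add: \<psi>_def)
      also have "\<dots> = - (?e * exp (\<i> * of_real (k * T))) * (LINT x|lebesgue. F x * \<psi> x)" by simp
      also have "?e * exp (\<i> * of_real (k * T)) = 1" unfolding exp_add[symmetric] by simp
      finally show ?thesis by simp
    qed
    have "(LINT x|lebesgue. W x * (laplacian \<psi> x + of_real (k\<^sup>2) * \<psi> x)) = 0"
    proof -
      have "(LINT x|lebesgue. W x * (laplacian \<psi> x + of_real (k\<^sup>2) * \<psi> x)) =
        (LINT x|lebesgue. w x * (laplacian \<psi> x + of_real (k\<^sup>2) * \<psi> x)) + (LINT x|lebesgue. w' x * (laplacian \<psi> x + of_real (k\<^sup>2) * \<psi> x))"
        unfolding W_def distrib_right[of "w _"] by (rule Bochner_Integration.integral_add[OF int[OF wc(1)] int[OF wc(2)]])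
      also have "\<dots> = - (LINT x|lebesgue. F x * \<psi> x) - (LINT x|lebesgue. G x * \<psi> x)"
        using eqw(1)[OF test] eqw(2)[OF test] by (simp only: add_eq_0_iff2 diff_conv_add_uminus)
      finally show ?thesis using 3 by simp
    qed
    moreover have AEq: "AE x in lebesgue. W x * (laplacian \<psi> x + of_real (k\<^sup>2) * \<psi> x) = ?near x + ?far L x"
      using AE_neq[of x0]
    proof eventually_elim
      case (elim x)
      show ?case unfolding near_far[OF elim] by (rule distrib_left)
    qed
    ultimately have sum0: "(LINT x|lebesgue. ?near x + ?far L x) = 0"
      using integral_cong_AE[OF continuous_lebesgue_measurable[OF continuous_on_mult[OF W(1) c]] borel_measurable_add[OF mnear mfar] AEq]
      by simp
    \<comment> \<open>The shell part is integrable by a direct bound; the near part then is, as the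
      difference from the integrable sum, and the integral may be split.\<close>
    have ifar: "integrable lebesgue (?far L)"
    proof -
      have Lp: "L > 0" using L1 by simp
      obtain B1 where B1: "B1 \<ge> 0" "\<And>s. norm (K1 s) \<le> B1"
        by (rule compact_support_bounded[OF smK(1), of 1]) (use zero in auto)
      obtain B2 where B2: "B2 \<ge> 0" "\<And>s. norm (K2 s) \<le> B2"
        by (rule compact_support_bounded[OF smK(2), of 1]) (use zero in auto)
      have "bounded (W ` cball x0 (2 * L))"
        by (intro compact_imp_bounded compact_continuous_image continuous_on_subset[OF W(1)]) auto
      then obtain M where M: "M > 0" "\<And>x. x \<in> cball x0 (2 * L) \<Longrightarrow> norm (W x) \<le> M" unfolding bounded_pos by auto
      have z: "far k K1 K2 L s = 0" if "s < L \<or> s > 2 * L" for s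
      proof -
        have "2 / L * s < 2 \<or> 2 / L * s > 4" using that Lp by (auto simp: field_simps)
        then have "\<bar>2 / L * s - 3\<bar> \<ge> 1" by linarith
        from zero[OF this] show ?thesis unfolding far_def by simp
      qed
      let ?D = "2 / L^2 * B2 + 2 * k / L * B1"
      have D0: "?D \<ge> 0" using Lp k B1 B2 by simp
      have b: "norm (far k K1 K2 L s) \<le> ?D / L" if "s \<ge> L" for s
      proof -
        have "norm (of_real (2 / L^2) * K2 (2 / L * s - 3)) \<le> 2 / L^2 * B2"
          unfolding norm_mult norm_of_real using Lp B2 by (intro mult_mono) auto
        moreover have "norm (\<i> * of_real (2 * k / L) * K1 (2 / L * s - 3)) \<le> 2 * k / L * B1"
          unfolding norm_mult norm_of_real norm_ii using Lp k B1 by (intro mult_mono) auto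
        ultimately have "norm (of_real (2 / L^2) * K2 (2 / L * s - 3) + \<i> * of_real (2 * k / L) * K1 (2 / L * s - 3)) \<le> ?D"
          by (rule norm_triangle_mono)
        then show ?thesis
          unfolding far_def norm_divide norm_minus_cancel norm_of_real using that Lp D0 by (intro frac_le) auto
      qed
      show ?thesis
      proof (rule integral_norm_le(1)[OF mfar, of _ "M * (?D / L)" x0 "2 * L"])
        show "?far L x = 0" if "x \<notin> cball x0 (2 * L)" for x
          using z[of "norm (x - x0)"] that by (simp add: dist_norm norm_minus_commute)
        show "norm (?far L x) \<le> M * (?D / L)" for x
        proof (cases "norm (x - x0) < L \<or> norm (x - x0) > 2 * L")
          case True
          have "0 \<le> M * (?D / L)" using M(1) D0 Lp by (intro mult_nonneg_nonneg divide_nonneg_pos) auto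
          then show ?thesis using z[OF True] by simp
        next
          case False
          then have "x \<in> cball x0 (2 * L)" by (simp add: dist_norm norm_minus_commute)
          then show ?thesis
            unfolding norm_mult[of "W x"] norm_mult[of "far k K1 K2 L _"] norm_exp_i_times mult_1_right
            using M b[of "norm (x - x0)"] False by (intro mult_mono) auto
        qed
      qed
    qed
    have isum: "integrable lebesgue (\<lambda>x. ?near x + ?far L x)"
      using integrable_cong_AE[OF continuous_lebesgue_measurable[OF continuous_on_mult[OF W(1) c]] borel_measurable_add[OF mnear mfar] AEq] int[OF W(1)]
      by simp
    have inear: "integrable lebesgue ?near"
      using Bochner_Integration.integrable_diff[OF isum ifar] by simp
    show ?thesis using sum0 Bochner_Integration.integral_add[OF inear ifar] by (simp add: add_eq_0_iff)
  qed
  have "((\<lambda>L. LINT x|lebesgue. ?far L x) \<longlongrightarrow> 0) at_top"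
    by (rule far_decay[OF k W K zero])
  moreover have "\<forall>\<^sub>F L in at_top. (LINT x|lebesgue. ?far L x) = - (LINT x|lebesgue. ?near x)"
    using key eventually_at_top_linorder by blast
  ultimately have "((\<lambda>L::real. - (LINT x|lebesgue. ?near x)) \<longlongrightarrow> 0) at_top"
    by (rule Lim_transform_eventually)
  then have "- (LINT x|lebesgue. ?near x) = 0"
    by (simp add: tendsto_const_iff)
  then show ?thesis by (simp add: W_def)
qed

section \<open>Concentration at a point\<close>

text \<open>In the variable \<open>y\<close> with \<open>x = x0 + \<eta> y\<close> the kernel
  becomes, up to terms that vanish with \<open>\<eta>\<close>, the fixed function
  \<open>c (norm y) / norm y\<close> on the unit ball. The integrals tend to \<open>W x0\<close>
  times the integral of that function, which is nonzero because \<open>c\<close> keeps one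
  sign.\<close>

lemma near_integral_concentrates:
  fixes W :: "real^3 \<Rightarrow> complex" and x0 :: "real^3" and c :: "real \<Rightarrow> real"
  assumes k: "k > 0" and W: "continuous_on UNIV W" and \<eta>0: "\<eta>0 > 0"
    and H: "\<And>\<eta>. 0 < \<eta> \<Longrightarrow> \<eta> \<le> \<eta>0 \<Longrightarrow> (LINT x|lebesgue. W x * near k K1 K2 \<eta> (norm (x - x0))) = 0"
    and K: "smooth K1" "\<And>s. (K1 has_vector_derivative K2 s) (at s)" "\<And>s. K1 (- s) = K1 s"
    and zero: "\<And>s. \<bar>s\<bar> \<ge> 1 \<Longrightarrow> K1 s = 0 \<and> K2 s = 0"
    and c: "\<And>s. K2 s = complex_of_real (c s)" "\<And>s. 0 < s \<Longrightarrow> s < 1 \<Longrightarrow> c s < 0"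
  shows "W x0 = 0"
proof -
  have smK2: "smooth K2" using smooth_vector_derivative K by blast
  obtain K3 where K3: "\<And>s. (K2 has_vector_derivative K3 s) (at s)" "smooth K3" using smooth_deriv[OF smK2] by metis
  have z: "K1 s = 0" "K2 s = 0" if "\<bar>s\<bar> \<ge> 1" for s using zero[OF that] by auto
  have z3: "K3 s = 0" if "\<bar>s\<bar> > 1" for s
    by (rule support_derivative[OF K3(1) _ that]) (use z in auto)
  obtain B1 where B1: "B1 \<ge> 0" "\<And>s. norm (K1 s) \<le> B1"
    by (rule compact_support_bounded[OF K(1), of 1]) (use z in auto)
  obtain B3 where B3: "B3 \<ge> 0" "\<And>s. norm (K3 s) \<le> B3" using compact_support_bounded[OF K3(2) z3] by blast
  \<comment> \<open>Evenness of \<open>K1\<close> gives \<open>K2 0 = 0\<close>, and the Lipschitz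
    bound then keeps \<open>K2 (norm y) / norm y\<close> bounded near the origin, which the
    domination needs.\<close>
  have "K2 (- 0) = - 1 * K2 0" by (rule parity_derivative[OF K(2)]) (use K(3) in simp)
  then have K20: "K2 0 = 0" by simp
  have K2b: "norm (K2 s) \<le> B3 * \<bar>s\<bar>" for s
  proof -
    have "norm (K2 s - K2 0) \<le> B3 * norm (s - 0)"
    proof (rule differentiable_bound[of UNIV K2 "\<lambda>x h. h *\<^sub>R K3 x"])
      show "onorm (\<lambda>h. h *\<^sub>R K3 x) \<le> B3" for x
        using mult_left_mono[OF B3(2)[of x], of "\<bar>h\<bar>" for h] by (intro onorm_le) (simp add: mult_ac)
    qed (use K3(1) in \<open>auto simp: has_vector_derivative_def\<close>)
    then show ?thesis by (simp add: K20)
  qed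
  define e where "e = (\<lambda>n. \<eta>0 / real (Suc n))"
  have e: "e n > 0" "e n \<le> \<eta>0" for n using \<eta>0 by (simp_all add: e_def field_simps)
  have elim: "e \<longlonglongrightarrow> 0"
    using tendsto_mult[OF tendsto_const[of \<eta>0] LIMSEQ_inverse_real_of_nat] by (simp add: e_def divide_inverse)
  \<comment> \<open>The cube of the scale from the volume element cancels the two powers in the
    second derivative of the step and the one in \<open>1 / s\<close>.\<close>
  define \<phi> where "\<phi> = (\<lambda>n y. W (x0 + e n *\<^sub>R y) * ((K2 (norm y) * of_real (cos (k * (e n * norm y))) -
     of_real (2 * k * e n) * K1 (norm y) * of_real (sin (k * (e n * norm y)))) / of_real (norm y)))"
  have Kb: "K1 \<in> borel_measurable borel" "K2 \<in> borel_measurable borel"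
    by (intro borel_measurable_continuous_onI smooth_continuous K smK2)+
  have Wb: "W \<in> borel_measurable borel" by (rule borel_measurable_continuous_onI[OF W])
  have \<phi>0: "(LINT y|lebesgue. \<phi> n y) = 0" for n
  proof -
    let ?f = "\<lambda>x. W x * near k K1 K2 (e n) (norm (x - x0))"
    have "?f \<in> borel_measurable borel" unfolding near_def using Kb Wb by measurable
    from lebesgue_integral_affine[OF e(1)[of n] this, of x0]
    have "(LINT y|lebesgue. ?f (x0 + e n *\<^sub>R y)) = 0" using H[OF e] by simp
    moreover have "\<phi> n y = of_real (e n ^ 3) * ?f (x0 + e n *\<^sub>R y)" for y
    proof (cases "y = 0")
      case True
      then show ?thesis by (simp add: \<phi>_def near_def)
    next
      case False
      have "norm (x0 + e n *\<^sub>R y - x0) = e n * norm y" using e(1)[of n] by simp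
      moreover have "e n * norm y / e n = norm y" using e(1)[of n] by simp
      ultimately show ?thesis
        unfolding \<phi>_def near_def using e(1)[of n] False
        by (simp add: field_simps power2_eq_square power3_eq_cube)
    qed
    ultimately show ?thesis by simp
  qed
  have "bounded (W ` cball x0 \<eta>0)"
    by (intro compact_imp_bounded compact_continuous_image continuous_on_subset[OF W]) auto
  then obtain M where M: "M > 0" "\<And>x. x \<in> cball x0 \<eta>0 \<Longrightarrow> norm (W x) \<le> M" unfolding bounded_pos by auto
  define D where "D = M * (B3 + 2 * k * \<eta>0 * B1 * (k * \<eta>0))"
  have D0: "D \<ge> 0" using M B3 B1 k \<eta>0 by (simp add: D_def)
  have \<phi>b: "norm (\<phi> n y) \<le> D * indicator (cball 0 1) y" for n y
  proof (cases "norm y < 1 \<and> y \<noteq> 0")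
    case False
    then have "\<phi> n y = 0" using z[of "norm y"] by (auto simp: \<phi>_def)
    then show ?thesis using D0 by (simp add: indicator_def)
  next
    case True
    then have y: "norm y > 0" "norm y \<le> 1" by auto
    have "e n * norm y \<le> \<eta>0 * 1" using e[of n] y \<eta>0 by (intro mult_mono) auto
    then have "norm (W (x0 + e n *\<^sub>R y)) \<le> M" using e(1)[of n] by (intro M) (simp add: dist_norm)
    moreover have "norm ((K2 (norm y) * of_real (cos (k * (e n * norm y))) -
       of_real (2 * k * e n) * K1 (norm y) * of_real (sin (k * (e n * norm y)))) / of_real (norm y))
      \<le> B3 + 2 * k * \<eta>0 * B1 * (k * \<eta>0)"
    proof -
      have "norm (K2 (norm y) * of_real (cos (k * (e n * norm y)))) \<le> (B3 * norm y) * 1"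
        unfolding norm_mult norm_of_real using K2b[of "norm y"] B3(1) by (intro mult_mono) auto
      moreover have "norm (of_real (2 * k * e n) * K1 (norm y) * of_real (sin (k * (e n * norm y)))) \<le> (2 * k * \<eta>0) * B1 * (k * \<eta>0 * norm y)"
      proof -
        have "\<bar>sin (k * (e n * norm y))\<bar> \<le> \<bar>k * (e n * norm y)\<bar>" by (rule abs_sin_x_le_abs_x)
        also have "\<dots> = k * e n * norm y" using k e(1)[of n] by simp
        also have "\<dots> \<le> k * \<eta>0 * norm y" using k e[of n] by (intro mult_right_mono mult_left_mono) auto
        finally show ?thesis
          unfolding norm_mult norm_of_real using k e[of n] B1 \<eta>0
          by (intro mult_mono) (auto intro!: mult_nonneg_nonneg)
      qed
      ultimately have "norm (K2 (norm y) * of_real (cos (k * (e n * norm y))) -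
          of_real (2 * k * e n) * K1 (norm y) * of_real (sin (k * (e n * norm y))))
         \<le> (B3 * norm y) * 1 + (2 * k * \<eta>0) * B1 * (k * \<eta>0 * norm y)"
        by (intro order_trans[OF norm_triangle_ineq4] add_mono)
      then show ?thesis using y by (simp add: norm_divide divide_le_eq algebra_simps)
    qed
    ultimately have "norm (\<phi> n y) \<le> D"
      unfolding \<phi>_def D_def norm_mult[of "W _"] using M(1) by (intro mult_mono) auto
    then show ?thesis using y by (simp add: indicator_def)
  qed
  define h where "h = (\<lambda>y::real^3. - c (norm y) / norm y)"
  have lim: "(\<lambda>n. \<phi> n y) \<longlonglongrightarrow> W x0 * of_real (- h y)" for y
  proof -
    have "(\<lambda>n. x0 + e n *\<^sub>R y) \<longlonglongrightarrow> x0 + 0 *\<^sub>R y" by (intro tendsto_intros elim)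
    then have 1: "(\<lambda>n. W (x0 + e n *\<^sub>R y)) \<longlonglongrightarrow> W x0"
      using W by (intro isCont_tendsto_compose[of x0 W]) (auto simp: continuous_on_eq_continuous_at)
    have a: "(\<lambda>n. k * (e n * norm y)) \<longlonglongrightarrow> k * (0 * norm y)" "(\<lambda>n. 2 * k * e n) \<longlonglongrightarrow> 2 * k * 0"
      by (intro tendsto_intros elim)+
    have "(\<lambda>n. \<phi> n y) \<longlonglongrightarrow> W x0 * ((K2 (norm y) * of_real (cos (k * (0 * norm y))) -
       of_real (2 * k * 0) * K1 (norm y) * of_real (sin (k * (0 * norm y)))) * inverse (of_real (norm y)))"
      unfolding \<phi>_def divide_inverse
      by (intro tendsto_mult 1 tendsto_diff tendsto_const tendsto_of_real tendsto_cos tendsto_sin a)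
    then show ?thesis by (simp add: h_def c(1) divide_inverse)
  qed
  have cb: "c \<in> borel_measurable borel"
  proof -
    have "(\<lambda>s. Re (K2 s)) \<in> borel_measurable borel" using Kb(2) by measurable
    then show ?thesis by (simp add: c(1))
  qed
  have hm: "h \<in> borel_measurable lebesgue"
    unfolding h_def using cb by (intro measurable_completion; measurable)
  have h0: "h y \<ge> 0" for y
  proof (cases "norm y < 1 \<and> y \<noteq> 0")
    case True
    then have "c (norm y) < 0" by (intro c(2)) auto
    then show ?thesis unfolding h_def by (intro divide_nonneg_nonneg) auto
  next
    case False
    then have "y = 0 \<or> c (norm y) = 0" using z(2)[of "norm y"] c(1)[of "norm y"] by auto
    then show ?thesis by (auto simp: h_def)
  qed
  have hb: "\<bar>h y\<bar> \<le> B3 * indicator (cball 0 1) y" for y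
  proof (cases "norm y < 1 \<and> y \<noteq> 0")
    case True
    then show ?thesis using K2b[of "norm y"] c(1)[of "norm y"] by (simp add: h_def divide_le_eq indicator_def)
  next
    case False
    then have "y = 0 \<or> c (norm y) = 0" using z(2)[of "norm y"] c(1)[of "norm y"] by auto
    then show ?thesis using B3 by (auto simp: h_def indicator_def)
  qed
  have ib: "integrable lebesgue (\<lambda>y. C * indicator (cball 0 1 :: (real^3) set) y :: real)" for C
    using lmeasurable_cball[of 0 1] by (intro integrable_mult_right) (auto simp: fmeasurable_def)
  have ih: "integrable lebesgue h"
    by (rule Bochner_Integration.integrable_bound[OF ib[of B3] hm])
      (use hb in \<open>auto intro: order_trans[OF _ abs_ge_self]\<close>)
  have m\<phi>: "\<phi> n \<in> borel_measurable lebesgue" for n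
    unfolding \<phi>_def using Kb Wb by (intro measurable_completion; measurable)
  have "(\<lambda>n. LINT y|lebesgue. \<phi> n y) \<longlonglongrightarrow> (LINT y|lebesgue. W x0 * of_real (- h y))"
  proof (rule integral_dominated_convergence[where w = "\<lambda>y. D * indicator (cball 0 1) y"])
    show "(\<lambda>y. W x0 * of_real (- h y)) \<in> borel_measurable lebesgue"
      using hm by measurable
  qed (use \<phi>b lim ib m\<phi> in auto)
  then have "(LINT y|lebesgue. W x0 * complex_of_real (- h y)) = 0"
    unfolding \<phi>0 by (simp add: LIMSEQ_const_iff)
  then have "W x0 = 0 \<or> (LINT y|lebesgue. h y) = 0" by simp
  moreover have "(LINT y|lebesgue. h y) \<noteq> 0"
  proof
    assume "(LINT y|lebesgue. h y) = 0"
    then have "AE y in lebesgue. h y = 0"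
      using integral_nonneg_eq_0_iff_AE[OF ih] h0 by simp
    then obtain N where N: "negligible N" "{y. h y \<noteq> 0} \<subseteq> N"
      unfolding eventually_ae_filter_negligible by (elim exE conjE)
    \<comment> \<open>The origin is left out because division by zero makes \<open>h 0 = 0\<close>.
      What remains is open and nonempty, hence not negligible.\<close>
    have "{y::real^3. 0 < norm y \<and> norm y < 1} \<subseteq> {y. h y \<noteq> 0}"
    proof
      fix y :: "real^3" assume "y \<in> {y. 0 < norm y \<and> norm y < 1}"
      then have y: "0 < norm y" "norm y < 1" by auto
      then show "y \<in> {y. h y \<noteq> 0}" using c(2)[OF y] by (simp add: h_def)
    qed
    then have "negligible {y::real^3. 0 < norm y \<and> norm y < 1}"
      by (intro negligible_subset[OF N(1)] subset_trans[OF _ N(2)])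
    moreover have "open {y::real^3. 0 < norm y \<and> norm y < 1}"
      by (intro open_Collect_conj open_Collect_less continuous_intros)
    moreover have "{y::real^3. 0 < norm y \<and> norm y < 1} \<noteq> {}"
    proof -
      obtain y :: "real^3" where "norm y = 1 / 2" using vector_choose_size[of "1 / 2"] by auto
      then have "y \<in> {y. 0 < norm y \<and> norm y < 1}" by (simp del: zero_less_norm_iff)
      then show ?thesis by blast
    qed
    ultimately show False by (metis open_not_negligible)
  qed
  ultimately show ?thesis by blast
qed

theorem theorem2p1:
  fixes k \<epsilon> T :: real
    and F G w w' :: "real^3 \<Rightarrow> complex"
    and u u' :: "real \<Rightarrow> real^3 \<Rightarrow> complex"
  assumes "k > 0" and "\<epsilon> > 0" and "T > 2 * \<epsilon>"
    and "F \<in> L2"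
    and "AE x in lebesgue. x \<notin> cball 0 \<epsilon> \<longrightarrow> F x = 0"
    and "outgoing_solution k F w"
    and "wave_cauchy_solution T F u u'"
    and "\<And>x. G x = - exp (- \<i> * complex_of_real (k * T)) * (u' T x + \<i> * complex_of_real k * u T x)"
    and "outgoing_solution k G w'"
  shows "\<forall>x. x \<notin> cball 0 (T + \<epsilon>) \<longrightarrow> w x + w' x = 0"
proof (intro allI impI)
  fix x0 :: "real^3" assume "x0 \<notin> cball 0 (T + \<epsilon>)"
  then have x0: "norm x0 > T + \<epsilon>" by simp
  have T: "T > 0" using assms(2,3) by simp
  obtain kap kap' kap'' where kap: "smooth (\<lambda>s. complex_of_real (kap s))"
     "\<And>s. (kap has_real_derivative kap' s) (at s)"
     "\<And>s. (kap' has_real_derivative kap'' s) (at s)"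
     "\<And>s. kap (- s) = - kap s" "\<And>s. s \<ge> 1 \<Longrightarrow> kap s = 1"
     "\<And>s. \<bar>s\<bar> \<ge> 1 \<Longrightarrow> kap' s = 0 \<and> kap'' s = 0" "\<And>s. 0 < s \<Longrightarrow> s < 1 \<Longrightarrow> kap'' s < 0"
    using step_exists by metis
  let ?K1 = "\<lambda>s. complex_of_real (kap' s)" and ?K2 = "\<lambda>s. complex_of_real (kap'' s)"
  have d: "((\<lambda>s. complex_of_real (kap s)) has_vector_derivative ?K1 s) (at s)"
    "(?K1 has_vector_derivative ?K2 s) (at s)" for s
    by (rule has_vector_derivative_of_real[OF kap(2)], rule has_vector_derivative_of_real[OF kap(3)])
  have even: "?K1 (- s) = ?K1 s" for s
    using parity_derivative[OF d(1), of "-1" s] kap(4) by simp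
  have zero: "?K1 s = 0 \<and> ?K2 s = 0" if "\<bar>s\<bar> \<ge> 1" for s using kap(6)[OF that] by simp
  \<comment> \<open>Every positive \<open>\<eta>\<close> up to the distance of \<open>x0\<close>
    from the ball of radius \<open>T + \<epsilon>\<close> is admissible.\<close>
  show "w x0 + w' x0 = 0"
  proof (rule near_integral_concentrates[OF assms(1), of "\<lambda>x. w x + w' x" "norm x0 - T - \<epsilon>" ?K1 ?K2 x0 kap''])
    show "continuous_on UNIV (\<lambda>x. w x + w' x)"
      using assms(6,9) unfolding outgoing_solution_def by (intro continuous_on_add) blast+
    show "norm x0 - T - \<epsilon> > 0" using x0 by simp
    show "smooth ?K1" using smooth_vector_derivative[OF kap(1) d(1)] .
    show "(LINT x|lebesgue. (w x + w' x) * near k ?K1 ?K2 \<eta> (norm (x - x0))) = 0"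
      if "0 < \<eta>" "\<eta> \<le> norm x0 - T - \<epsilon>" for \<eta>
      using that kap(4,5)
      by (intro near_integral_zero[OF assms(1,2) T assms(4-9) kap(1) d _ _ zero]) auto
  qed (use d even zero kap(7) in auto)
qed

end
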